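(* Let $M^{n-1}$ be a totally biharmonic hypersurface of a space form $N^n(\rho)$ of constant sectional curvature $\rho$. If $\rho\le 0$, then $M^{n-1}$ is locally a totally geodesic hypersurface. If $\rho>0$, then, after rescaling so that $N^n(\rho)\cong\mathbb{S}^n(1)=\mathbb{S}^n[1]$, $M^{n-1}$ is, locally, either a totally geodesic hypersurface or one of the following: (i) a part of the totally umbilical sphere $\mathbb{S}^{n-1}[1/\sqrt2]$; (ii) a part of a generalized Clifford torus $\mathbb{S}^p[1/\sqrt2]\times\mathbb{S}^{n-p-1}[1/\sqrt2]$, for some integer $p$ with $0<p<n-1$.
   Context: $N^n(\rho)$ denotes the hyperbolic space $\mathbb{H}^n(\rho)$ if $\rho<0$, Euclidean space $\mathbb{R}^n$ if $\rho=0$, and the round sphere $\mathbb{S}^n(\rho)$ of constant sectional curvature $\rho$ if $\rho>0$. $\mathbb{S}^k[R]$ denotes the round $k$-sphere of radius $R$. In $\mathbb{S}^n[1]\subset\mathbb{R}^{n+1}$, $\mathbb{S}^{n-1}[1/\sqrt2]$ is the small hypersphere of radius $1/\sqrt2$ (intersection of the unit sphere with an affine hyperplane at distance $1/\sqrt2$ from the origin), and $\mathbb{S}^p[1/\sqrt2]\times\mathbb{S}^{n-p-1}[1/\sqrt2]\subset\mathbb{R}^{p+1}\times\mathbb{R}^{n-p}=\mathbb{R}^{n+1}$ is the product of spheres centred at the origin; "a part of" means an open subset, up to isometries of $\mathbb{S}^n[1]$. A hypersurface is a connected manifold $M^{n-1}$ with a smooth isometric immersion $\varphi:M^{n-1}\to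 N^n$ and unit normal vector field. A unit-speed curve $\gamma$ in a Riemannian manifold $N$, with $\mathbf t=\gamma'$, is biharmonic if $\nabla_{\mathbf t}^3\mathbf t+R^N(\nabla_{\mathbf t}\mathbf t,\mathbf t)\mathbf t=0$, where $R^N(X,Y)=\nabla_X\nabla_Y-\nabla_Y\nabla_X-\nabla_{[X,Y]}$. A hypersurface is totally biharmonic if every unit-speed geodesic $\gamma$ of $M$ is such that $\varphi\circ\gamma$ is a biharmonic curve of $N$. *)

theory Defs
  imports "HOL-Analysis.Analysis"
begin

section \<open>Smooth maps between Euclidean spaces\<close>

text \<open>Only used on open sets: all iterated directional derivatives up to order \<open>k\<close> exist and are
  continuous, which in finite dimension is the usual \<open>C\<^sup>k\<close> condition.\<close>

primrec Ck_on :: "nat \<Rightarrow> ('a::euclidean_space \<Rightarrow> 'b::euclidean_space) \<Rightarrow> 'a set \<Rightarrow> bool" where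
  "Ck_on 0 f S \<longleftrightarrow> continuous_on S f"
| "Ck_on (Suc k) f S \<longleftrightarrow>
     (\<forall>x\<in>S. f differentiable (at x)) \<and> (\<forall>v. Ck_on k (\<lambda>x. frechet_derivative f (at x) v) S)"

definition smooth_on :: "('a::euclidean_space \<Rightarrow> 'b::euclidean_space) \<Rightarrow> 'a set \<Rightarrow> bool" where
  "smooth_on f S \<longleftrightarrow> (\<forall>k. Ck_on k f S)"

section \<open>Riemannian geometry in one chart\<close>

text \<open>Here \<open>g x u v\<close> is the metric at \<open>x\<close> in a chart with values in the Euclidean space \<open>'e\<close>.\<close>

type_synonym 'e local_metric = "'e \<Rightarrow> 'e \<Rightarrow> 'e \<Rightarrow> real"

text \<open>\<open>christoffel g x u v\<close> has components \<open>\<Sum>i j. \<Gamma>\<^sup>k\<^sub>i\<^sub>j u\<^sup>i v\<^sup>j\<close>; it is determined by the Koszul formula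
  for vector fields that are constant in the chart.\<close>

definition christoffel :: "'e::euclidean_space local_metric \<Rightarrow> 'e \<Rightarrow> 'e \<Rightarrow> 'e \<Rightarrow> 'e" where
  "christoffel g x u v = (THE z. \<forall>w. 2 * g x z w =
      frechet_derivative (\<lambda>y. g y v w) (at x) u
    + frechet_derivative (\<lambda>y. g y u w) (at x) v
    - frechet_derivative (\<lambda>y. g y u v) (at x) w)"

definition nabla ::
  "'e::euclidean_space local_metric \<Rightarrow> ('e \<Rightarrow> 'e) \<Rightarrow> ('e \<Rightarrow> 'e) \<Rightarrow> 'e \<Rightarrow> 'e" where
  "nabla g X Y = (\<lambda>x. frechet_derivative Y (at x) (X x) + christoffel g x (X x) (Y x))"

definition lie_bracket :: "('e::euclidean_space \<Rightarrow> 'e) \<Rightarrow> ('e \<Rightarrow> 'e) \<Rightarrow> 'e \<Rightarrow> 'e" where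
  "lie_bracket X Y = (\<lambda>x. frechet_derivative Y (at x) (X x) - frechet_derivative X (at x) (Y x))"

definition curvature_field ::
  "'e::euclidean_space local_metric \<Rightarrow> ('e \<Rightarrow> 'e) \<Rightarrow> ('e \<Rightarrow> 'e) \<Rightarrow> ('e \<Rightarrow> 'e) \<Rightarrow> 'e \<Rightarrow> 'e" where
  "curvature_field g X Y Z = (\<lambda>x.
     nabla g X (nabla g Y Z) x - nabla g Y (nabla g X Z) x - nabla g (lie_bracket X Y) Z x)"

text \<open>The value \<open>R(u,v)w\<close> at a point does not depend on the vector fields extending \<open>u\<close>, \<open>v\<close>, \<open>w\<close>;
  the extensions that are constant in the chart are used.\<close>

definition curvature_tensor ::
  "'e::euclidean_space local_metric \<Rightarrow> 'e \<Rightarrow> 'e \<Rightarrow> 'e \<Rightarrow> 'e \<Rightarrow> 'e" where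
  "curvature_tensor g x u v w = curvature_field g (\<lambda>_. u) (\<lambda>_. v) (\<lambda>_. w) x"

definition velocity :: "(real \<Rightarrow> 'e::euclidean_space) \<Rightarrow> real \<Rightarrow> 'e" where
  "velocity a = (\<lambda>t. vector_derivative a (at t))"

text \<open>Covariant derivative of the vector field \<open>W\<close> along the curve \<open>a\<close>.\<close>

definition nabla_along ::
  "'e::euclidean_space local_metric \<Rightarrow> (real \<Rightarrow> 'e) \<Rightarrow> (real \<Rightarrow> 'e) \<Rightarrow> real \<Rightarrow> 'e" where
  "nabla_along g a W = (\<lambda>t. vector_derivative W (at t) + christoffel g (a t) (velocity a t) (W t))"

section \<open>Riemannian manifolds\<close>

text \<open>A chart is a pair (domain, coordinate map); the coordinate map is irrelevant off the domain.
  \<open>metric_in M c\<close> is the metric of \<open>M\<close> in the chart \<open>c\<close>.\<close>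

type_synonym ('p, 'e) chart = "'p set \<times> ('p \<Rightarrow> 'e)"

record ('p, 'e) riemannian =
  mtop :: "'p topology"
  charts :: "('p, 'e) chart set"
  metric_in :: "('p, 'e) chart \<Rightarrow> 'e local_metric"

definition chart_inv :: "('p, 'e) chart \<Rightarrow> 'e \<Rightarrow> 'p" where
  "chart_inv c = inv_into (fst c) (snd c)"

definition rep :: "('p \<Rightarrow> 'q) \<Rightarrow> ('p, 'e) chart \<Rightarrow> ('q, 'f) chart \<Rightarrow> 'e \<Rightarrow> 'f" where
  "rep \<phi> c d = snd d \<circ> \<phi> \<circ> chart_inv c"

definition rep_dom :: "('p \<Rightarrow> 'q) \<Rightarrow> ('p, 'e) chart \<Rightarrow> ('q, 'f) chart \<Rightarrow> 'e set" where
  "rep_dom \<phi> c d = snd c ` (fst c \<inter> \<phi> -` fst d)"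

definition smooth_atlas :: "'p topology \<Rightarrow> ('p, 'e::euclidean_space) chart set \<Rightarrow> bool" where
  "smooth_atlas X A \<longleftrightarrow>
     (\<Union>c\<in>A. fst c) = topspace X \<and>
     (\<forall>c\<in>A. openin X (fst c) \<and> open (snd c ` fst c) \<and>
        homeomorphic_map (subtopology X (fst c)) (top_of_set (snd c ` fst c)) (snd c)) \<and>
     (\<forall>c\<in>A. \<forall>d\<in>A. smooth_on (rep (\<lambda>p. p) c d) (rep_dom (\<lambda>p. p) c d))"

definition local_riemannian_metric :: "'e::euclidean_space local_metric \<Rightarrow> 'e set \<Rightarrow> bool" where
  "local_riemannian_metric g S \<longleftrightarrow>
     (\<forall>u v. smooth_on (\<lambda>x. g x u v) S) \<and>
     (\<forall>x\<in>S. bilinear (g x) \<and> (\<forall>u v. g x u v = g x v u) \<and> (\<forall>u. u \<noteq> 0 \<longrightarrow> g x u u > 0))"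

text \<open>\<open>\<phi>\<close> pulls the metric of \<open>N\<close> back to the metric of \<open>M\<close>. For \<open>M = N\<close> and the identity this
  says that the local metrics of the different charts fit together.\<close>

definition preserves_metric ::
  "('p, 'm::euclidean_space) riemannian \<Rightarrow> ('q, 'n::euclidean_space) riemannian \<Rightarrow> ('p \<Rightarrow> 'q) \<Rightarrow> bool"
where
  "preserves_metric M N \<phi> \<longleftrightarrow>
     (\<forall>c\<in>charts M. \<forall>d\<in>charts N. \<forall>x\<in>rep_dom \<phi> c d. \<forall>u v.
        metric_in M c x u v =
        metric_in N d (rep \<phi> c d x)
          (frechet_derivative (rep \<phi> c d) (at x) u) (frechet_derivative (rep \<phi> c d) (at x) v))"

definition riemannian_manifold :: "('p, 'e::euclidean_space) riemannian \<Rightarrow> bool" where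
  "riemannian_manifold M \<longleftrightarrow>
     Hausdorff_space (mtop M) \<and> second_countable (mtop M) \<and> smooth_atlas (mtop M) (charts M) \<and>
     (\<forall>c\<in>charts M. local_riemannian_metric (metric_in M c) (snd c ` fst c)) \<and>
     preserves_metric M M (\<lambda>p. p)"

definition smooth_map ::
  "('p, 'm::euclidean_space) riemannian \<Rightarrow> ('q, 'n::euclidean_space) riemannian \<Rightarrow> ('p \<Rightarrow> 'q) \<Rightarrow> bool"
where
  "smooth_map M N \<phi> \<longleftrightarrow>
     continuous_map (mtop M) (mtop N) \<phi> \<and>
     (\<forall>c\<in>charts M. \<forall>d\<in>charts N. smooth_on (rep \<phi> c d) (rep_dom \<phi> c d))"

definition isometric_immersion ::
  "('p, 'm::euclidean_space) riemannian \<Rightarrow> ('q, 'n::euclidean_space) riemannian \<Rightarrow> ('p \<Rightarrow> 'q) \<Rightarrow> bool"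
where
  "isometric_immersion M N \<phi> \<longleftrightarrow>
     smooth_map M N \<phi> \<and>
     (\<forall>c\<in>charts M. \<forall>d\<in>charts N. \<forall>x\<in>rep_dom \<phi> c d.
        inj (frechet_derivative (rep \<phi> c d) (at x))) \<and>
     preserves_metric M N \<phi>"

text \<open>A vector field along \<open>\<phi>\<close> is given by its components \<open>\<xi> d p\<close> in each chart \<open>d\<close> of \<open>N\<close> around
  \<open>\<phi> p\<close>; the second conjunct is the transformation law of tangent vectors.\<close>

definition unit_normal_field ::
  "('p, 'm::euclidean_space) riemannian \<Rightarrow> ('q, 'n::euclidean_space) riemannian \<Rightarrow> ('p \<Rightarrow> 'q) \<Rightarrow>
   (('q, 'n) chart \<Rightarrow> 'p \<Rightarrow> 'n) \<Rightarrow> bool"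
where
  "unit_normal_field M N \<phi> \<xi> \<longleftrightarrow>
     (\<forall>c\<in>charts M. \<forall>d\<in>charts N. smooth_on (\<lambda>x. \<xi> d (chart_inv c x)) (rep_dom \<phi> c d)) \<and>
     (\<forall>p\<in>topspace (mtop M). \<forall>d\<in>charts N. \<forall>d'\<in>charts N. \<phi> p \<in> fst d \<inter> fst d' \<longrightarrow>
        \<xi> d' p = frechet_derivative (rep (\<lambda>q. q) d d') (at (snd d (\<phi> p))) (\<xi> d p)) \<and>
     (\<forall>p\<in>topspace (mtop M). \<forall>d\<in>charts N. \<phi> p \<in> fst d \<longrightarrow>
        metric_in N d (snd d (\<phi> p)) (\<xi> d p) (\<xi> d p) = 1) \<and>
     (\<forall>c\<in>charts M. \<forall>d\<in>charts N. \<forall>x\<in>rep_dom \<phi> c d. \<forall>u.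
        metric_in N d (rep \<phi> c d x)
          (\<xi> d (chart_inv c x)) (frechet_derivative (rep \<phi> c d) (at x) u) = 0)"

definition hypersurface ::
  "('p, 'm::euclidean_space) riemannian \<Rightarrow> ('q, 'n::euclidean_space) riemannian \<Rightarrow> ('p \<Rightarrow> 'q) \<Rightarrow> bool"
where
  "hypersurface M N \<phi> \<longleftrightarrow>
     DIM('n) = DIM('m) + 1 \<and> riemannian_manifold M \<and> connected_space (mtop M) \<and>
     isometric_immersion M N \<phi> \<and> (\<exists>\<xi>. unit_normal_field M N \<phi> \<xi>)"

section \<open>Geodesics and biharmonic curves\<close>

definition smooth_curve ::
  "('p, 'e::euclidean_space) riemannian \<Rightarrow> real set \<Rightarrow> (real \<Rightarrow> 'p) \<Rightarrow> bool" where
  "smooth_curve M I \<gamma> \<longleftrightarrow>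
     open I \<and> is_interval I \<and> continuous_map (top_of_set I) (mtop M) \<gamma> \<and>
     (\<forall>c\<in>charts M. smooth_on (snd c \<circ> \<gamma>) (I \<inter> \<gamma> -` fst c))"

definition unit_speed ::
  "('p, 'e::euclidean_space) riemannian \<Rightarrow> real set \<Rightarrow> (real \<Rightarrow> 'p) \<Rightarrow> bool" where
  "unit_speed M I \<gamma> \<longleftrightarrow>
     (\<forall>t\<in>I. \<forall>c\<in>charts M. \<gamma> t \<in> fst c \<longrightarrow>
        metric_in M c (snd c (\<gamma> t)) (velocity (snd c \<circ> \<gamma>) t) (velocity (snd c \<circ> \<gamma>) t) = 1)"

definition geodesic ::
  "('p, 'e::euclidean_space) riemannian \<Rightarrow> real set \<Rightarrow> (real \<Rightarrow> 'p) \<Rightarrow> bool" where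
  "geodesic M I \<gamma> \<longleftrightarrow>
     smooth_curve M I \<gamma> \<and>
     (\<forall>t\<in>I. \<forall>c\<in>charts M. \<gamma> t \<in> fst c \<longrightarrow>
        nabla_along (metric_in M c) (snd c \<circ> \<gamma>) (velocity (snd c \<circ> \<gamma>)) t = 0)"

definition biharmonic_curve ::
  "('q, 'e::euclidean_space) riemannian \<Rightarrow> real set \<Rightarrow> (real \<Rightarrow> 'q) \<Rightarrow> bool" where
  "biharmonic_curve N I \<gamma> \<longleftrightarrow>
     smooth_curve N I \<gamma> \<and> unit_speed N I \<gamma> \<and>
     (\<forall>t\<in>I. \<forall>c\<in>charts N. \<gamma> t \<in> fst c \<longrightarrow>
        (let g = metric_in N c; a = snd c \<circ> \<gamma>; T = velocity a; D = nabla_along g a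
         in (D ^^ 3) T t + curvature_tensor g (a t) (D T t) (T t) (T t) = 0))"

definition totally_biharmonic ::
  "('p, 'm::euclidean_space) riemannian \<Rightarrow> ('q, 'n::euclidean_space) riemannian \<Rightarrow> ('p \<Rightarrow> 'q) \<Rightarrow> bool"
where
  "totally_biharmonic M N \<phi> \<longleftrightarrow>
     (\<forall>I \<gamma>. geodesic M I \<gamma> \<and> unit_speed M I \<gamma> \<longrightarrow> biharmonic_curve N I (\<phi> \<circ> \<gamma>))"

definition totally_geodesic_on ::
  "'p set \<Rightarrow> ('p, 'm::euclidean_space) riemannian \<Rightarrow> ('q, 'n::euclidean_space) riemannian \<Rightarrow>
   ('p \<Rightarrow> 'q) \<Rightarrow> bool"
where
  "totally_geodesic_on W M N \<phi> \<longleftrightarrow>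
     (\<forall>I \<gamma>. geodesic M I \<gamma> \<and> \<gamma> ` I \<subseteq> W \<longrightarrow> geodesic N I (\<phi> \<circ> \<gamma>))"

definition locally_totally_geodesic ::
  "('p, 'm::euclidean_space) riemannian \<Rightarrow> ('q, 'n::euclidean_space) riemannian \<Rightarrow> ('p \<Rightarrow> 'q) \<Rightarrow> bool"
where
  "locally_totally_geodesic M N \<phi> \<longleftrightarrow>
     (\<forall>p\<in>topspace (mtop M). \<exists>W. openin (mtop M) W \<and> p \<in> W \<and> totally_geodesic_on W M N \<phi>)"

section \<open>Space forms\<close>

text \<open>A submanifold \<open>S\<close> of a Euclidean space \<open>'v\<close>, with its maximal atlas (the inverses of all
  injectively immersed local parametrisations that are homeomorphisms onto open subsets of \<open>S\<close>) and
  with the metric induced by a constant symmetric bilinear form \<open>B\<close> on \<open>'v\<close>.\<close>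

definition submanifold_charts :: "'v::euclidean_space set \<Rightarrow> ('v, 'e::euclidean_space) chart set" where
  "submanifold_charts S = {c.
     openin (top_of_set S) (fst c) \<and> open (snd c ` fst c) \<and>
     homeomorphic_map (top_of_set (fst c)) (top_of_set (snd c ` fst c)) (snd c) \<and>
     smooth_on (chart_inv c) (snd c ` fst c) \<and>
     (\<forall>x \<in> snd c ` fst c. inj (frechet_derivative (chart_inv c) (at x)))}"

definition submanifold ::
  "('v::euclidean_space \<Rightarrow> 'v \<Rightarrow> real) \<Rightarrow> 'v set \<Rightarrow> ('v, 'e::euclidean_space) riemannian" where
  "submanifold B S =
     \<lparr> mtop = top_of_set S,
       charts = submanifold_charts S,
       metric_in = (\<lambda>c x u v. B (frechet_derivative (chart_inv c) (at x) u)
                                (frechet_derivative (chart_inv c) (at x) v)) \<rparr>"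

definition lorentz :: "'n::euclidean_space \<times> real \<Rightarrow> 'n \<times> real \<Rightarrow> real" where
  "lorentz v w = fst v \<bullet> fst w - snd v * snd w"

text \<open>With \<open>n = DIM('n)\<close>, all models of \<open>N\<^sup>n(\<rho>)\<close> are realised in \<open>'n \<times> real\<close>, i.e. in
  \<open>\<real>\<^sup>n\<^sup>+\<^sup>1\<close>: one sheet of the hyperboloid in Minkowski space for \<open>\<rho> < 0\<close>, the hyperplane
  \<open>\<real>\<^sup>n \<times> {0}\<close> for \<open>\<rho> = 0\<close>, and the sphere of radius \<open>1 / sqrt \<rho>\<close> for \<open>\<rho> > 0\<close>.\<close>

definition space_form :: "real \<Rightarrow> ('n::euclidean_space \<times> real, 'n) riemannian" where
  "space_form \<rho> =
     (if \<rho> < 0 then submanifold lorentz {v. lorentz v v = 1 / \<rho> \<and> snd v > 0}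
      else if \<rho> = 0 then submanifold (\<bullet>) {v. snd v = 0}
      else submanifold (\<bullet>) (sphere 0 (1 / sqrt \<rho>)))"

text \<open>The intersection of the unit sphere with an affine hyperplane at distance \<open>1 / sqrt 2\<close> from
  the origin.\<close>

definition small_hypersphere :: "('n::euclidean_space \<times> real) set" where
  "small_hypersphere = sphere 0 1 \<inter> {v. snd v = 1 / sqrt 2}"

text \<open>The product of the two spheres of radius \<open>1 / sqrt 2\<close> centred at the origin in the factors of
  the orthogonal decomposition \<open>E \<oplus> E\<^sup>\<bottom>\<close>; for \<open>dim E = p + 1\<close> in \<open>\<real>\<^sup>n\<^sup>+\<^sup>1\<close> this is
  \<open>S\<^sup>p[1 / sqrt 2] \<times> S\<^sup>n\<^sup>-\<^sup>p\<^sup>-\<^sup>1[1 / sqrt 2]\<close>.\<close>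

definition clifford_torus :: "'v::euclidean_space set \<Rightarrow> 'v set" where
  "clifford_torus E =
     {a + b | a b. a \<in> E \<and> norm a = 1 / sqrt 2 \<and> b \<in> E\<^sup>\<bottom> \<and> norm b = 1 / sqrt 2}"

text \<open>Every point of \<open>M\<close> has a neighbourhood that \<open>\<psi>\<close> embeds as an open subset of \<open>S\<close>, up to an
  isometry of the unit sphere, i.e. (the restriction of) an orthogonal transformation.\<close>

definition locally_part_of ::
  "('p, 'm::euclidean_space) riemannian \<Rightarrow> ('p \<Rightarrow> 'v::euclidean_space) \<Rightarrow> 'v set \<Rightarrow> bool" where
  "locally_part_of M \<psi> S \<longleftrightarrow>
     (\<forall>p\<in>topspace (mtop M). \<exists>W F. openin (mtop M) W \<and> p \<in> W \<and>
        embedding_map (subtopology (mtop M) W) euclidean \<psi> \<and>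
        orthogonal_transformation F \<and> openin (top_of_set S) (F ` \<psi> ` W))"

end

theory Submission
  imports Defs
begin

text \<open>All computations take place in the ambient vector space, with position \<open>\<eta>\<close>, unit normal \<open>\<nu>\<close> and
  the Euclidean or Lorentzian form \<open>B\<close>. Along a unit-speed geodesic of \<open>M\<close> with normal curvature \<open>k\<close>
  the biharmonic equation yields \<open>k k' = 0\<close> and then \<open>k (\<rho> - B \<nu>' \<nu>') = 0\<close>. With shape operator \<open>A\<close>,
  the product of the quadratic forms \<open>\<langle>A u, u\<rangle>\<close> and \<open>\<rho> |u|\<^sup>2 - |A u|\<^sup>2\<close> therefore vanishes
  identically on each tangent space, so one of the factors does: \<open>A = 0\<close> or \<open>A\<^sup>2 = \<rho>\<close>. The second
  case needs \<open>\<rho> > 0\<close>, and by connectedness one alternative holds everywhere.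

  If \<open>A\<^sup>2 = \<rho>\<close>, rescale to the unit sphere and let \<open>R\<close> be the linear map of the ambient space that exchanges
  position \<open>\<psi>\<close> and normal \<open>\<nu>\<close> and restricts to \<open>d\<psi> u \<mapsto> d\<nu> u\<close>. It is an orthogonal involution,
  and the Codazzi equation makes it constant on \<open>M\<close>. Hence \<open>\<nu> = R \<psi>\<close>, and \<open>\<psi>\<close> is the sum of two
  components of norm \<open>1 / sqrt 2\<close> in the eigenspaces of \<open>R\<close>.\<close>

text \<open>The biharmonic equation is available only along geodesics, so information on
  \<open>A\<close> at a point requires a geodesic through it with each unit initial velocity. This
  calls for local existence for ODEs and, because \<open>christoffel\<close> is defined by a linear
  equation, for smooth dependence of solutions of linear systems on parameters. That different
  tangent directions cannot choose different alternatives is algebra: a polynomial ring over the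
  reals has no zero divisors. The three models are treated together by means of one extra normal
  direction, the position vector for \<open>\<rho> \<noteq> 0\<close> and the constant vector
  \<open>(0, 1)\<close> for \<open>\<rho> = 0\<close>. The radius \<open>1 / sqrt 2\<close> comes
  from \<open>R\<close>: since \<open>\<psi>\<close> and \<open>R \<psi> = \<nu>\<close> are
  orthonormal, \<open>(\<psi> + \<nu>) / 2\<close> and \<open>(\<psi> - \<nu>) / 2\<close> have
  equal norms. For the same reason \<open>R\<close> is neither the identity nor its negative. If one
  eigenspace is a line, the product of spheres degenerates to two parallel small hyperspheres; this
  is where the umbilical case comes from.\<close>

abbreviation DD :: "('a::real_normed_vector \<Rightarrow> 'b::real_normed_vector) \<Rightarrow> 'a \<Rightarrow> 'a \<Rightarrow> 'b" where
  "DD f x v \<equiv> frechet_derivative f (at x) v"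

section \<open>Calculus of smooth maps\<close>

lemma DD_cong:
  assumes "open S" "x \<in> S" "\<And>y. y \<in> S \<Longrightarrow> f y = g y"
  shows "frechet_derivative f (at x) = frechet_derivative g (at x)"
proof -
  have "(f has_derivative F) (at x) \<longleftrightarrow> (g has_derivative F) (at x)" for F
    using assms has_derivative_transform_within_open[of f F x UNIV S g]
      has_derivative_transform_within_open[of g F x UNIV S f] by auto
  then show ?thesis by (simp add: frechet_derivative_def)
qed

lemma has_derivative_DD: "f differentiable (at x) \<Longrightarrow> (f has_derivative DD f x) (at x)"
  by (simp add: frechet_derivative_works)

lemma DD_eq: "(f has_derivative F) (at x) \<Longrightarrow> frechet_derivative f (at x) = F"
  using frechet_derivative_at by metis

lemma differentiable_cong_open:
  assumes "open S" "x \<in> S" "\<And>y. y \<in> S \<Longrightarrow> f y = g y" "f differentiable (at x)"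
  shows "g differentiable (at x)"
  using assms has_derivative_transform_within_open[of f _ x UNIV S g]
  unfolding differentiable_def by blast

lemma Ck_on_subset: "Ck_on k f S \<Longrightarrow> T \<subseteq> S \<Longrightarrow> Ck_on k f T"
  by (induction k arbitrary: f) (auto intro: continuous_on_subset)

lemma Ck_on_cong:
  assumes "open S" "\<And>x. x \<in> S \<Longrightarrow> f x = g x" "Ck_on k f S"
  shows "Ck_on k g S"
  using assms(2,3)
proof (induction k arbitrary: f g)
  case 0
  then show ?case using continuous_on_cong[of S S f g] by auto
next
  case (Suc k)
  have "g differentiable (at x)" if "x \<in> S" for x
    using Suc.prems that differentiable_cong_open[OF assms(1) that, of f g] by auto
  moreover have "Ck_on k (\<lambda>x. DD g x v) S" for v
  proof (rule Suc.IH)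
    show "DD f x v = DD g x v" if "x \<in> S" for x
      using DD_cong[OF assms(1) that Suc.prems(1)] by simp
    show "Ck_on k (\<lambda>x. DD f x v) S" using Suc.prems(2) by simp
  qed
  ultimately show ?case by simp
qed

lemma Ck_on_continuous_on: "Ck_on k f S \<Longrightarrow> continuous_on S f"
proof (cases k)
  case (Suc j)
  moreover assume "Ck_on k f S"
  ultimately have "f differentiable_on S"
    by (auto simp: differentiable_on_def differentiable_at_withinI)
  then show ?thesis by (rule differentiable_imp_continuous_on)
qed simp

lemma Ck_on_Suc_D: "Ck_on (Suc k) f S \<Longrightarrow> Ck_on k f S"
proof (induction k arbitrary: f)
  case 0
  then show ?case using Ck_on_continuous_on[OF 0] by simp
next
  case (Suc k)
  then show ?case by (metis Ck_on.simps(2))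
qed

text \<open>Lets smoothness on a chart of \<open>M\<close> be checked on the smaller sets that are
  mapped into a single chart of the ambient space.\<close>

lemma Ck_on_local:
  assumes "\<And>x. x \<in> S \<Longrightarrow> \<exists>T. open T \<and> x \<in> T \<and> Ck_on k f T"
  shows "Ck_on k f S"
  using assms
proof (induction k arbitrary: f)
  case 0
  show ?case unfolding Ck_on.simps
  proof (rule continuous_at_imp_continuous_on, rule ballI)
    fix x assume "x \<in> S"
    then obtain T where "open T" "x \<in> T" "continuous_on T f" using 0[of x] by auto
    then show "isCont f x" by (simp add: continuous_on_eq_continuous_at)
  qed
next
  case (Suc k)
  have "f differentiable (at x)" if "x \<in> S" for x using Suc.prems[OF that] by auto
  moreover have "Ck_on k (\<lambda>x. DD f x v) S" for v
    by (rule Suc.IH) (use Suc.prems in force)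
  ultimately show ?case by simp
qed

lemma Ck_on_const: "Ck_on k (\<lambda>x. c) S"
  by (induction k arbitrary: c) auto

lemma Ck_on_ident: "Ck_on k (\<lambda>x. x) S"
  by (cases k) (auto simp: Ck_on_const)

lemma Ck_on_bounded_linear:
  assumes L: "bounded_linear L" and S: "open S" and "Ck_on k f S"
  shows "Ck_on k (\<lambda>x. L (f x)) S"
  using assms(3)
proof (induction k arbitrary: f)
  case 0
  then show ?case using bounded_linear.continuous_on[OF L] by auto
next
  case (Suc k)
  have d: "((\<lambda>x. L (f x)) has_derivative (\<lambda>v. L (DD f x v))) (at x)" if "x \<in> S" for x
    using Suc.prems that by (intro bounded_linear.has_derivative[OF L] has_derivative_DD) auto
  have "Ck_on k (\<lambda>x. DD (\<lambda>x. L (f x)) x v) S" for v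
    by (rule Ck_on_cong[OF S _ Suc.IH[of "\<lambda>x. DD f x v"]])
       (use Suc.prems in \<open>auto simp: DD_eq[OF d]\<close>)
  then show ?case using d by (auto simp: differentiable_def)
qed

lemma Ck_on_add:
  assumes S: "open S" and "Ck_on k f S" "Ck_on k g S"
  shows "Ck_on k (\<lambda>x. f x + g x) S"
  using assms(2,3)
proof (induction k arbitrary: f g)
  case 0
  then show ?case by (auto intro: continuous_intros)
next
  case (Suc k)
  have d: "((\<lambda>x. f x + g x) has_derivative (\<lambda>v. DD f x v + DD g x v)) (at x)" if "x \<in> S" for x
    using Suc.prems that by (intro has_derivative_add has_derivative_DD) auto
  have "Ck_on k (\<lambda>x. DD (\<lambda>x. f x + g x) x v) S" for v
    by (rule Ck_on_cong[OF S _ Suc.IH[of "\<lambda>x. DD f x v" "\<lambda>x. DD g x v"]])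
       (use Suc.prems in \<open>auto simp: DD_eq[OF d]\<close>)
  then show ?case using d by (auto simp: differentiable_def)
qed

lemma Ck_on_sum:
  assumes "open S" "\<And>i. i \<in> I \<Longrightarrow> Ck_on k (f i) S"
  shows "Ck_on k (\<lambda>x. \<Sum>i\<in>I. f i x) S"
proof (cases "finite I")
  case True
  then show ?thesis using assms(2)
    by (induction I rule: finite_induct) (auto intro: Ck_on_add[OF assms(1)] Ck_on_const)
qed (simp add: Ck_on_const)

lemma Ck_on_bilinear:
  assumes h: "bounded_bilinear h" and S: "open S" and "Ck_on k f S" "Ck_on k g S"
  shows "Ck_on k (\<lambda>x. h (f x) (g x)) S"
  using assms(3,4)
proof (induction k arbitrary: f g)
  case 0
  then show ?case using bounded_bilinear.continuous_on[OF h] by auto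
next
  case (Suc k)
  have d: "((\<lambda>x. h (f x) (g x)) has_derivative (\<lambda>v. h (f x) (DD g x v) + h (DD f x v) (g x))) (at x)"
    if "x \<in> S" for x
    using Suc.prems that by (intro bounded_bilinear.FDERIV[OF h] has_derivative_DD) auto
  have "Ck_on k (\<lambda>x. DD (\<lambda>x. h (f x) (g x)) x v) S" for v
  proof (rule Ck_on_cong[OF S])
    show "Ck_on k (\<lambda>x. h (f x) (DD g x v) + h (DD f x v) (g x)) S"
      using Suc.prems Ck_on_Suc_D[OF Suc.prems(1)] Ck_on_Suc_D[OF Suc.prems(2)]
      by (intro Ck_on_add[OF S] Suc.IH) simp_all
  qed (auto simp: DD_eq[OF d])
  then show ?case using d by (auto simp: differentiable_def)
qed

text \<open>\<open>Ck_on\<close> speaks only of derivatives in fixed directions; the expansion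
  reduces a direction that varies with the point to finitely many fixed ones.\<close>

lemma DD_expand:
  fixes f :: "'a::euclidean_space \<Rightarrow> 'b::real_normed_vector"
  assumes "f differentiable (at x)"
  shows "DD f x v = (\<Sum>b\<in>Basis. (v \<bullet> b) *\<^sub>R DD f x b)"
proof -
  interpret linear "DD f x" using assms by (rule linear_frechet_derivative)
  show ?thesis by (subst (1) euclidean_representation[of v, symmetric]) (simp add: sum scaleR)
qed

text \<open>By the chain rule the derivative is again a finite sum of products with factors of the
  form \<open>g' (f x)\<close>, where \<open>g'\<close> is a directional derivative of
  \<open>g\<close>. The induction therefore varies \<open>g\<close> and keeps
  \<open>f\<close>.\<close>

lemma Ck_on_compose:
  assumes T: "open T" and S: "open S" and im: "f ` S \<subseteq> T"
    and "Ck_on k g T" and "Ck_on k f S"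
  shows "Ck_on k (\<lambda>x. g (f x)) S"
  using assms(4,5)
proof (induction k arbitrary: g)
  case 0
  then show ?case using continuous_on_compose2[of T g S f] im by auto
next
  case (Suc k)
  have d: "((\<lambda>x. g (f x)) has_derivative (\<lambda>v. DD g (f x) (DD f x v))) (at x)" if "x \<in> S" for x
    using Suc.prems that im has_derivative_compose[of f "DD f x" x UNIV g "DD g (f x)"]
    by (auto simp: has_derivative_DD image_subset_iff)
  have "Ck_on k (\<lambda>x. DD (\<lambda>x. g (f x)) x v) S" for v
  proof (rule Ck_on_cong[OF S])
    show "Ck_on k (\<lambda>x. \<Sum>b\<in>Basis. (DD f x v \<bullet> b) *\<^sub>R DD g (f x) b) S"
      using Suc.prems Ck_on_Suc_D[OF Suc.prems(2)]
      by (intro Ck_on_sum[OF S] Ck_on_bilinear[OF bounded_bilinear_scaleR S] Suc.IH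
           Ck_on_bounded_linear[OF bounded_linear_inner_left S]) simp_all
    show "(\<Sum>b\<in>Basis. (DD f x v \<bullet> b) *\<^sub>R DD g (f x) b) = DD (\<lambda>x. g (f x)) x v" if "x \<in> S" for x
      using Suc.prems that im DD_expand[of g "f x" "DD f x v"] by (auto simp: DD_eq[OF d])
  qed
  then show ?case using d by (auto simp: differentiable_def)
qed

text \<open>The derivative of a power is a multiple of another power, so the induction runs over all
  real exponents at once. The exponent \<open>1/2\<close> yields the square roots in the graph
  charts of the sphere and the hyperboloid.\<close>

lemma Ck_on_powr: "Ck_on k (\<lambda>x::real. x powr s) {0<..}"
proof (induction k arbitrary: s)
  case 0
  show ?case by (auto intro!: continuous_intros)
next
  case (Suc k)
  have d: "((\<lambda>x. x powr s) has_derivative (\<lambda>v. (v * s) *\<^sub>R (x powr (s - 1)))) (at x)"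
    if "x \<in> {0<..}" for x :: real
    using that by (auto intro!: derivative_eq_intros simp: fun_eq_iff powr_diff field_simps)
  have "Ck_on k (\<lambda>x. DD (\<lambda>x::real. x powr s) x v) {0<..}" for v
    by (rule Ck_on_cong[OF _ _ Ck_on_bounded_linear[OF bounded_linear_scaleR_right _ Suc.IH]])
       (auto simp: DD_eq[OF d])
  then show ?case using d by (auto simp: differentiable_def)
qed

lemma smooth_on_subset: "smooth_on f S \<Longrightarrow> T \<subseteq> S \<Longrightarrow> smooth_on f T"
  unfolding smooth_on_def using Ck_on_subset[of _ f S T] by simp

lemma smooth_on_cong:
  "open S \<Longrightarrow> (\<And>x. x \<in> S \<Longrightarrow> f x = g x) \<Longrightarrow> smooth_on f S \<Longrightarrow> smooth_on g S"
  unfolding smooth_on_def using Ck_on_cong[of S f g] by simp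

lemma smooth_on_local:
  "(\<And>x. x \<in> S \<Longrightarrow> \<exists>T. open T \<and> x \<in> T \<and> smooth_on f T) \<Longrightarrow> smooth_on f S"
  unfolding smooth_on_def by (intro allI Ck_on_local) blast

lemma smooth_on_continuous_on: "smooth_on f S \<Longrightarrow> continuous_on S f"
  unfolding smooth_on_def using Ck_on_continuous_on[of 0 f S] by simp

lemma smooth_on_differentiable: "smooth_on f S \<Longrightarrow> x \<in> S \<Longrightarrow> f differentiable (at x)"
  unfolding smooth_on_def by (drule spec[of _ "Suc 0"]) simp

lemma smooth_on_has_derivative: "smooth_on f S \<Longrightarrow> x \<in> S \<Longrightarrow> (f has_derivative DD f x) (at x)"
  using smooth_on_differentiable has_derivative_DD by blast

lemma smooth_on_DD: "smooth_on f S \<Longrightarrow> smooth_on (\<lambda>x. DD f x v) S"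
  unfolding smooth_on_def
proof
  fix k assume "\<forall>k. Ck_on k f S"
  then have "Ck_on (Suc k) f S" by blast
  then show "Ck_on k (\<lambda>x. DD f x v) S" by simp
qed

lemma smooth_on_const: "smooth_on (\<lambda>x. c) S"
  by (simp add: smooth_on_def Ck_on_const)

lemma smooth_on_ident: "smooth_on (\<lambda>x. x) S"
  by (simp add: smooth_on_def Ck_on_ident)

lemma smooth_on_bounded_linear:
  "bounded_linear L \<Longrightarrow> open S \<Longrightarrow> smooth_on f S \<Longrightarrow> smooth_on (\<lambda>x. L (f x)) S"
  by (simp add: smooth_on_def Ck_on_bounded_linear)

lemma smooth_on_add:
  "open S \<Longrightarrow> smooth_on f S \<Longrightarrow> smooth_on g S \<Longrightarrow> smooth_on (\<lambda>x. f x + g x) S"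
  by (simp add: smooth_on_def Ck_on_add)

lemma smooth_on_sum:
  "open S \<Longrightarrow> (\<And>i. i \<in> I \<Longrightarrow> smooth_on (f i) S) \<Longrightarrow> smooth_on (\<lambda>x. \<Sum>i\<in>I. f i x) S"
  by (simp add: smooth_on_def Ck_on_sum)

lemma smooth_on_bilinear:
  "bounded_bilinear h \<Longrightarrow> open S \<Longrightarrow> smooth_on f S \<Longrightarrow> smooth_on g S
    \<Longrightarrow> smooth_on (\<lambda>x. h (f x) (g x)) S"
  unfolding smooth_on_def by (intro allI Ck_on_bilinear[of h S _ f g]) simp_all

lemmas smooth_on_scaleR = smooth_on_bilinear[OF bounded_bilinear_scaleR]
lemmas smooth_on_inner = smooth_on_bilinear[OF bounded_bilinear_inner]

lemma smooth_on_minus: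
  "open S \<Longrightarrow> smooth_on f S \<Longrightarrow> smooth_on (\<lambda>x. - f x) S"
  using smooth_on_bounded_linear[OF bounded_linear_minus[OF bounded_linear_ident]] by blast

lemma smooth_on_diff:
  "open S \<Longrightarrow> smooth_on f S \<Longrightarrow> smooth_on g S \<Longrightarrow> smooth_on (\<lambda>x. f x - g x) S"
  using smooth_on_add[of S f "\<lambda>x. - g x"] smooth_on_minus[of S g] by simp

lemma smooth_on_compose:
  "open T \<Longrightarrow> open S \<Longrightarrow> f ` S \<subseteq> T \<Longrightarrow> smooth_on g T \<Longrightarrow> smooth_on f S
    \<Longrightarrow> smooth_on (\<lambda>x. g (f x)) S"
  unfolding smooth_on_def by (intro allI Ck_on_compose[of T S f _ g]) simp_all

lemma smooth_on_Pair:
  assumes "open S" "smooth_on f S" "smooth_on g S"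
  shows "smooth_on (\<lambda>x. (f x, g x)) S"
proof -
  have "smooth_on (\<lambda>x. (f x, 0) + (0, g x)) S"
    by (intro smooth_on_add smooth_on_bounded_linear[of "\<lambda>y. (y, 0)"]
          smooth_on_bounded_linear[of "\<lambda>y. (0, y)"] assms bounded_linear_Pair
          bounded_linear_ident bounded_linear_zero)
  then show ?thesis by simp
qed

lemma smooth_on_sqrt:
  assumes "open S" "smooth_on f S" "\<And>x. x \<in> S \<Longrightarrow> f x > 0"
  shows "smooth_on (\<lambda>x. sqrt (f x)) S"
proof (rule smooth_on_cong[OF assms(1)])
  show "smooth_on (\<lambda>x. f x powr (1/2)) S"
  proof (rule smooth_on_compose[of "{0<..}" S f "\<lambda>y. y powr (1/2)"])
    show "smooth_on (\<lambda>y::real. y powr (1/2)) {0<..}"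
      unfolding smooth_on_def using Ck_on_powr by blast
  qed (use assms in auto)
  show "f x powr (1/2) = sqrt (f x)" if "x \<in> S" for x
    using assms(3)[OF that] by (simp add: powr_half_sqrt)
qed

lemma smooth_on_DD_compose:
  assumes "open T" "open S" "g ` S \<subseteq> T" "smooth_on f T" "smooth_on g S" "smooth_on W S"
  shows "smooth_on (\<lambda>x. DD f (g x) (W x)) S"
proof (rule smooth_on_cong[OF assms(2)])
  have c: "smooth_on (\<lambda>x. DD f (g x) b) S" for b
    by (rule smooth_on_compose[OF assms(1,2,3) smooth_on_DD[OF assms(4), of b] assms(5)])
  have d: "smooth_on (\<lambda>x. W x \<bullet> b) S" for b
    by (rule smooth_on_bounded_linear[OF bounded_linear_inner_left assms(2,6)])
  show "smooth_on (\<lambda>x. \<Sum>b\<in>Basis. (W x \<bullet> b) *\<^sub>R DD f (g x) b) S"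
    by (rule smooth_on_sum[OF assms(2)]) (rule smooth_on_scaleR[OF assms(2) d c])
  show "(\<Sum>b\<in>Basis. (W x \<bullet> b) *\<^sub>R DD f (g x) b) = DD f (g x) (W x)" if "x \<in> S" for x
    using that assms(3) by (intro DD_expand[symmetric] smooth_on_differentiable[OF assms(4)]) auto
qed

lemma DD_compose:
  assumes "g differentiable (at (f x))" "f differentiable (at x)"
  shows "DD (\<lambda>y. g (f y)) x v = DD g (f x) (DD f x v)"
  using DD_eq[OF has_derivative_compose[OF has_derivative_DD[OF assms(2)] has_derivative_DD[OF assms(1)]]]
  by simp

lemma DD_bilinear:
  assumes "bounded_bilinear h" "f differentiable (at x)" "g differentiable (at x)"
  shows "DD (\<lambda>x. h (f x) (g x)) x v = h (f x) (DD g x v) + h (DD f x v) (g x)"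
  using DD_eq[OF bounded_bilinear.FDERIV[OF assms(1) has_derivative_DD[OF assms(2)] has_derivative_DD[OF assms(3)]]]
  by simp

lemma DD_linear: "f differentiable (at x) \<Longrightarrow> linear (\<lambda>v. DD f x v)"
  by (rule linear_frechet_derivative)

lemma has_vector_derivative_DD:
  assumes "f differentiable (at (a t))" "(a has_vector_derivative a') (at t)"
  shows "((\<lambda>s. f (a s)) has_vector_derivative DD f (a t) a') (at t)"
proof -
  have "((\<lambda>s. f (a s)) has_derivative (\<lambda>s. DD f (a t) (s *\<^sub>R a'))) (at t)"
    using has_derivative_compose[OF assms(2)[unfolded has_vector_derivative_def] has_derivative_DD[OF assms(1)]]
    by simp
  then show ?thesis
    by (simp add: has_vector_derivative_def linear_scale[OF DD_linear[OF assms(1)]])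
qed

text \<open>The second difference over a small parallelogram is symmetric in \<open>u\<close> and
  \<open>v\<close>. It equals \<open>s\<^sup>2\<close> times either mixed derivative, each taken at
  some nearby point; both points tend to \<open>x\<close>, and the mixed derivatives are
  continuous.\<close>

lemma symmetric_second_derivative_real:
  fixes f :: "'a::euclidean_space \<Rightarrow> real"
  assumes S: "open S" and x: "x \<in> S" and f: "smooth_on f S"
  shows "DD (\<lambda>y. DD f y u) x v = DD (\<lambda>y. DD f y v) x u"
proof -
  obtain r where r: "r > 0" "ball x r \<subseteq> S" using S x openE by blast
  define c where "c = norm u + norm v + 1"
  have c: "c > 0" unfolding c_def by (meson add_nonneg_pos add_nonneg_nonneg norm_ge_zero zero_less_one)
  \<comment> \<open>Two uses of the mean value theorem, along \<open>u\<close> for the difference of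
    \<open>f\<close> and then along \<open>v\<close> for its derivative. The intermediate point
    stays in the parallelogram, which lies within \<open>s * c\<close> of \<open>x\<close>.\<close>
  have key: "\<exists>y. dist y x \<le> s * c \<and>
      f (x + s *\<^sub>R u + s *\<^sub>R v) - f (x + s *\<^sub>R u) - f (x + s *\<^sub>R v) + f x
        = s\<^sup>2 * DD (\<lambda>y. DD f y u) y v"
    if s: "0 < s" "s * c < r" and c: "c = norm u + norm v + 1" for s u v
  proof -
    have inS: "x + a *\<^sub>R u + b *\<^sub>R v \<in> S" and near: "dist (x + a *\<^sub>R u + b *\<^sub>R v) x \<le> s * c"
      if "0 \<le> a" "a \<le> s" "0 \<le> b" "b \<le> s" for a b
    proof -
      have "norm (a *\<^sub>R u + b *\<^sub>R v) \<le> a * norm u + b * norm v"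
        using that norm_triangle_ineq[of "a *\<^sub>R u" "b *\<^sub>R v"] by simp
      also have "\<dots> \<le> s * norm u + s * norm v"
        using that by (intro add_mono mult_right_mono) auto
      also have "\<dots> \<le> s * c" using s by (simp add: c algebra_simps)
      finally have *: "norm (a *\<^sub>R u + b *\<^sub>R v) \<le> s * c" .
      have e: "dist (x + a *\<^sub>R u + b *\<^sub>R v) x = norm (a *\<^sub>R u + b *\<^sub>R v)"
        by (simp add: dist_norm add.assoc)
      show "dist (x + a *\<^sub>R u + b *\<^sub>R v) x \<le> s * c" using * e by simp
      then show "x + a *\<^sub>R u + b *\<^sub>R v \<in> S" using r s by (force simp: dist_commute)
    qed
    let ?q = "\<lambda>a. f (x + a *\<^sub>R u + s *\<^sub>R v) - f (x + a *\<^sub>R u + 0 *\<^sub>R v)"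
    have dq: "(?q has_real_derivative DD f (x + a *\<^sub>R u + s *\<^sub>R v) u - DD f (x + a *\<^sub>R u + 0 *\<^sub>R v) u) (at a)"
      if "0 \<le> a" "a \<le> s" for a
    proof -
      have "((\<lambda>a. f (x + a *\<^sub>R u + b *\<^sub>R v)) has_real_derivative DD f (x + a *\<^sub>R u + b *\<^sub>R v) u) (at a)"
        if b: "0 \<le> b" "b \<le> s" for b
        unfolding has_real_derivative_iff_has_vector_derivative
        by (rule has_vector_derivative_DD[of f "\<lambda>a. x + a *\<^sub>R u + b *\<^sub>R v"])
           (use smooth_on_differentiable[OF f inS] \<open>0 \<le> a\<close> \<open>a \<le> s\<close> b in \<open>auto intro!: derivative_eq_intros\<close>)
      from DERIV_diff[OF this[of s] this[of 0]] show ?thesis using s by simp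
    qed
    obtain \<xi> where \<xi>: "0 < \<xi>" "\<xi> < s" and e1: "?q s - ?q 0 = (s - 0) * (DD f (x + \<xi> *\<^sub>R u + s *\<^sub>R v) u - DD f (x + \<xi> *\<^sub>R u + 0 *\<^sub>R v) u)"
      using MVT2[OF s(1) dq] by blast
    let ?p = "\<lambda>b. DD f (x + \<xi> *\<^sub>R u + b *\<^sub>R v) u"
    have dp: "(?p has_real_derivative DD (\<lambda>y. DD f y u) (x + \<xi> *\<^sub>R u + b *\<^sub>R v) v) (at b)"
      if b: "0 \<le> b" "b \<le> s" for b
      unfolding has_real_derivative_iff_has_vector_derivative
      by (rule has_vector_derivative_DD[of "\<lambda>y. DD f y u" "\<lambda>b. x + \<xi> *\<^sub>R u + b *\<^sub>R v"])
         (use smooth_on_differentiable[OF smooth_on_DD[OF f] inS] \<xi> b in \<open>auto intro!: derivative_eq_intros\<close>)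
    obtain \<eta> where \<eta>: "0 < \<eta>" "\<eta> < s" and e2: "?p s - ?p 0 = (s - 0) * DD (\<lambda>y. DD f y u) (x + \<xi> *\<^sub>R u + \<eta> *\<^sub>R v) v"
      using MVT2[OF s(1) dp] by blast
    show ?thesis
      using e1 e2 near[of \<xi> \<eta>] \<xi> \<eta>
      by (intro exI[of _ "x + \<xi> *\<^sub>R u + \<eta> *\<^sub>R v"]) (simp add: power2_eq_square)
  qed
  have lim: "(\<lambda>n. DD (\<lambda>y. DD f y u) (p n) v) \<longlonglongrightarrow> DD (\<lambda>y. DD f y u) x v"
    if "p \<longlonglongrightarrow> x" for p u v
  proof -
    have "isCont (\<lambda>z. DD (\<lambda>y. DD f y u) z v) x"
      using smooth_on_continuous_on[OF smooth_on_DD[OF smooth_on_DD[OF f]]] S x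
        continuous_on_eq_continuous_at by blast
    then show ?thesis using that isCont_tendsto_compose by blast
  qed
  \<comment> \<open>Chosen so that \<open>s n * c\<close> is \<open>r / 2\<close> divided by
    \<open>n + 1\<close>: below \<open>r\<close> for every \<open>n\<close>, and tending to
    0.\<close>
  define s where "s n = r / (2 * c) / real (Suc n)" for n
  have s: "0 < s n" "s n * c < r" for n
  proof -
    show "0 < s n" using r c by (simp add: s_def)
    have "s n * c = r / 2 / real (Suc n)" using c by (simp add: s_def)
    also have "\<dots> \<le> r / 2 / 1" using r by (intro divide_left_mono) auto
    also have "\<dots> < r" using r by simp
    finally show "s n * c < r" .
  qed
  have "(\<lambda>n. (r / 2) * (1 / real (Suc n))) \<longlonglongrightarrow> (r / 2) * 0"
    by (intro tendsto_mult tendsto_const LIMSEQ_Suc lim_1_over_n)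
  moreover have "s n * c = (r / 2) * (1 / real (Suc n))" for n using c by (simp add: s_def)
  ultimately have s0: "(\<lambda>n. s n * c) \<longlonglongrightarrow> 0" by simp
  have "\<exists>y. dist y x \<le> s n * c \<and>
      f (x + s n *\<^sub>R u + s n *\<^sub>R v) - f (x + s n *\<^sub>R u) - f (x + s n *\<^sub>R v) + f x
        = (s n)\<^sup>2 * DD (\<lambda>y. DD f y u) y v" for n
    using key[of "s n" u v] s by (simp add: c_def)
  then obtain p where p: "\<And>n. dist (p n) x \<le> s n * c" "\<And>n.
      f (x + s n *\<^sub>R u + s n *\<^sub>R v) - f (x + s n *\<^sub>R u) - f (x + s n *\<^sub>R v) + f x
        = (s n)\<^sup>2 * DD (\<lambda>y. DD f y u) (p n) v" by metis
  have "\<exists>y. dist y x \<le> s n * c \<and>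
      f (x + s n *\<^sub>R v + s n *\<^sub>R u) - f (x + s n *\<^sub>R v) - f (x + s n *\<^sub>R u) + f x
        = (s n)\<^sup>2 * DD (\<lambda>y. DD f y v) y u" for n
    using key[of "s n" v u] s by (simp add: c_def)
  then obtain q where q: "\<And>n. dist (q n) x \<le> s n * c" "\<And>n.
      f (x + s n *\<^sub>R v + s n *\<^sub>R u) - f (x + s n *\<^sub>R v) - f (x + s n *\<^sub>R u) + f x
        = (s n)\<^sup>2 * DD (\<lambda>y. DD f y v) (q n) u" by metis
  have eqs: "(s n)\<^sup>2 * DD (\<lambda>y. DD f y u) (p n) v = (s n)\<^sup>2 * DD (\<lambda>y. DD f y v) (q n) u" for n
    using p(2)[of n] q(2)[of n] by (simp add: algebra_simps)
  have eq: "DD (\<lambda>y. DD f y u) (p n) v = DD (\<lambda>y. DD f y v) (q n) u" for n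
  proof -
    have "(s n)\<^sup>2 \<noteq> 0" using s(1)[of n] by simp
    then show ?thesis using eqs[of n] mult_left_cancel by blast
  qed
  have "p \<longlonglongrightarrow> x" if "\<And>n. dist (p n) x \<le> s n * c" for p
    by (rule tendsto_dist_iff[THEN iffD2], rule tendsto_sandwich[OF _ _ tendsto_const s0])
       (use that in auto)
  from this[OF p(1)] this[OF q(1)] have "p \<longlonglongrightarrow> x" "q \<longlonglongrightarrow> x" .
  then show ?thesis
    using lim[of p u v] lim[of q v u] eq LIMSEQ_unique by simp
qed

lemma symmetric_second_derivative:
  fixes f :: "'a::euclidean_space \<Rightarrow> 'b::euclidean_space"
  assumes S: "open S" and x: "x \<in> S" and f: "smooth_on f S"
  shows "DD (\<lambda>y. DD f y u) x v = DD (\<lambda>y. DD f y v) x u"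
proof (rule euclidean_eqI)
  fix b :: 'b
  have d: "DD (\<lambda>y. h y \<bullet> b) z w = DD h z w \<bullet> b" if "smooth_on h S" "z \<in> S" for h :: "'a \<Rightarrow> 'b" and z w
    using DD_eq[OF has_derivative_inner_left[OF smooth_on_has_derivative[OF that], of b]] by simp
  have fb: "smooth_on (\<lambda>y. f y \<bullet> b) S"
    by (intro smooth_on_bounded_linear[OF bounded_linear_inner_left] S f)
  have e: "DD (\<lambda>y. DD (\<lambda>y. f y \<bullet> b) y u) x v = DD (\<lambda>y. DD f y u) x v \<bullet> b" for u v
  proof -
    have "DD (\<lambda>y. DD (\<lambda>y. f y \<bullet> b) y u) x v = DD (\<lambda>y. DD f y u \<bullet> b) x v"
      using DD_cong[OF S x, of "\<lambda>y. DD (\<lambda>y. f y \<bullet> b) y u" "\<lambda>y. DD f y u \<bullet> b"] d[OF f] by simp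
    then show ?thesis using d[OF smooth_on_DD[OF f] x] by simp
  qed
  show "DD (\<lambda>y. DD f y u) x v \<bullet> b = DD (\<lambda>y. DD f y v) x u \<bullet> b"
    using symmetric_second_derivative_real[OF S x fb, of u v] by (simp add: e)
qed

section \<open>Linear systems that depend smoothly on a parameter\<close>

lemma linear_euclidean_expand:
  fixes L :: "'a::euclidean_space \<Rightarrow> 'b::real_vector"
  assumes "linear L"
  shows "L v = (\<Sum>b\<in>Basis. (v \<bullet> b) *\<^sub>R L b)"
proof -
  interpret linear L by fact
  show ?thesis by (subst (1) euclidean_representation[of v, symmetric]) (simp add: sum scaleR)
qed

lemma Ck_on_linear_family:
  fixes L :: "'x::euclidean_space \<Rightarrow> 'a::euclidean_space \<Rightarrow> 'b::euclidean_space"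
  assumes "open S" "\<And>x. x \<in> S \<Longrightarrow> linear (L x)" "\<And>u. Ck_on k (\<lambda>x. L x u) S" "Ck_on k z S"
  shows "Ck_on k (\<lambda>x. L x (z x)) S"
proof (rule Ck_on_cong[OF assms(1)])
  show "(\<Sum>b\<in>Basis. (z x \<bullet> b) *\<^sub>R L x b) = L x (z x)" if "x \<in> S" for x
    by (rule linear_euclidean_expand[OF assms(2)[OF that], symmetric])
  have "Ck_on k (\<lambda>x. z x \<bullet> b) S" for b
    by (rule Ck_on_bounded_linear[OF bounded_linear_inner_left assms(1,4)])
  then show "Ck_on k (\<lambda>x. \<Sum>b\<in>Basis. (z x \<bullet> b) *\<^sub>R L x b) S"
    by (intro Ck_on_sum[OF assms(1)]) (rule Ck_on_bilinear[OF bounded_bilinear_scaleR assms(1) _ assms(3)])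
qed

lemma smooth_on_linear_family:
  assumes "open S" "\<And>x. x \<in> S \<Longrightarrow> linear (L x)" "\<And>u. smooth_on (\<lambda>x. L x u) S" "smooth_on z S"
  shows "smooth_on (\<lambda>x. L x (z x)) S"
  unfolding smooth_on_def
proof
  fix k show "Ck_on k (\<lambda>x. L x (z x)) S"
    by (rule Ck_on_linear_family[OF assms(1,2)]) (use assms(3,4) in \<open>simp_all add: smooth_on_def\<close>)
qed

lemma has_derivative_linear_family:
  fixes L :: "'x::real_normed_vector \<Rightarrow> 'a::euclidean_space \<Rightarrow> 'b::real_normed_vector"
  assumes S: "open S" "x \<in> S" and lin: "\<And>y. y \<in> S \<Longrightarrow> linear (L y)"
    and L: "\<And>p. ((\<lambda>y. L y p) has_derivative L' p) (at x)" and z: "(z has_derivative z') (at x)"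
  shows "((\<lambda>y. L y (z y)) has_derivative (\<lambda>h. L' (z x) h + L x (z' h))) (at x)"
proof -
  have "((\<lambda>y. \<Sum>b\<in>Basis. (z x \<bullet> b) *\<^sub>R L y b) has_derivative (\<lambda>h. \<Sum>b\<in>Basis. (z x \<bullet> b) *\<^sub>R L' b h)) (at x)"
    by (intro has_derivative_sum has_derivative_scaleR_right L)
  then have "((\<lambda>y. L y (z x)) has_derivative (\<lambda>h. \<Sum>b\<in>Basis. (z x \<bullet> b) *\<^sub>R L' b h)) (at x)"
    by (rule has_derivative_transform_within_open[OF _ S]) (rule linear_euclidean_expand[OF lin, symmetric])
  then have L': "L' (z x) = (\<lambda>h. \<Sum>b\<in>Basis. (z x \<bullet> b) *\<^sub>R L' b h)"
    by (rule has_derivative_unique[OF L])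
  have "((\<lambda>y. \<Sum>b\<in>Basis. (z y \<bullet> b) *\<^sub>R L y b) has_derivative
      (\<lambda>h. \<Sum>b\<in>Basis. ((z x \<bullet> b) *\<^sub>R L' b h + (z' h \<bullet> b) *\<^sub>R L x b))) (at x)"
    by (intro has_derivative_sum has_derivative_scaleR has_derivative_inner_left z L)
  moreover have "(\<Sum>b\<in>Basis. ((z x \<bullet> b) *\<^sub>R L' b h + (z' h \<bullet> b) *\<^sub>R L x b)) = L' (z x) h + L x (z' h)" for h
    unfolding sum.distrib
    by (intro arg_cong2[where f = "(+)"] fun_cong[OF L', symmetric] linear_euclidean_expand[OF lin[OF S(2)], symmetric])
  ultimately have "((\<lambda>y. \<Sum>b\<in>Basis. (z y \<bullet> b) *\<^sub>R L y b) has_derivative (\<lambda>h. L' (z x) h + L x (z' h))) (at x)"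
    by (simp only:)
  then show ?thesis
    by (rule has_derivative_transform_within_open[OF _ S]) (rule linear_euclidean_expand[OF lin, symmetric])
qed

text \<open>\<open>K\<close> inverts \<open>L x0\<close>, and continuity on the finitely many basis
  vectors makes \<open>K (L x)\<close> a perturbation of the identity of size \<open>e x\<close>.
  This estimate replaces the inverses of the other \<open>L x\<close>.\<close>

lemma injective_family_left_inverse:
  fixes L :: "'x::euclidean_space \<Rightarrow> 'a::euclidean_space \<Rightarrow> 'a"
  assumes x0: "x0 \<in> S" and lin: "\<And>x. x \<in> S \<Longrightarrow> linear (L x)"
    and inj: "\<And>u. L x0 u = 0 \<Longrightarrow> u = 0" and cont: "\<And>b. ((\<lambda>x. L x b) \<longlongrightarrow> L x0 b) (at x0)"
  obtains K e where "linear K" "\<And>u. K (L x0 u) = u" "\<And>u. L x0 (K u) = u"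
    "(e \<longlongrightarrow> (0::real)) (at x0)" "\<And>x. e x \<ge> 0"
    "\<And>x u. x \<in> S \<Longrightarrow> norm (K (L x u) - u) \<le> e x * norm u"
proof -
  have lin0: "linear (L x0)" using lin x0 by blast
  have "inj (L x0)" using inj lin0 by (simp add: linear_injective_0)
  then obtain K where K: "linear K" "\<And>u. K (L x0 u) = u" "\<And>u. L x0 (K u) = u"
    using linear_injective_isomorphism[OF lin0] by metis
  have blK: "bounded_linear K" using K(1) linear_conv_bounded_linear by blast
  define E where "E x u = K (L x u) - u" for x u
  have Elin: "linear (E x)" if "x \<in> S" for x
  proof -
    have "linear (\<lambda>u. K (L x u))" using linear_compose[OF lin[OF that] K(1)] by (simp add: o_def)
    then show ?thesis unfolding E_def by (rule linear_compose_sub) (rule linear_ident)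
  qed
  have Eb: "((\<lambda>x. E x b) \<longlongrightarrow> 0) (at x0)" for b
  proof -
    have "((\<lambda>x. K (L x b) - b) \<longlongrightarrow> K (L x0 b) - b) (at x0)"
      by (rule tendsto_diff[OF bounded_linear.tendsto[OF blK cont] tendsto_const])
    then show ?thesis by (simp add: E_def K)
  qed
  define e where "e x = (\<Sum>b\<in>Basis. norm (E x b))" for x
  have "((\<lambda>x. \<Sum>b\<in>Basis. norm (E x b)) \<longlongrightarrow> (\<Sum>b\<in>(Basis::'a set). norm (0::'a))) (at x0)"
    by (rule tendsto_sum) (rule tendsto_norm[OF Eb])
  then have e0: "(e \<longlongrightarrow> 0) (at x0)" by (simp add: e_def[abs_def])
  have Ebound: "norm (E x u) \<le> e x * norm u" if "x \<in> S" for x u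
  proof -
    have "norm (E x u) = norm (\<Sum>b\<in>Basis. (u \<bullet> b) *\<^sub>R E x b)"
      by (rule arg_cong[OF linear_euclidean_expand[OF Elin[OF that]]])
    also have "\<dots> \<le> (\<Sum>b\<in>Basis. norm u * norm (E x b))"
      by (rule sum_norm_le) (auto intro!: mult_right_mono Basis_le_norm)
    finally show ?thesis by (simp add: e_def sum_distrib_left mult.commute)
  qed
  have "e x \<ge> 0" for x by (simp add: e_def sum_nonneg)
  then show thesis using that[of K e] K e0 Ebound by (simp add: E_def)
qed

text \<open>With \<open>w = z x - z x0\<close> the equation gives
  \<open>L x w = y x - L x (z x0)\<close>, a residual that tends to 0. As soon as
  \<open>e x < 1/2\<close>, \<open>norm w\<close> is at most twice the norm of \<open>K\<close>
  applied to the residual.\<close>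

lemma solution_continuous:
  fixes L :: "'x::euclidean_space \<Rightarrow> 'a::euclidean_space \<Rightarrow> 'a"
  assumes S: "open S" and lin: "\<And>x. x \<in> S \<Longrightarrow> linear (L x)"
    and inj: "\<And>x u. x \<in> S \<Longrightarrow> L x u = 0 \<Longrightarrow> u = 0"
    and L: "\<And>u. continuous_on S (\<lambda>x. L x u)" and y: "continuous_on S y"
    and eq: "\<And>x. x \<in> S \<Longrightarrow> L x (z x) = y x"
  shows "continuous_on S z"
proof (rule continuous_at_imp_continuous_on, rule ballI)
  fix x0 assume x0: "x0 \<in> S"
  have cont: "(f \<longlongrightarrow> f x0) (at x0)" if "continuous_on S f" for f :: "'x \<Rightarrow> 'a"
    using that S x0 by (metis continuous_on_eq_continuous_at isCont_def)
  obtain K e where K: "linear K" "\<And>u. K (L x0 u) = u" "\<And>u. L x0 (K u) = u"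
    and e0: "(e \<longlongrightarrow> (0::real)) (at x0)" and "\<And>x. e x \<ge> 0"
    and Ebound: "\<And>x u. x \<in> S \<Longrightarrow> norm (K (L x u) - u) \<le> e x * norm u"
    by (rule injective_family_left_inverse[of x0 S L, OF x0 lin inj[OF x0] cont[OF L]]) auto
  have evS: "\<forall>\<^sub>F x in at x0. x \<in> S" using S x0 eventually_at_topological by blast
  have ev2: "\<forall>\<^sub>F x in at x0. e x < 1/2" using order_tendstoD(2)[OF e0, of "1/2"] by simp
  have "((\<lambda>x. K (y x - L x (z x0))) \<longlongrightarrow> K (y x0 - L x0 (z x0))) (at x0)"
    using K(1) linear_conv_bounded_linear
    by (intro bounded_linear.tendsto[of K] tendsto_diff cont y L) blast
  then have r: "((\<lambda>x. 2 * norm (K (y x - L x (z x0)))) \<longlongrightarrow> 0) (at x0)"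
    using eq[OF x0] linear_0[OF K(1)] tendsto_norm_zero[of _ "at x0"] tendsto_mult_right_zero by fastforce
  have bd: "\<forall>\<^sub>F x in at x0. norm (z x - z x0) \<le> 2 * norm (K (y x - L x (z x0)))"
    using evS ev2
  proof eventually_elim
    case (elim x)
    let ?w = "z x - z x0"
    have "norm (K (L x ?w) - ?w) \<le> 1/2 * norm ?w"
      using Ebound[OF elim(1), of ?w] mult_right_mono[of "e x" "1/2" "norm ?w"] elim(2) by simp
    moreover have "L x ?w = y x - L x (z x0)"
      using eq[OF elim(1)] linear_diff[OF lin[OF elim(1)]] by simp
    ultimately show ?case using norm_triangle_ineq3[of "K (L x ?w)" ?w] by simp
  qed
  have "((\<lambda>x. norm (z x - z x0)) \<longlongrightarrow> 0) (at x0)"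
    by (rule tendsto_sandwich[OF _ bd tendsto_const r]) simp
  then show "isCont z x0"
    unfolding isCont_def by (simp add: LIM_zero_iff tendsto_norm_zero_iff)
qed

text \<open>Formal differentiation of \<open>L x (z x) = y x\<close>. The derivative is
  \<open>K\<close> applied to the derivative of the residual \<open>r\<close>, in which
  \<open>z\<close> is frozen at its value at \<open>x0\<close>.\<close>

lemma solution_has_derivative:
  fixes L :: "'x::euclidean_space \<Rightarrow> 'a::euclidean_space \<Rightarrow> 'a"
  assumes S: "open S" and x0: "x0 \<in> S"
    and lin: "\<And>x. x \<in> S \<Longrightarrow> linear (L x)" and inj: "\<And>x u. x \<in> S \<Longrightarrow> L x u = 0 \<Longrightarrow> u = 0"
    and Ld: "\<And>u. (\<lambda>x. L x u) differentiable (at x0)" and yd: "y differentiable (at x0)"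
    and eq: "\<And>x. x \<in> S \<Longrightarrow> L x (z x) = y x"
  obtains z' where "(z has_derivative z') (at x0)"
    "\<And>v. L x0 (z' v) = DD y x0 v - DD (\<lambda>x. L x (z x0)) x0 v"
proof -
  have cont: "((\<lambda>x. L x b) \<longlongrightarrow> L x0 b) (at x0)" for b
    using differentiable_imp_continuous_within[OF Ld] by (simp add: continuous_within)
  obtain K e where K: "linear K" "\<And>u. K (L x0 u) = u" "\<And>u. L x0 (K u) = u"
    and e0: "(e \<longlongrightarrow> (0::real)) (at x0)" and e_nonneg: "\<And>x. e x \<ge> 0"
    and Eb: "\<And>x u. x \<in> S \<Longrightarrow> norm (K (L x u) - u) \<le> e x * norm u"
    by (rule injective_family_left_inverse[of x0 S L, OF x0 lin inj[OF x0] cont]) auto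
  have blK: "bounded_linear K" using K(1) linear_conv_bounded_linear by blast
  define E where "E x u = K (L x u) - u" for x u
  have Ebound: "norm (E x u) \<le> e x * norm u" if "x \<in> S" for x u using Eb[OF that] by (simp add: E_def)
  define r where "r x = y x - L x (z x0)" for x
  define r' where "r' v = DD y x0 v - DD (\<lambda>x. L x (z x0)) x0 v" for v
  have r: "(r has_derivative r') (at x0)"
    unfolding r_def r'_def by (intro has_derivative_diff has_derivative_DD Ld yd)
  have r0: "r x0 = 0" using eq[OF x0] by (simp add: r_def)
  have evS: "\<forall>\<^sub>F x in at x0. x \<in> S" using S x0 eventually_at_topological by blast
  have ev2: "\<forall>\<^sub>F x in at x0. e x < 1/2" using order_tendstoD(2)[OF e0, of "1/2"] by simp
  have evn: "\<forall>\<^sub>F x in at x0. x \<noteq> x0" by (simp add: eventually_at_filter)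
  define w where "w x = z x - z x0" for x
  have wr: "K (r x) = w x + E x (w x)" if "x \<in> S" for x
  proof -
    have "L x (w x) = r x"
      using eq[OF that] linear_diff[OF lin[OF that]] by (simp add: w_def r_def)
    then show ?thesis by (simp add: E_def)
  qed
  have wb: "norm (w x) \<le> 2 * norm (K (r x))" if "x \<in> S" "e x < 1/2" for x
  proof -
    have "norm (E x (w x)) \<le> 1/2 * norm (w x)"
      using Ebound[OF that(1), of "w x"] mult_right_mono[of "e x" "1/2" "norm (w x)"] that(2) by simp
    then show ?thesis using wr[OF that(1)] norm_triangle_ineq2[of "w x" "- E x (w x)"] by simp
  qed
  have "(z has_derivative (\<lambda>v. K (r' v))) (at x0)"
    unfolding has_derivative_iff_norm
  proof
    show "bounded_linear (\<lambda>v. K (r' v))"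
      using bounded_linear_compose[OF blK has_derivative_bounded_linear[OF r]] by (simp add: o_def)
    have Kr: "((\<lambda>x. K (r x)) has_derivative (\<lambda>v. K (r' v))) (at x0)"
      by (rule bounded_linear.has_derivative[OF blK r])
    then have l1: "((\<lambda>x. norm (K (r x) - K (r x0) - K (r' (x - x0))) / norm (x - x0)) \<longlongrightarrow> 0) (at x0)"
      unfolding has_derivative_iff_norm by blast
    obtain B where B: "B > 0" "\<And>v. norm (K (r' v)) \<le> norm v * B"
      using bounded_linear.pos_bounded[OF has_derivative_bounded_linear[OF Kr]] by blast
    define q where "q x = norm (K (r x) - K (r x0) - K (r' (x - x0))) / norm (x - x0)" for x
    have lim: "((\<lambda>x. q x + e x * (2 * (q x + B))) \<longlongrightarrow> 0 + 0 * (2 * (0 + B))) (at x0)"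
      using l1 e0 unfolding q_def by (intro tendsto_intros)
    \<comment> \<open>The error of \<open>z\<close> is the error \<open>q x\<close> of the
      differentiable map \<open>K \<circ> r\<close> plus \<open>E x (w x)\<close>. The second term
      is negligible because \<open>w x\<close> is of order \<open>norm (x - x0)\<close> and
      \<open>e x\<close> tends to 0.\<close>
    have bd: "\<forall>\<^sub>F x in at x0. norm (z x - z x0 - K (r' (x - x0))) / norm (x - x0) \<le> q x + e x * (2 * (q x + B))"
      using evS ev2 evn
    proof eventually_elim
      case (elim x)
      have n: "norm (x - x0) > 0" using elim by simp
      have K0: "K (r x0) = 0" using r0 linear_0[OF K(1)] by simp
      have a: "norm (K (r x) - K (r' (x - x0))) = q x * norm (x - x0)"
        using n by (simp add: q_def K0)
      have "norm (K (r x)) \<le> norm (K (r x) - K (r' (x - x0))) + norm (K (r' (x - x0)))"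
        by (metis diff_add_cancel norm_triangle_ineq)
      also have "\<dots> \<le> (q x + B) * norm (x - x0)"
        using a B(2)[of "x - x0"] by (simp add: algebra_simps)
      finally have b: "norm (w x) \<le> 2 * ((q x + B) * norm (x - x0))"
        using wb[of x] elim by simp
      have "z x - z x0 - K (r' (x - x0)) = (K (r x) - K (r' (x - x0))) - E x (w x)"
        using wr[of x] elim by (simp add: w_def algebra_simps)
      then have "norm (z x - z x0 - K (r' (x - x0))) \<le> q x * norm (x - x0) + norm (E x (w x))"
        using norm_triangle_ineq4[of "K (r x) - K (r' (x - x0))" "E x (w x)"] a by metis
      also have "norm (E x (w x)) \<le> e x * (2 * ((q x + B) * norm (x - x0)))"
        using Ebound[of x "w x"] elim mult_left_mono[OF b e_nonneg[of x]] by simp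
      finally have "norm (z x - z x0 - K (r' (x - x0))) \<le> (q x + e x * (2 * (q x + B))) * norm (x - x0)"
        by (simp add: algebra_simps)
      then show ?case using n by (simp add: divide_le_eq)
    qed
    show "((\<lambda>y. norm (z y - z x0 - K (r' (y - x0))) / norm (y - x0)) \<longlongrightarrow> 0) (at x0)"
    proof (rule tendsto_sandwich[OF _ bd tendsto_const])
      show "((\<lambda>x. q x + e x * (2 * (q x + B))) \<longlongrightarrow> 0) (at x0)" using lim by simp
    qed simp
  qed
  then show thesis using that[of "\<lambda>v. K (r' v)"] K(3) by (simp add: r'_def)
qed

text \<open>Bootstrapping: the derivative of \<open>z\<close> solves a system with the same
  \<open>L\<close>, whose right-hand side contains \<open>z\<close> itself and one derivative of
  \<open>L\<close> and \<open>y\<close>. One order of smoothness is gained at each step.\<close>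

lemma Ck_on_solution_square:
  fixes L :: "'x::euclidean_space \<Rightarrow> 'a::euclidean_space \<Rightarrow> 'a"
  assumes S: "open S"
    and lin: "\<And>x. x \<in> S \<Longrightarrow> linear (L x)" and inj: "\<And>x u. x \<in> S \<Longrightarrow> L x u = 0 \<Longrightarrow> u = 0"
    and L: "\<And>u. Ck_on k (\<lambda>x. L x u) S" and y: "Ck_on k y S"
    and eq: "\<And>x. x \<in> S \<Longrightarrow> L x (z x) = y x"
  shows "Ck_on k z S"
  using L y eq
proof (induction k arbitrary: y z)
  case 0
  then show ?case using solution_continuous[OF S lin inj] by simp
next
  case (Suc k)
  have Ld: "(\<lambda>x. L x u) differentiable (at x)" and yd: "y differentiable (at x)" if "x \<in> S" for x u
    using Suc.prems(1)[of u] Suc.prems(2) that by simp_all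
  have *: "z differentiable (at x) \<and> (\<forall>v. L x (DD z x v) = DD y x v - DD (\<lambda>x'. L x' (z x)) x v)"
    if x: "x \<in> S" for x
  proof -
    obtain z' where "(z has_derivative z') (at x)"
      "\<And>v. L x (z' v) = DD y x v - DD (\<lambda>x'. L x' (z x)) x v"
      by (rule solution_has_derivative[OF S x lin inj Ld[OF x] yd[OF x] Suc.prems(3)]) auto
    then show ?thesis using DD_eq[of z z' x] by (auto simp: differentiable_def)
  qed
  have Lk: "Ck_on k (\<lambda>x. L x u) S" for u using Ck_on_Suc_D[OF Suc.prems(1)] .
  have zk: "Ck_on k z S"
    by (rule Suc.IH[OF Lk Ck_on_Suc_D[OF Suc.prems(2)] Suc.prems(3)])
  have "Ck_on k (\<lambda>x. DD z x v) S" for v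
  proof (rule Suc.IH[OF Lk])
    let ?M = "\<lambda>x u. DD (\<lambda>x'. L x' u) x v"
    have Mlin: "linear (?M x)" if "x \<in> S" for x
    proof (rule linearI)
      fix u w c
      have "DD (\<lambda>x'. L x' u + L x' w) x = DD (\<lambda>x'. L x' (u + w)) x"
        using DD_cong[OF S that, of "\<lambda>x'. L x' u + L x' w" "\<lambda>x'. L x' (u + w)"] linear_add[OF lin] by simp
      then show "?M x (u + w) = ?M x u + ?M x w"
        using fun_cong[OF DD_eq[OF has_derivative_add[OF has_derivative_DD[OF Ld[OF that, of u]] has_derivative_DD[OF Ld[OF that, of w]]]], of v]
        by simp
      have "DD (\<lambda>x'. c *\<^sub>R L x' u) x = DD (\<lambda>x'. L x' (c *\<^sub>R u)) x"
        using DD_cong[OF S that, of "\<lambda>x'. c *\<^sub>R L x' u" "\<lambda>x'. L x' (c *\<^sub>R u)"] linear_scale[OF lin] by simp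
      then show "?M x (c *\<^sub>R u) = c *\<^sub>R ?M x u"
        using fun_cong[OF DD_eq[OF has_derivative_scaleR_right[OF has_derivative_DD[OF Ld[OF that, of u]], of c]], of v]
        by simp
    qed
    have Mk: "Ck_on k (\<lambda>x. ?M x u) S" for u using Suc.prems(1)[of u] by simp
    have Mz: "Ck_on k (\<lambda>x. ?M x (z x)) S"
      by (rule Ck_on_linear_family[OF S Mlin Mk zk])
    have "Ck_on k (\<lambda>x. DD y x v + - ?M x (z x)) S"
      using Suc.prems(2)
      by (intro Ck_on_add[OF S] Ck_on_bounded_linear[OF bounded_linear_minus[OF bounded_linear_ident] S Mz]) simp
    then show "Ck_on k (\<lambda>x. DD y x v - ?M x (z x)) S" by simp
    show "L x (DD z x v) = DD y x v - ?M x (z x)" if "x \<in> S" for x using *[OF that] by simp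
  qed
  then show ?case using * by simp
qed

lemma smooth_on_solution:
  fixes L :: "'x::euclidean_space \<Rightarrow> 'a::euclidean_space \<Rightarrow> 'b::euclidean_space"
  assumes S: "open S"
    and lin: "\<And>x. x \<in> S \<Longrightarrow> linear (L x)" and inj: "\<And>x u. x \<in> S \<Longrightarrow> L x u = 0 \<Longrightarrow> u = 0"
    and L: "\<And>u. smooth_on (\<lambda>x. L x u) S" and y: "smooth_on y S"
    and eq: "\<And>x. x \<in> S \<Longrightarrow> L x (z x) = y x"
  shows "smooth_on z S"
proof -
  \<comment> \<open>the normal equations \<open>L\<^sup>T L z = L\<^sup>T y\<close> are square\<close>
  define T where "T x w = (\<Sum>b\<in>Basis. (L x b \<bullet> w) *\<^sub>R b)" for x w
  have Tin: "T x w \<bullet> u = L x u \<bullet> w" if "x \<in> S" for x w u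
  proof -
    have "T x w \<bullet> u = (\<Sum>b\<in>Basis. (u \<bullet> b) *\<^sub>R L x b) \<bullet> w"
    proof -
      have "T x w \<bullet> u = (\<Sum>b\<in>Basis. (L x b \<bullet> w) * (b \<bullet> u))" by (simp add: T_def inner_sum_left)
      also have "\<dots> = (\<Sum>b\<in>Basis. (u \<bullet> b) * (L x b \<bullet> w))"
        by (rule sum.cong) (simp_all add: inner_commute[of u] mult.commute)
      finally show ?thesis by (simp add: inner_sum_left)
    qed
    then show ?thesis using linear_euclidean_expand[OF lin[OF that], of u] by metis
  qed
  have Tsm: "smooth_on (\<lambda>x. T x (f x)) S" if "smooth_on f S" for f
  proof -
    have "smooth_on (\<lambda>x. (L x b \<bullet> f x) *\<^sub>R b) S" for b
      by (rule smooth_on_bounded_linear[OF bounded_linear_scaleR_left S smooth_on_inner[OF S L that]])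
    then show ?thesis unfolding T_def by (rule smooth_on_sum[OF S])
  qed
  have Tlin: "linear (T x)" for x
    unfolding T_def by (rule linearI) (simp_all add: inner_add_right scaleR_add_left sum.distrib scaleR_sum_right)
  show ?thesis
    unfolding smooth_on_def
  proof
    fix k show "Ck_on k z S"
    proof (rule Ck_on_solution_square[OF S, of "\<lambda>x u. T x (L x u)" k "\<lambda>x. T x (y x)" z])
      show "linear (\<lambda>u. T x (L x u))" if "x \<in> S" for x
        using linear_compose[OF lin[OF that] Tlin] by (simp add: o_def)
      show "u = 0" if "x \<in> S" "T x (L x u) = 0" for x u
        using Tin[OF that(1), of "L x u" u] that inj by simp
      show "Ck_on k (\<lambda>x. T x (L x u)) S" for u using Tsm[OF L] by (simp add: smooth_on_def)
      show "Ck_on k (\<lambda>x. T x (y x)) S" using Tsm[OF y] by (simp add: smooth_on_def)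
      show "T x (L x (z x)) = T x (y x)" if "x \<in> S" for x using eq[OF that] by simp
    qed
  qed
qed

section \<open>Local existence for ordinary differential equations\<close>

text \<open>Compactness bounds the derivative on the basis vectors, hence in operator norm;
  convexity allows the mean value inequality.\<close>

lemma smooth_on_lipschitz:
  fixes f :: "'a::euclidean_space \<Rightarrow> 'b::euclidean_space"
  assumes f: "smooth_on f U" and S: "compact S" "convex S" "S \<subseteq> U"
  obtains L where "L \<ge> 0" "\<And>x y. x \<in> S \<Longrightarrow> y \<in> S \<Longrightarrow> norm (f x - f y) \<le> L * norm (x - y)"
proof -
  have "continuous_on S (\<lambda>x. \<Sum>b\<in>Basis. norm (DD f x b))"
    using continuous_on_subset[OF smooth_on_continuous_on[OF smooth_on_DD[OF f]] S(3)]
    by (intro continuous_on_sum continuous_on_norm)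
  then have "bounded ((\<lambda>x. \<Sum>b\<in>Basis. norm (DD f x b)) ` S)"
    by (rule compact_imp_bounded[OF compact_continuous_image[OF _ S(1)]])
  then obtain L where L: "\<And>x. x \<in> S \<Longrightarrow> \<bar>\<Sum>b\<in>Basis. norm (DD f x b)\<bar> \<le> L"
    unfolding bounded_iff by (metis imageI real_norm_def)
  have on: "onorm (DD f x) \<le> \<bar>L\<bar>" if "x \<in> S" for x
  proof (rule onorm_bound)
    fix v
    have "DD f x v = (\<Sum>b\<in>Basis. (v \<bullet> b) *\<^sub>R DD f x b)"
      using that S(3) by (intro DD_expand smooth_on_differentiable[OF f]) auto
    then have "norm (DD f x v) = norm (\<Sum>b\<in>Basis. (v \<bullet> b) *\<^sub>R DD f x b)" by metis
    also have "\<dots> \<le> (\<Sum>b\<in>Basis. norm v * norm (DD f x b))"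
      by (rule sum_norm_le) (auto intro!: mult_right_mono Basis_le_norm)
    also have "\<dots> = norm v * (\<Sum>b\<in>Basis. norm (DD f x b))" by (simp add: sum_distrib_left)
    also have "\<dots> \<le> norm v * \<bar>L\<bar>" using L[OF that] by (intro mult_left_mono) auto
    finally show "norm (DD f x v) \<le> \<bar>L\<bar> * norm v" by (simp add: mult.commute)
  qed simp
  have "norm (f x - f y) \<le> \<bar>L\<bar> * norm (x - y)" if "x \<in> S" "y \<in> S" for x y
    using S(3) on that
    by (intro differentiable_bound[OF S(2), of f "DD f"])
       (auto intro!: has_derivative_at_withinI smooth_on_has_derivative[OF f])
  then show thesis using that[of "\<bar>L\<bar>"] by simp
qed

text \<open>Picard iteration as a contraction of the bounded continuous functions on the whole real
  line. For this the right-hand side is extended to all of space and time is clamped to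
  \<open>{-\<delta>..\<delta>}\<close>.\<close>

lemma ode_local_existence:
  fixes f :: "'a::euclidean_space \<Rightarrow> 'a"
  assumes U: "open U" and x0: "x0 \<in> U" and f: "smooth_on f U"
  obtains \<delta> y where "\<delta> > 0" "y 0 = x0" "\<And>t. t \<in> {-\<delta><..<\<delta>} \<Longrightarrow> y t \<in> U"
    "\<And>t. t \<in> {-\<delta><..<\<delta>} \<Longrightarrow> (y has_vector_derivative f (y t)) (at t)"
proof -
  obtain r where r: "r > 0" "cball x0 r \<subseteq> U" using U x0 open_contains_cball by blast
  let ?B = "cball x0 r"
  \<comment> \<open>The nearest-point projection onto a convex set does not increase distances, so
    \<open>F\<close> is globally Lipschitz and bounded, and agrees with \<open>f\<close> on the
    ball.\<close>
  define F where "F = f \<circ> closest_point ?B"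
  have B: "compact ?B" "convex ?B" "closed ?B" "?B \<noteq> {}" using r by auto
  have cp: "closest_point ?B x \<in> ?B" for x using closest_point_in_set[OF B(3,4)] .
  obtain L where L: "L \<ge> 0" "\<And>x y. x \<in> ?B \<Longrightarrow> y \<in> ?B \<Longrightarrow> norm (f x - f y) \<le> L * norm (x - y)"
    using smooth_on_lipschitz[OF f B(1,2) r(2)] by blast
  have FL: "norm (F x - F y) \<le> L * norm (x - y)" for x y
  proof -
    have "norm (F x - F y) \<le> L * norm (closest_point ?B x - closest_point ?B y)"
      using L(2)[OF cp cp] by (simp add: F_def)
    also have "\<dots> \<le> L * norm (x - y)"
      using closest_point_lipschitz[OF B(2,3,4), of x y] L(1)
      by (intro mult_left_mono) (simp_all add: dist_norm)
    finally show ?thesis .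
  qed
  have Fc: "continuous_on UNIV F"
    unfolding F_def
    using continuous_on_subset[OF smooth_on_continuous_on[OF f] r(2)] cp
    by (intro continuous_on_compose continuous_on_closest_point B)
       (auto intro: continuous_on_subset)
  obtain M where M: "\<And>x. x \<in> ?B \<Longrightarrow> norm (f x) \<le> M"
    using compact_imp_bounded[OF compact_continuous_image[OF continuous_on_subset[OF smooth_on_continuous_on[OF f] r(2)] B(1)]]
    unfolding bounded_iff by blast
  have FM: "norm (F x) \<le> M" for x using M[OF cp] by (simp add: F_def)
  have M0: "M \<ge> 0" using FM[of x0] norm_ge_zero order_trans by blast
  \<comment> \<open>The first bound makes the Picard map a contraction with factor
    \<open>1/2\<close>, the second keeps its values in the ball. The 4 is the cost of two integrals,
    each over a length of at most \<open>2 * \<delta>\<close>; the added 1 avoids division by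
    zero.\<close>
  define \<delta> where "\<delta> = min (1 / (8 * (L + 1))) (r / (4 * (M + 1)))"
  have \<delta>: "\<delta> > 0" using L(1) M0 r(1) by (simp add: \<delta>_def)
  have "\<delta> \<le> 1 / (8 * (L + 1))" by (simp add: \<delta>_def)
  then have "\<delta> * (8 * (L + 1)) \<le> 1" using L(1) by (simp add: le_divide_eq)
  then have \<delta>L: "4 * \<delta> * L \<le> 1/2" using \<delta> by (simp add: algebra_simps)
  have "\<delta> \<le> r / (4 * (M + 1))" by (simp add: \<delta>_def)
  then have "\<delta> * (4 * (M + 1)) \<le> r" using M0 by (simp add: le_divide_eq)
  then have \<delta>M: "4 * \<delta> * M \<le> r" using \<delta> by (simp add: algebra_simps)
  define cl where "cl t = max (-\<delta>) (min \<delta> t)" for t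
  have cl: "cl t \<in> {-\<delta>..\<delta>}" for t using \<delta> by (auto simp: cl_def)
  have clc: "continuous_on UNIV cl" unfolding cl_def by (intro continuous_intros)
  have Fx: "continuous_on T (\<lambda>s. F (apply_bcontfun x s))" for x :: "real \<Rightarrow>\<^sub>C 'a" and T
    using continuous_on_compose2[OF Fc, of T "apply_bcontfun x"] by simp
  have int: "(\<lambda>s. F (apply_bcontfun x s)) integrable_on {a..b}" for x :: "real \<Rightarrow>\<^sub>C 'a" and a b
    by (rule integrable_continuous_real[OF Fx])
  \<comment> \<open>The integral from 0 to \<open>cl t\<close>, written as a difference of integrals
    from \<open>-\<delta>\<close> because \<open>integral {0..s}\<close> vanishes for negative
    \<open>s\<close> instead of changing sign.\<close>
  define P where "P x t = x0 + integral {-\<delta>..cl t} (\<lambda>s. F (apply_bcontfun x s))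
      - integral {-\<delta>..0} (\<lambda>s. F (apply_bcontfun x s))" for x :: "real \<Rightarrow>\<^sub>C 'a" and t
  have ib: "norm (integral {-\<delta>..c} g) \<le> 2 * \<delta> * K"
    if "c \<in> {-\<delta>..\<delta>}" "continuous_on {-\<delta>..c} g" "\<And>s. norm (g s) \<le> K" for c K and g :: "real \<Rightarrow> 'a"
  proof -
    have K: "K \<ge> 0" using that(3)[of 0] norm_ge_zero order_trans by blast
    have "norm (integral {-\<delta>..c} g) \<le> K * (c - - \<delta>)"
      using that by (intro integral_bound) auto
    also have "\<dots> \<le> K * (2 * \<delta>)" using that(1) K by (intro mult_left_mono) auto
    finally show ?thesis by (simp add: mult.commute)
  qed
  have z0: "0 \<in> {-\<delta>..\<delta>}" using \<delta> by simp
  have Pb: "norm (P x t - x0) \<le> r" for x t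
  proof -
    have "norm (P x t - x0) = norm (integral {-\<delta>..cl t} (\<lambda>s. F (apply_bcontfun x s)) - integral {-\<delta>..0} (\<lambda>s. F (apply_bcontfun x s)))"
      by (simp add: P_def)
    then have "norm (P x t - x0) \<le> 2 * \<delta> * M + 2 * \<delta> * M"
      using norm_triangle_ineq4[of "integral {-\<delta>..cl t} (\<lambda>s. F (apply_bcontfun x s))" "integral {-\<delta>..0} (\<lambda>s. F (apply_bcontfun x s))"]
        ib[OF cl[of t] Fx FM, of x] ib[OF z0 Fx FM, of x] by linarith
    then show ?thesis using \<delta>M by linarith
  qed
  have Pc: "P x \<in> bcontfun" for x
  proof (rule bcontfun_normI)
    have "continuous_on {-\<delta>..\<delta>} (\<lambda>u. integral {-\<delta>..u} (\<lambda>s. F (apply_bcontfun x s)))"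
      by (rule indefinite_integral_continuous_1[OF int])
    then have "continuous_on UNIV (\<lambda>t. integral {-\<delta>..cl t} (\<lambda>s. F (apply_bcontfun x s)))"
      using continuous_on_compose2[OF _ clc] cl by blast
    then show "continuous_on UNIV (P x)" unfolding P_def by (intro continuous_intros)
    show "norm (P x t) \<le> norm x0 + r" for t
      using Pb[of x t] norm_triangle_ineq[of "P x t - x0" x0] by simp
  qed
  have "\<exists>!x. Bcontfun (P x) = x"
  proof (rule banach_fix_type[of "1/2"])
    show "\<forall>x y. dist (Bcontfun (P x)) (Bcontfun (P y)) \<le> 1/2 * dist x y"
    proof (intro allI dist_bound)
      fix x y :: "real \<Rightarrow>\<^sub>C 'a" and t
      let ?g = "\<lambda>s. F (apply_bcontfun x s) - F (apply_bcontfun y s)"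
      have gb: "norm (?g s) \<le> L * dist x y" for s
        using FL[of "apply_bcontfun x s" "apply_bcontfun y s"] dist_bounded[of x s y] L(1)
        by (smt (verit) dist_norm mult_left_mono)
      have gc: "continuous_on T ?g" for T by (intro continuous_intros Fx)
      have "P x t - P y t = integral {-\<delta>..cl t} ?g - integral {-\<delta>..0} ?g"
        by (simp add: P_def integral_diff int)
      then have "dist (P x t) (P y t) \<le> norm (integral {-\<delta>..cl t} ?g) + norm (integral {-\<delta>..0} ?g)"
        by (simp add: dist_norm norm_triangle_ineq4)
      also have "\<dots> \<le> 2 * \<delta> * (L * dist x y) + 2 * \<delta> * (L * dist x y)"
        using \<delta> by (intro add_mono ib gb gc cl) auto
      also have "\<dots> = (4 * \<delta> * L) * dist x y" by simp
      also have "\<dots> \<le> 1/2 * dist x y" using \<delta>L by (intro mult_right_mono) auto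
      finally show "dist (apply_bcontfun (Bcontfun (P x)) t) (apply_bcontfun (Bcontfun (P y)) t) \<le> 1/2 * dist x y"
        by (simp add: Bcontfun_inverse Pc)
    qed
  qed auto
  then obtain x where x: "Bcontfun (P x) = x" by blast
  have xP: "apply_bcontfun x t = P x t" for t using Bcontfun_inverse[OF Pc[of x]] x by metis
  define y where "y = apply_bcontfun x"
  show thesis
  proof (rule that[of \<delta> y])
    have yP: "y t = x0 + integral {-\<delta>..cl t} (\<lambda>s. F (y s)) - integral {-\<delta>..0} (\<lambda>s. F (y s))" for t
      unfolding y_def using xP[of t] unfolding P_def .
    show "y 0 = x0" using yP[of 0] \<delta> by (simp add: cl_def)
    have inB: "y t \<in> ?B" for t
      using Pb[of x t] xP[of t] by (simp add: y_def dist_norm norm_minus_commute)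
    then show "y t \<in> U" for t using r(2) by blast
    show "(y has_vector_derivative f (y t)) (at t)" if t: "t \<in> {-\<delta><..<\<delta>}" for t
    proof -
      have "F (y t) = f (y t)" using closest_point_self[OF inB] by (simp add: F_def)
      moreover have "((\<lambda>u. integral {-\<delta>..u} (\<lambda>s. F (y s))) has_vector_derivative F (y t)) (at t within {-\<delta>..\<delta>})"
        unfolding y_def using t by (intro integral_has_vector_derivative Fx) auto
      then have "((\<lambda>u. integral {-\<delta>..u} (\<lambda>s. F (y s))) has_vector_derivative F (y t)) (at t)"
        using t at_within_Icc_at[of "-\<delta>" t \<delta>] by simp
      then have "((\<lambda>u. x0 + integral {-\<delta>..u} (\<lambda>s. F (y s)) - integral {-\<delta>..0} (\<lambda>s. F (y s))) has_vector_derivative F (y t)) (at t)"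
        using has_vector_derivative_diff[OF has_vector_derivative_add[OF has_vector_derivative_const] has_vector_derivative_const]
        by fastforce
      moreover have "x0 + integral {-\<delta>..u} (\<lambda>s. F (y s)) - integral {-\<delta>..0} (\<lambda>s. F (y s)) = y u"
        if "u \<in> {-\<delta><..<\<delta>}" for u
        using that yP[of u] by (simp add: cl_def)
      ultimately show ?thesis
        using has_vector_derivative_transform_within_open[of _ _ t "{-\<delta><..<\<delta>}" y] t by fastforce
    qed
  qed (use \<delta> in auto)
qed

text \<open>If \<open>y\<close> has \<open>k\<close> continuous derivatives, so has
  \<open>f \<circ> y\<close>, which is the derivative of \<open>y\<close>.\<close>

lemma smooth_on_ode_solution:
  fixes f :: "'a::euclidean_space \<Rightarrow> 'a"
  assumes U: "open U" and f: "smooth_on f U" and I: "open I" and yU: "\<And>t. t \<in> I \<Longrightarrow> y t \<in> U"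
    and y: "\<And>t. t \<in> I \<Longrightarrow> (y has_vector_derivative f (y t)) (at t)"
  shows "smooth_on y I"
  unfolding smooth_on_def
proof
  fix k show "Ck_on k y I"
  proof (induction k)
    case 0
    show ?case using y
      by (auto intro!: continuous_at_imp_continuous_on has_vector_derivative_continuous)
  next
    case (Suc k)
    have fy: "Ck_on k (\<lambda>t. f (y t)) I"
      by (rule Ck_on_compose[OF U I _ _ Suc]) (use yU f in \<open>auto simp: smooth_on_def\<close>)
    have D: "(y has_derivative (\<lambda>v. v *\<^sub>R f (y t))) (at t)" if "t \<in> I" for t
      using y[OF that] by (simp add: has_vector_derivative_def)
    have "Ck_on k (\<lambda>t. DD y t v) I" for v
      by (rule Ck_on_cong[OF I _ Ck_on_bounded_linear[OF bounded_linear_scaleR_right[of v] I fy]])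
         (simp add: DD_eq[OF D])
    then show ?case using D by (auto simp: differentiable_def)
  qed
qed

section \<open>Induced metrics\<close>

lemma has_derivative_DD_compose:
  fixes f :: "'e::euclidean_space \<Rightarrow> 'v::euclidean_space"
  assumes S: "open S" and f: "smooth_on f S" and t: "a t \<in> S"
    and a: "(a has_derivative a') (at t)" and W: "(W has_derivative W') (at t)"
  shows "((\<lambda>s. DD f (a s) (W s)) has_derivative
           (\<lambda>h. DD (\<lambda>y. DD f y (W t)) (a t) (a' h) + DD f (a t) (W' h))) (at t)"
proof -
  have "isCont a t" using a has_derivative_continuous by blast
  then obtain T where T: "open T" "t \<in> T" "\<And>s. s \<in> T \<Longrightarrow> a s \<in> S"
    using S t by (metis continuous_at_open)
  show ?thesis
  proof (rule has_derivative_linear_family[OF T(1,2) _ _ W])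
    show "linear (DD f (a s))" if "s \<in> T" for s
      by (rule linear_frechet_derivative[OF smooth_on_differentiable[OF f T(3)[OF that]]])
    show "((\<lambda>s. DD f (a s) p) has_derivative (\<lambda>h. DD (\<lambda>y. DD f y p) (a t) (a' h))) (at t)" for p
      using has_derivative_compose[OF a smooth_on_has_derivative[OF smooth_on_DD[OF f] t]] by simp
  qed
qed

lemma has_vector_derivative_DD_compose:
  fixes f :: "'e::euclidean_space \<Rightarrow> 'v::euclidean_space"
  assumes S: "open S" and f: "smooth_on f S" and t: "a t \<in> S"
    and a: "(a has_vector_derivative a') (at t)" and W: "(W has_vector_derivative W') (at t)"
  shows "((\<lambda>s. DD f (a s) (W s)) has_vector_derivative
           DD (\<lambda>y. DD f y (W t)) (a t) a' + DD f (a t) W') (at t)"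
  using has_derivative_DD_compose[OF S f t a[unfolded has_vector_derivative_def] W[unfolded has_vector_derivative_def]]
    linear_scale[OF DD_linear[OF smooth_on_differentiable[OF f t]]]
    linear_scale[OF DD_linear[OF smooth_on_differentiable[OF smooth_on_DD[OF f] t]]]
  by (simp add: has_vector_derivative_def scaleR_add_right)

text \<open>Linearity in the last direction is that of a derivative; symmetry carries it over to the
  first.\<close>

lemma second_derivative_linear:
  fixes f :: "'e::euclidean_space \<Rightarrow> 'v::euclidean_space"
  assumes "open S" "smooth_on f S" "x \<in> S"
  shows "linear (\<lambda>u. DD (\<lambda>y. DD f y u) x v)" "linear (\<lambda>v. DD (\<lambda>y. DD f y u) x v)"
proof -
  show 2: "linear (\<lambda>v. DD (\<lambda>y. DD f y u) x v)" for u
    using DD_linear[OF smooth_on_differentiable[OF smooth_on_DD[OF assms(2)] assms(3)]] .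
  show "linear (\<lambda>u. DD (\<lambda>y. DD f y u) x v)"
    using 2[of v] symmetric_second_derivative[OF assms(1,3,2)] by simp
qed

text \<open>\<open>B\<close> may be Lorentzian, so nondegeneracy of the induced form takes the place
  of injectivity of the differential. The locale covers charts of the ambient space form and charts
  of the hypersurface alike.\<close>

locale immersion =
  fixes S :: "'e::euclidean_space set" and \<sigma> :: "'e \<Rightarrow> 'v::euclidean_space" and B :: "'v \<Rightarrow> 'v \<Rightarrow> real"
  assumes S: "open S" and sm: "smooth_on \<sigma> S" and B: "bounded_bilinear B"
    and Bsym: "B v w = B w v"
    and nondeg: "x \<in> S \<Longrightarrow> (\<And>w. B (DD \<sigma> x z) (DD \<sigma> x w) = 0) \<Longrightarrow> z = 0"
begin

sublocale B: bounded_bilinear B by (rule B)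

lemmas Bsimps = B.add_left B.add_right B.diff_left B.diff_right B.scaleR_left B.scaleR_right
  B.minus_left B.minus_right B.zero_left B.zero_right

abbreviation d1 :: "'e \<Rightarrow> 'e \<Rightarrow> 'v" where "d1 x u \<equiv> DD \<sigma> x u"
abbreviation d2 :: "'e \<Rightarrow> 'e \<Rightarrow> 'e \<Rightarrow> 'v" where "d2 x u v \<equiv> DD (\<lambda>y. DD \<sigma> y u) x v"

definition ind :: "'e local_metric" where "ind x u v = B (d1 x u) (d1 x v)"

lemma d1_linear: "x \<in> S \<Longrightarrow> linear (d1 x)"
  using DD_linear[OF smooth_on_differentiable[OF sm]] by simp

lemma d2_sym: "x \<in> S \<Longrightarrow> d2 x u v = d2 x v u"
  using symmetric_second_derivative[OF S _ sm] .

lemmas d1_simps = linear_add[OF d1_linear] linear_diff[OF d1_linear] linear_scale[OF d1_linear]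
  linear_0[OF d1_linear] linear_neg[OF d1_linear]

lemma d1_differentiable: "x \<in> S \<Longrightarrow> (\<lambda>y. d1 y u) differentiable (at x)"
  using smooth_on_differentiable[OF smooth_on_DD[OF sm]] .

lemma DD_ind: "x \<in> S \<Longrightarrow> DD (\<lambda>y. ind y v w) x u = B (d1 x v) (d2 x w u) + B (d2 x v u) (d1 x w)"
  unfolding ind_def by (rule DD_bilinear[OF B d1_differentiable d1_differentiable])

lemma ind_differentiable: "x \<in> S \<Longrightarrow> (\<lambda>y. ind y v w) differentiable (at x)"
  unfolding ind_def
  using bounded_bilinear.FDERIV[OF B has_derivative_DD[OF d1_differentiable] has_derivative_DD[OF d1_differentiable]]
  unfolding differentiable_def by blast

lemma tangential_unique:
  "x \<in> S \<Longrightarrow> (\<And>w. B (d1 x z) (d1 x w) = B (d1 x z') (d1 x w)) \<Longrightarrow> z = z'"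
  using nondeg[of x "z - z'"] by (simp add: d1_simps Bsimps)

text \<open>The adjoint of \<open>d1 x\<close> with respect to \<open>B\<close> and the inner
  product of the chart. Preceded by \<open>d1 x\<close> it becomes the Gram matrix of the induced
  metric, which turns tangential projection into a square linear system.\<close>

definition gram :: "'e \<Rightarrow> 'v \<Rightarrow> 'e" where "gram x r = (\<Sum>b\<in>Basis. B r (d1 x b) *\<^sub>R b)"

lemma gram_inner: assumes "x \<in> S" shows "gram x r \<bullet> w = B r (d1 x w)"
proof -
  have "gram x r \<bullet> w = (\<Sum>b\<in>Basis. B r (d1 x b) * (b \<bullet> w))"
    by (simp add: gram_def inner_sum_left)
  also have "\<dots> = B r (\<Sum>b\<in>Basis. (w \<bullet> b) *\<^sub>R d1 x b)"
    by (simp add: B.sum_right Bsimps inner_commute mult.commute)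
  finally show ?thesis
    using linear_euclidean_expand[OF d1_linear[OF assms], of w] by metis
qed

lemma gram_linear: "linear (gram x)"
  unfolding gram_def by (rule linearI) (simp_all add: Bsimps scaleR_add_left sum.distrib scaleR_sum_right)

lemma gram_d1_linear: "x \<in> S \<Longrightarrow> linear (\<lambda>z. gram x (d1 x z))"
  using linear_compose[OF d1_linear gram_linear, unfolded o_def] .

lemma gram_d1_inj: assumes "x \<in> S" "gram x (d1 x z) = 0" shows "z = 0"
proof (rule nondeg[OF assms(1)])
  show "B (d1 x z) (d1 x w) = 0" for w
    using gram_inner[OF assms(1), of "d1 x z" w] assms(2) by simp
qed

lemma tangential_part_exists:
  assumes "x \<in> S"
  obtains z where "\<And>w. B (d1 x z) (d1 x w) = B r (d1 x w)"
proof -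
  have "inj (\<lambda>z. gram x (d1 x z))"
    using gram_d1_inj[OF assms] gram_d1_linear[OF assms] by (simp add: linear_injective_0)
  then have "surj (\<lambda>z. gram x (d1 x z))"
    using linear_injective_imp_surjective gram_d1_linear[OF assms] by blast
  then obtain z where "gram x (d1 x z) = gram x r" by (metis surjD)
  then show thesis using that[of z] gram_inner[OF assms] by metis
qed

text \<open>The tangential part solves the Gram system, whose coefficients are smooth. The base
  point is an arbitrary map \<open>a\<close>, so that both fields on the chart and fields along a
  curve are covered.\<close>

lemma smooth_on_tangential_part:
  fixes a :: "'t::euclidean_space \<Rightarrow> 'e"
  assumes T: "open T" and a: "smooth_on a T" "a ` T \<subseteq> S" and Y: "smooth_on Y T"
    and z: "\<And>t w. t \<in> T \<Longrightarrow> B (d1 (a t) (z t)) (d1 (a t) w) = B (Y t) (d1 (a t) w)"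
  shows "smooth_on z T"
proof (rule smooth_on_solution[OF T])
  have aS: "a t \<in> S" if "t \<in> T" for t using a(2) that by blast
  have sb: "smooth_on (\<lambda>t. d1 (a t) b) T" for b
    by (rule smooth_on_compose[OF S T a(2) smooth_on_DD[OF sm] a(1)])
  have sg: "smooth_on (\<lambda>t. gram (a t) (f t)) T" if "smooth_on f T" for f
  proof -
    have "smooth_on (\<lambda>t. B (f t) (d1 (a t) b) *\<^sub>R b) T" for b
      by (rule smooth_on_bounded_linear[OF bounded_linear_scaleR_left T smooth_on_bilinear[OF B T that sb]])
    then show ?thesis unfolding gram_def by (rule smooth_on_sum[OF T])
  qed
  show "linear (\<lambda>u. gram (a t) (d1 (a t) u))" if "t \<in> T" for t
    by (rule gram_d1_linear[OF aS[OF that]])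
  show "u = 0" if "t \<in> T" "gram (a t) (d1 (a t) u) = 0" for t u
    by (rule gram_d1_inj[OF aS[OF that(1)] that(2)])
  show "smooth_on (\<lambda>t. gram (a t) (d1 (a t) u)) T" for u by (rule sg[OF sb])
  show "smooth_on (\<lambda>t. gram (a t) (Y t)) T" by (rule sg[OF Y])
  show "gram (a t) (d1 (a t) (z t)) = gram (a t) (Y t)" if "t \<in> T" for t
    using gram_inner[OF aS[OF that]] z[OF that] by (metis vector_eq_rdot)
qed

text \<open>After insertion of the derivatives of the induced metric into the Koszul formula,
  symmetry of second derivatives cancels all terms but two equal ones. Thus the Christoffel term is
  the tangential part of the ambient second derivative.\<close>

lemma christoffel_ind:
  assumes G: "\<And>x. x \<in> S \<Longrightarrow> G x = ind x" and x: "x \<in> S"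
  shows "B (d1 x (christoffel G x u v)) (d1 x w) = B (d2 x u v) (d1 x w)"
proof -
  let ?K = "\<lambda>w. frechet_derivative (\<lambda>y. G y v w) (at x) u + frechet_derivative (\<lambda>y. G y u w) (at x) v
    - frechet_derivative (\<lambda>y. G y u v) (at x) w"
  have DG: "DD (\<lambda>y. G y v w) x u = B (d1 x v) (d2 x w u) + B (d2 x v u) (d1 x w)" for u v w
  proof -
    have "DD (\<lambda>y. G y v w) x = DD (\<lambda>y. ind y v w) x"
      by (rule DD_cong[OF S x]) (simp add: G)
    then show ?thesis using DD_ind[OF x] by simp
  qed
  have K: "?K w = 2 * B (d2 x u v) (d1 x w)" for w
    unfolding DG d2_sym[OF x, of w] d2_sym[OF x, of v u]
    by (simp add: Bsym[of "d1 x u"] Bsym[of "d1 x v"])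
  obtain z where z: "\<And>w. B (d1 x z) (d1 x w) = B (d2 x u v) (d1 x w)"
    using tangential_part_exists[OF x] by blast
  have "christoffel G x u v = z"
    unfolding christoffel_def
  proof (rule the_equality)
    show "\<forall>w. 2 * G x z w = ?K w" unfolding K by (simp add: G[OF x] ind_def z)
    show "z' = z" if "\<forall>w. 2 * G x z' w = ?K w" for z'
      using that unfolding K by (intro tangential_unique[OF x]) (simp add: G[OF x] ind_def z)
  qed
  then show ?thesis using z by simp
qed

lemma christoffel_eqI:
  assumes "\<And>x. x \<in> S \<Longrightarrow> G x = ind x" and x: "x \<in> S"
    and "\<And>w. B (d1 x z) (d1 x w) = B (d2 x u v) (d1 x w)"
  shows "christoffel G x u v = z"
  using christoffel_ind[OF assms(1) x] assms(3) by (intro tangential_unique[OF x]) simp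

lemma smooth_on_christoffel:
  assumes G: "\<And>x. x \<in> S \<Longrightarrow> G x = ind x"
  shows "smooth_on (\<lambda>x. christoffel G x u v) S"
  by (rule smooth_on_tangential_part[OF S smooth_on_ident _ smooth_on_DD[OF smooth_on_DD[OF sm]]])
     (auto simp: christoffel_ind[OF G])

lemma christoffel_linear:
  assumes G: "\<And>x. x \<in> S \<Longrightarrow> G x = ind x" and x: "x \<in> S"
  shows "linear (\<lambda>v. christoffel G x u v)" "linear (\<lambda>u. christoffel G x u v)"
proof -
  note l = second_derivative_linear[OF S sm x]
  show "linear (\<lambda>v. christoffel G x u v)"
    by (rule linearI; rule christoffel_eqI[OF G x])
       (simp_all add: d1_simps x Bsimps christoffel_ind[OF G x] linear_add[OF l(2)] linear_scale[OF l(2)])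
  show "linear (\<lambda>u. christoffel G x u v)"
    by (rule linearI; rule christoffel_eqI[OF G x])
       (simp_all add: d1_simps x Bsimps christoffel_ind[OF G x] linear_add[OF l(1)] linear_scale[OF l(1)])
qed

lemma has_vector_derivative_lift:
  assumes "a t \<in> S" "(a has_vector_derivative a') (at t)" "(W has_vector_derivative W') (at t)"
  shows "((\<lambda>s. d1 (a s) (W s)) has_vector_derivative d2 (a t) (W t) a' + d1 (a t) W') (at t)"
  by (rule has_vector_derivative_DD_compose[where f = \<sigma>, OF S sm assms])

text \<open>The covariant derivative is the tangential part of the ambient derivative; this is what
  moves the calculation out of charts.\<close>

lemma nabla_along_ind:
  assumes G: "\<And>x. x \<in> S \<Longrightarrow> G x = ind x" and t: "a t \<in> S"
    and a: "a differentiable (at t)" and W: "W differentiable (at t)"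
  shows "B (d1 (a t) (nabla_along G a W t)) (d1 (a t) w)
    = B (vector_derivative (\<lambda>s. d1 (a s) (W s)) (at t)) (d1 (a t) w)"
  using vector_derivative_at[OF has_vector_derivative_lift[OF t
      a[unfolded vector_derivative_works] W[unfolded vector_derivative_works]]]
  by (simp add: nabla_along_def velocity_def d1_simps t Bsimps christoffel_ind[OF G t]
      d2_sym[OF t, of "vector_derivative a (at t)"])

text \<open>The second-order equation is solved as an autonomous first-order system for position and
  velocity. Smoothness of its right-hand side follows from linearity of the Christoffel term in each
  of its two vector arguments.\<close>

lemma geodesic_exists:
  assumes G: "\<And>x. x \<in> S \<Longrightarrow> G x = ind x" and x0: "x0 \<in> S"
  obtains \<delta> a where "\<delta> > 0" "a 0 = x0" "velocity a 0 = u0" "smooth_on a {-\<delta><..<\<delta>}"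
    "a ` {-\<delta><..<\<delta>} \<subseteq> S" "\<And>t. t \<in> {-\<delta><..<\<delta>} \<Longrightarrow> nabla_along G a (velocity a) t = 0"
proof -
  let ?U = "S \<times> (UNIV :: 'e set)"
  let ?f = "\<lambda>p. (snd p, - christoffel G (fst p) (snd p) (snd p))"
  have U: "open ?U" using S by (simp add: open_Times)
  have fst: "smooth_on (\<lambda>p::'e\<times>'e. fst p) ?U" and snd: "smooth_on (\<lambda>p::'e\<times>'e. snd p) ?U"
    by (rule smooth_on_bounded_linear[OF bounded_linear_fst U smooth_on_ident],
        rule smooth_on_bounded_linear[OF bounded_linear_snd U smooth_on_ident])
  have c1: "smooth_on (\<lambda>p. christoffel G (fst p) u v) ?U" for u v
    by (rule smooth_on_compose[OF S U _ smooth_on_christoffel[OF G] fst]) auto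
  have c2: "smooth_on (\<lambda>p. christoffel G (fst p) u (snd p)) ?U" for u
    by (rule smooth_on_linear_family[OF U christoffel_linear(1)[OF G] c1 snd]) auto
  have c3: "smooth_on (\<lambda>p. christoffel G (fst p) (snd p) (snd p)) ?U"
    by (rule smooth_on_linear_family[where L = "\<lambda>p u. christoffel G (fst p) u (snd p)",
          OF U christoffel_linear(2)[OF G] c2 snd]) auto
  have f: "smooth_on ?f ?U"
    by (rule smooth_on_Pair[OF U snd smooth_on_minus[OF U c3]])
  obtain \<delta> y where \<delta>: "\<delta> > 0" and y0: "y 0 = (x0, u0)" and yU: "\<And>t. t \<in> {-\<delta><..<\<delta>} \<Longrightarrow> y t \<in> ?U"
    and yd: "\<And>t. t \<in> {-\<delta><..<\<delta>} \<Longrightarrow> (y has_vector_derivative ?f (y t)) (at t)"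
    using ode_local_existence[OF U _ f, of "(x0, u0)"] x0 by blast
  have ys: "smooth_on y {-\<delta><..<\<delta>}"
    by (rule smooth_on_ode_solution[OF U f open_greaterThanLessThan yU yd])
  define a where "a t = fst (y t)" for t
  have ad: "(a has_vector_derivative snd (y t)) (at t)"
    and ud: "((\<lambda>t. snd (y t)) has_vector_derivative - christoffel G (a t) (snd (y t)) (snd (y t))) (at t)"
    if "t \<in> {-\<delta><..<\<delta>}" for t
    using bounded_linear.has_vector_derivative[OF bounded_linear_fst yd[OF that]]
      bounded_linear.has_vector_derivative[OF bounded_linear_snd yd[OF that]]
    by (simp_all add: a_def[abs_def])
  have vel: "velocity a t = snd (y t)" if "t \<in> {-\<delta><..<\<delta>}" for t
    unfolding velocity_def by (rule vector_derivative_at[OF ad[OF that]])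
  have vd: "(velocity a has_vector_derivative - christoffel G (a t) (snd (y t)) (snd (y t))) (at t)"
    if "t \<in> {-\<delta><..<\<delta>}" for t
    by (rule has_vector_derivative_transform_within_open[OF ud[OF that] open_greaterThanLessThan that])
       (simp add: vel)
  show thesis
  proof (rule that[of \<delta> a])
    show "a 0 = x0" by (simp add: a_def y0)
    show "velocity a 0 = u0" using vel[of 0] y0 \<delta> by simp
    show "smooth_on a {-\<delta><..<\<delta>}"
      unfolding a_def by (rule smooth_on_bounded_linear[OF bounded_linear_fst open_greaterThanLessThan ys])
    show "a ` {-\<delta><..<\<delta>} \<subseteq> S" using yU by (auto simp: a_def mem_Times_iff)
    show "nabla_along G a (velocity a) t = 0" if "t \<in> {-\<delta><..<\<delta>}" for t
      using vector_derivative_at[OF vd[OF that]] vel[OF that] by (simp add: nabla_along_def)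
  qed (rule \<delta>)
qed

end

section \<open>Curves in space forms\<close>

lemma velocity_cong:
  assumes "open J" "t \<in> J" "\<And>s. s \<in> J \<Longrightarrow> f s = g s"
  shows "velocity f t = velocity g t"
proof -
  have "(f has_vector_derivative D) (at t) \<longleftrightarrow> (g has_vector_derivative D) (at t)" for D
    using assms has_vector_derivative_transform_within_open[of f D t J g]
      has_vector_derivative_transform_within_open[of g D t J f] by auto
  then show ?thesis by (simp add: velocity_def vector_derivative_def)
qed

lemma smooth_on_velocity:
  assumes "open J" "smooth_on f J"
  shows "smooth_on (velocity f) J"
proof (rule smooth_on_cong[OF assms(1)])
  show "smooth_on (\<lambda>t. DD f t 1) J" by (rule smooth_on_DD[OF assms(2)])
  show "DD f t 1 = velocity f t" if "t \<in> J" for t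
    using frechet_derivative_eq_vector_derivative[OF smooth_on_differentiable[OF assms(2) that]]
    by (simp add: velocity_def)
qed

lemma has_velocity:
  "f differentiable (at t) \<Longrightarrow> (f has_vector_derivative velocity f t) (at t)"
  by (simp add: velocity_def vector_derivative_works)

lemma velocity_eqI: "(f has_vector_derivative f') (at t) \<Longrightarrow> velocity f t = f'"
  unfolding velocity_def by (rule vector_derivative_at)

lemma velocity_bilinear:
  assumes "bounded_bilinear h" "f differentiable (at t)" "g differentiable (at t)"
  shows "velocity (\<lambda>s. h (f s) (g s)) t = h (f t) (velocity g t) + h (velocity f t) (g t)"
  by (rule velocity_eqI[OF bounded_bilinear.has_vector_derivative[OF assms(1) has_velocity has_velocity, OF assms(2,3)]])

lemma velocity_zero:
  assumes "open J" "t \<in> J" "\<And>s. s \<in> J \<Longrightarrow> f s = c"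
  shows "velocity f t = 0"
  using velocity_cong[OF assms(1,2), of f "\<lambda>_. c"] assms(3) by (simp add: velocity_def)

text \<open>The covariant derivative, along the curve \<open>\<eta>\<close> in a space form, of a tangent field \<open>Z\<close>, both
  regarded as maps into the ambient space.\<close>

definition cov :: "('v \<Rightarrow> 'v \<Rightarrow> real) \<Rightarrow> real \<Rightarrow> (real \<Rightarrow> 'v::euclidean_space) \<Rightarrow> (real \<Rightarrow> 'v) \<Rightarrow> real \<Rightarrow> 'v" where
  "cov B \<rho> \<eta> Z t = velocity Z t + (\<rho> * B (Z t) (velocity \<eta> t)) *\<^sub>R \<eta> t"

text \<open>For unit speed, \<open>velocity (velocity \<eta>) + \<rho> \<eta>\<close> is the
  covariant acceleration. The last summand is the curvature term, which simplifies because the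
  acceleration is orthogonal to the unit velocity.\<close>

definition biharmonic_ambient_at :: "('v \<Rightarrow> 'v \<Rightarrow> real) \<Rightarrow> real \<Rightarrow> (real \<Rightarrow> 'v::euclidean_space) \<Rightarrow> real \<Rightarrow> bool" where
  "biharmonic_ambient_at B \<rho> \<eta> t \<longleftrightarrow>
     cov B \<rho> \<eta> (cov B \<rho> \<eta> (\<lambda>s. velocity (velocity \<eta>) s + \<rho> *\<^sub>R \<eta> s)) t
       + \<rho> *\<^sub>R (velocity (velocity \<eta>) t + \<rho> *\<^sub>R \<eta> t) = 0"

lemma cov_cong:
  assumes "open J" "t \<in> J" "\<And>s. s \<in> J \<Longrightarrow> Y s = Z s"
  shows "cov B \<rho> \<eta> Y t = cov B \<rho> \<eta> Z t"
  using velocity_cong[OF assms] assms(2,3) by (simp add: cov_def)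

text \<open>The vector \<open>e0\<close> is the normal of the flat model, where the position vector
  is not normal. The assumption \<open>frame\<close> says that the tangent vectors and this one
  normal detect every ambient vector, so identities can be proved by pairing with them.\<close>

locale space_form_chart = immersion S \<sigma> B
  for S :: "'e::euclidean_space set" and \<sigma> :: "'e \<Rightarrow> 'v::euclidean_space" and B +
  fixes \<rho> :: real and e0 :: 'v
  assumes quadric: "\<rho> \<noteq> 0 \<Longrightarrow> x \<in> S \<Longrightarrow> B (\<sigma> x) (\<sigma> x) = 1 / \<rho>"
    and flat: "\<rho> = 0 \<Longrightarrow> x \<in> S \<Longrightarrow> B e0 (\<sigma> x) = 0"
    and frame: "x \<in> S \<Longrightarrow> (\<And>w. B r (d1 x w) = 0) \<Longrightarrow> B r (if \<rho> = 0 then e0 else \<sigma> x) = 0 \<Longrightarrow> r = 0"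
begin

lemma position_normal:
  assumes "\<rho> \<noteq> 0" "x \<in> S" shows "B (\<sigma> x) (d1 x u) = 0"
proof -
  have d: "\<sigma> differentiable (at x)" using smooth_on_differentiable[OF sm assms(2)] .
  have "DD (\<lambda>y. B (\<sigma> y) (\<sigma> y)) x = DD (\<lambda>y. 1 / \<rho>) x"
    by (rule DD_cong[OF S assms(2)]) (simp add: quadric assms(1))
  then have "DD (\<lambda>y. B (\<sigma> y) (\<sigma> y)) x u = 0" by simp
  then show ?thesis using DD_bilinear[OF B d d, of u] by (simp add: Bsym[of "d1 x u"])
qed

lemma flat_normal:
  assumes "\<rho> = 0" "x \<in> S" shows "B e0 (d1 x u) = 0"
proof -
  have d: "\<sigma> differentiable (at x)" using smooth_on_differentiable[OF sm assms(2)] .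
  have "DD (\<lambda>y. B e0 (\<sigma> y)) x = DD (\<lambda>y. 0) x"
    by (rule DD_cong[OF S assms(2)]) (simp add: flat assms(1))
  then have "DD (\<lambda>y. B e0 (\<sigma> y)) x u = 0" by simp
  then show ?thesis using DD_bilinear[OF B differentiable_const d, of e0 u] by (simp add: Bsimps)
qed

lemma position_normal': "x \<in> S \<Longrightarrow> \<rho> * B (\<sigma> x) (d1 x u) = 0"
  using position_normal by auto

lemma position_second:
  assumes "\<rho> \<noteq> 0" "x \<in> S" shows "B (\<sigma> x) (d2 x u v) = - ind x u v"
proof -
  have d: "\<sigma> differentiable (at x)" using smooth_on_differentiable[OF sm assms(2)] .
  have "DD (\<lambda>y. B (\<sigma> y) (d1 y u)) x = DD (\<lambda>y. 0) x"
    by (rule DD_cong[OF S assms(2)]) (simp add: position_normal assms(1))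
  then have "DD (\<lambda>y. B (\<sigma> y) (d1 y u)) x v = 0" by simp
  then show ?thesis
    using DD_bilinear[OF B d d1_differentiable[OF assms(2)], of u v]
    by (simp add: ind_def Bsym[of "d1 x v"])
qed

lemma flat_second:
  assumes "\<rho> = 0" "x \<in> S" shows "B e0 (d2 x u v) = 0"
proof -
  have "DD (\<lambda>y. B e0 (d1 y u)) x = DD (\<lambda>y. 0) x"
    by (rule DD_cong[OF S assms(2)]) (simp add: flat_normal assms(1))
  then have "DD (\<lambda>y. B e0 (d1 y u)) x v = 0" by simp
  then show ?thesis
    using DD_bilinear[OF B differentiable_const d1_differentiable[OF assms(2)], of e0 u v] by (simp add: Bsimps)
qed

section \<open>The Levi-Civita connection and the curvature of a space form\<close>

context
  fixes G :: "'e local_metric"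
  assumes G: "\<And>x. x \<in> S \<Longrightarrow> G x = ind x"
begin

text \<open>The Gauss formula of a quadric: the normal part of the second derivative is along the
  position vector, with coefficient found by differentiating
  \<open>B (\<sigma> x) (d1 x u) = 0\<close>. Both sides have the same pairings with the
  frame.\<close>

lemma gauss:
  assumes x: "x \<in> S"
  shows "d1 x (christoffel G x u v) = d2 x u v + (\<rho> * ind x u v) *\<^sub>R \<sigma> x"
proof -
  let ?r = "d1 x (christoffel G x u v) - d2 x u v - (\<rho> * ind x u v) *\<^sub>R \<sigma> x"
  have "?r = 0"
  proof (rule frame[OF x])
    show "B ?r (d1 x w) = 0" for w
      using christoffel_ind[OF G x, of u v w] position_normal'[OF x, of w] by (auto simp: Bsimps)
    show "B ?r (if \<rho> = 0 then e0 else \<sigma> x) = 0"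
    proof (cases "\<rho> = 0")
      case True
      then show ?thesis
        using flat_normal[OF True x] flat_second[OF True x] by (simp add: Bsimps Bsym[of "d1 x _" e0] Bsym[of "d2 x _ _" e0])
    next
      case False
      then show ?thesis
        using position_normal[OF False x] position_second[OF False x] quadric[OF False x]
        by (simp add: Bsimps Bsym[of "d1 x _" "\<sigma> x"] Bsym[of "d2 x _ _" "\<sigma> x"])
    qed
  qed
  then show ?thesis by (simp add: algebra_simps)
qed

lemma nabla_along_space_form:
  assumes t: "a t \<in> S" and a: "a differentiable (at t)" and W: "W differentiable (at t)"
  shows "d1 (a t) (nabla_along G a W t) = cov B \<rho> (\<lambda>s. \<sigma> (a s)) (\<lambda>s. d1 (a s) (W s)) t"
proof -
  have v: "velocity (\<lambda>s. \<sigma> (a s)) t = d1 (a t) (velocity a t)"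
    using has_vector_derivative_DD[OF smooth_on_differentiable[OF sm t] has_velocity[OF a]]
    by (rule velocity_eqI)
  have w: "velocity (\<lambda>s. d1 (a s) (W s)) t = d2 (a t) (W t) (velocity a t) + d1 (a t) (velocity W t)"
    using has_vector_derivative_lift[OF t has_velocity[OF a] has_velocity[OF W]]
    by (rule velocity_eqI)
  show ?thesis
    unfolding cov_def v w
    by (simp add: nabla_along_def d1_simps t gauss velocity_def[of W] d2_sym[OF t, of "W t"]
        ind_def Bsym[of "d1 (a t) (W t)"])
qed

text \<open>The Gauss formula is used twice. The third derivatives of \<open>\<sigma>\<close> that
  appear are symmetric and cancel in the antisymmetrisation, leaving the constant-curvature
  expression and a multiple of the position vector.\<close>

lemma curvature_space_form:
  assumes x: "x \<in> S"
  shows "d1 x (curvature_tensor G x u v w) = \<rho> *\<^sub>R (ind x v w *\<^sub>R d1 x u - ind x u w *\<^sub>R d1 x v)"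
proof -
  let ?C = "christoffel G"
  have R: "curvature_tensor G x u v w = (DD (\<lambda>y. ?C y v w) x u + ?C x u (?C x v w))
      - (DD (\<lambda>y. ?C y u w) x v + ?C x v (?C x u w))"
    using linear_0[OF christoffel_linear(2)[OF G x]]
    by (simp add: curvature_tensor_def curvature_field_def nabla_def lie_bracket_def)
  \<comment> \<open>Collects every coefficient of \<open>\<sigma> x\<close>. It is not evaluated:
    the curvature vector is tangent, so the antisymmetrised coefficient has to vanish.\<close>
  define c where "c u v w = DD (\<lambda>y. ind y v w) x u + ind x u (?C x v w)" for u v w
  have main: "d1 x (DD (\<lambda>y. ?C y v w) x u + ?C x u (?C x v w))
      = DD (\<lambda>y. d2 y w v) x u + (\<rho> * ind x v w) *\<^sub>R d1 x u + (\<rho> * c u v w) *\<^sub>R \<sigma> x" for u v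
  proof -
    have "((\<lambda>y. d1 y (?C y v w)) has_derivative
        (\<lambda>h. d2 x (?C x v w) h + d1 x (DD (\<lambda>y. ?C y v w) x h))) (at x)"
      using has_derivative_DD_compose[OF S sm, of "\<lambda>y. y" x, OF x has_derivative_ident
          smooth_on_has_derivative[OF smooth_on_christoffel[OF G] x]] .
    from fun_cong[OF DD_eq[OF this], of u]
    have l: "DD (\<lambda>y. d1 y (?C y v w)) x u = d2 x (?C x v w) u + d1 x (DD (\<lambda>y. ?C y v w) x u)" .
    have i: "DD (\<lambda>y. d1 y (?C y v w)) x = DD (\<lambda>y. d2 y w v + (\<rho> * ind y v w) *\<^sub>R \<sigma> y) x"
      by (rule DD_cong[OF S x]) (simp add: gauss d2_sym[of _ v])
    have "((\<lambda>y. d2 y w v + (\<rho> * ind y v w) *\<^sub>R \<sigma> y) has_derivative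
        (\<lambda>h. DD (\<lambda>y. d2 y w v) x h + ((\<rho> * ind x v w) *\<^sub>R d1 x h + (\<rho> * DD (\<lambda>y. ind y v w) x h) *\<^sub>R \<sigma> x))) (at x)"
      by (rule has_derivative_add[OF smooth_on_has_derivative[OF smooth_on_DD[OF smooth_on_DD[OF sm]] x]
            has_derivative_scaleR[OF has_derivative_mult_right[OF has_derivative_DD[OF ind_differentiable[OF x]]]
              smooth_on_has_derivative[OF sm x]]])
    from fun_cong[OF DD_eq[OF this], of u] l i
    have "d1 x (DD (\<lambda>y. ?C y v w) x u) = DD (\<lambda>y. d2 y w v) x u
        + ((\<rho> * ind x v w) *\<^sub>R d1 x u + (\<rho> * DD (\<lambda>y. ind y v w) x u) *\<^sub>R \<sigma> x) - d2 x (?C x v w) u"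
      by (simp add: algebra_simps)
    then show ?thesis
      by (simp add: d1_simps x gauss d2_sym[OF x, of u] c_def algebra_simps)
  qed
  have s: "DD (\<lambda>y. d2 y w v) x u = DD (\<lambda>y. d2 y w u) x v"
    by (rule symmetric_second_derivative[OF S x smooth_on_DD[OF sm]])
  have *: "d1 x (curvature_tensor G x u v w)
      = \<rho> *\<^sub>R (ind x v w *\<^sub>R d1 x u - ind x u w *\<^sub>R d1 x v) + (\<rho> * (c u v w - c v u w)) *\<^sub>R \<sigma> x"
    unfolding R linear_diff[OF d1_linear[OF x]] main s by (simp add: algebra_simps)
  have "\<rho> * (c u v w - c v u w) = 0"
  proof (cases "\<rho> = 0")
    case False
    have "B (\<sigma> x) (d1 x (curvature_tensor G x u v w)) = c u v w - c v u w"
      unfolding * using False by (simp add: Bsimps position_normal x quadric)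
    then show ?thesis using position_normal[OF False x] by simp
  qed simp
  then show ?thesis using * by simp
qed

text \<open>Each \<open>nabla_along\<close> becomes a \<open>cov\<close> under \<open>d1\<close>;
  the lifted equation is then rewritten from the innermost derivative outwards.\<close>

lemma biharmonic_ambient:
  assumes J: "open J" and a: "smooth_on a J" "a ` J \<subseteq> S" and t: "t \<in> J"
    and unit: "\<And>t. t \<in> J \<Longrightarrow> ind (a t) (velocity a t) (velocity a t) = 1"
    and bih: "(nabla_along G a ^^ 3) (velocity a) t + curvature_tensor G (a t)
        (nabla_along G a (velocity a) t) (velocity a t) (velocity a t) = 0"
  shows "biharmonic_ambient_at B \<rho> (\<lambda>s. \<sigma> (a s)) t"
proof -
  define \<eta> where "\<eta> = (\<lambda>s. \<sigma> (a s))"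
  define X where "X = (\<lambda>s. velocity (velocity \<eta>) s + \<rho> *\<^sub>R \<eta> s)"
  have aS: "a s \<in> S" if "s \<in> J" for s using that a(2) by blast
  let ?N = "nabla_along G a"
  have ad: "a differentiable (at s)" if "s \<in> J" for s using smooth_on_differentiable[OF a(1) that] .
  have lift_smooth: "smooth_on (\<lambda>s. d1 (a s) (W s)) J" if "smooth_on W J" for W
    by (rule smooth_on_DD_compose[OF S J a(2) sm a(1) that])
  \<comment> \<open>Each covariant derivative is differentiated once more, so it must be smooth
    itself; it is the tangential part of a smooth ambient field.\<close>
  have N_smooth: "smooth_on (?N W) J" if "smooth_on W J" for W
  proof (rule smooth_on_tangential_part[OF J a smooth_on_velocity[OF J lift_smooth[OF that]]])
    show "B (d1 (a s) (?N W s)) (d1 (a s) w) = B (velocity (\<lambda>s. d1 (a s) (W s)) s) (d1 (a s) w)"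
      if s: "s \<in> J" for s w
      unfolding velocity_def
      by (rule nabla_along_ind[OF G aS[OF s] ad[OF s] smooth_on_differentiable[OF \<open>smooth_on W J\<close> s]])
  qed
  have N: "d1 (a s) (?N W s) = cov B \<rho> \<eta> (\<lambda>s. d1 (a s) (W s)) s" if "smooth_on W J" "s \<in> J" for W s
    unfolding \<eta>_def using that by (intro nabla_along_space_form aS ad smooth_on_differentiable[of W J])
  have T: "smooth_on (velocity a) J" by (rule smooth_on_velocity[OF J a(1)])
  have \<eta>1: "d1 (a s) (velocity a s) = velocity \<eta> s" if "s \<in> J" for s
    unfolding \<eta>_def
    using velocity_eqI[OF has_vector_derivative_DD[OF smooth_on_differentiable[OF sm aS[OF that]] has_velocity[OF ad[OF that]]]]
    by simp
  have unit': "B (velocity \<eta> s) (velocity \<eta> s) = 1" if "s \<in> J" for s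
    using unit[OF that] \<eta>1[OF that] by (simp add: ind_def)
  have n1: "d1 (a s) (?N (velocity a) s) = X s" if "s \<in> J" for s
  proof -
    have "cov B \<rho> \<eta> (\<lambda>s. d1 (a s) (velocity a s)) s = cov B \<rho> \<eta> (velocity \<eta>) s"
      by (rule cov_cong[OF J that \<eta>1])
    then show ?thesis using N[OF T that] unit'[OF that] by (simp add: cov_def[of _ _ _ "velocity \<eta>"] X_def)
  qed
  have n2: "d1 (a s) (?N (?N (velocity a)) s) = cov B \<rho> \<eta> X s" if "s \<in> J" for s
    unfolding N[OF N_smooth[OF T] that] by (rule cov_cong[OF J that n1])
  have n3: "d1 (a t) (?N (?N (?N (velocity a))) t) = cov B \<rho> \<eta> (cov B \<rho> \<eta> X) t"
    unfolding N[OF N_smooth[OF N_smooth[OF T]] t] by (rule cov_cong[OF J t n2])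
  have \<eta>s: "smooth_on (velocity \<eta>) J"
    unfolding \<eta>_def by (rule smooth_on_velocity[OF J smooth_on_compose[OF S J a(2) sm a(1)]])
  have "velocity (\<lambda>s. B (velocity \<eta> s) (velocity \<eta> s)) t = 0"
    by (rule velocity_zero[OF J t unit'])
  then have o: "B (velocity \<eta> t) (velocity (velocity \<eta>) t) = 0"
    using velocity_bilinear[OF B smooth_on_differentiable[OF \<eta>s t] smooth_on_differentiable[OF \<eta>s t]]
    by (simp add: Bsym[of "velocity (velocity \<eta>) t"])
  have "\<rho> * B (\<eta> t) (velocity \<eta> t) = 0"
    using position_normal'[OF aS[OF t], of "velocity a t"] \<eta>1[OF t] by (simp add: \<eta>_def)
  \<comment> \<open>The acceleration is orthogonal to the velocity, which removes one of the two
    terms of the curvature and leaves \<open>\<rho>\<close> times the acceleration.\<close>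
  then have o': "ind (a t) (?N (velocity a) t) (velocity a t) = 0"
    using o by (simp add: ind_def n1[OF t] \<eta>1[OF t] X_def Bsimps Bsym[of "velocity (velocity \<eta>) t"])
  have "d1 (a t) ((?N ^^ 3) (velocity a) t + curvature_tensor G (a t) (?N (velocity a) t) (velocity a t) (velocity a t)) = 0"
    unfolding bih by (rule linear_0[OF d1_linear[OF aS[OF t]]])
  then have "cov B \<rho> \<eta> (cov B \<rho> \<eta> X) t + \<rho> *\<^sub>R X t = 0"
    by (simp add: numeral_3_eq_3 d1_simps aS[OF t] curvature_space_form[OF aS[OF t]] n3 n1[OF t] unit[OF t] o')
  then show ?thesis unfolding biharmonic_ambient_at_def X_def \<eta>_def .
qed

end

end

text \<open>\<open>\<nu>\<close> is the unit normal of a hypersurface along its geodesic \<open>\<eta>\<close>. The component of the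
  biharmonic equation along \<open>\<eta>'\<close> is \<open>-3 k k' = 0\<close>; where \<open>k \<noteq> 0\<close>, the one along \<open>\<nu>\<close> is then
  \<open>k (\<rho> - B \<nu>' \<nu>') = 0\<close>.\<close>

lemma biharmonic_geodesic_alternative:
  fixes \<eta> \<nu> :: "real \<Rightarrow> 'v::euclidean_space"
  assumes B: "bounded_bilinear B" and Bsym: "\<And>v w. B v w = B w v"
    and J: "open J" and t0: "t0 \<in> J" and \<eta>: "smooth_on \<eta> J" and \<nu>: "smooth_on \<nu> J"
    and \<eta>\<eta>': "\<And>t. t \<in> J \<Longrightarrow> \<rho> * B (\<eta> t) (velocity \<eta> t) = 0"
    and \<nu>\<nu>: "\<And>t. t \<in> J \<Longrightarrow> B (\<nu> t) (\<nu> t) = 1"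
    and \<nu>\<eta>': "\<And>t. t \<in> J \<Longrightarrow> B (\<nu> t) (velocity \<eta> t) = 0"
    and \<nu>\<eta>: "\<And>t. t \<in> J \<Longrightarrow> \<rho> * B (\<nu> t) (\<eta> t) = 0"
    and X: "\<And>t. t \<in> J \<Longrightarrow> velocity (velocity \<eta>) t + \<rho> *\<^sub>R \<eta> t = k t *\<^sub>R \<nu> t"
    and bih: "\<And>t. t \<in> J \<Longrightarrow> biharmonic_ambient_at B \<rho> \<eta> t"
  shows "k t0 = 0 \<or> B (velocity \<nu> t0) (velocity \<nu> t0) = \<rho>"
proof -
  interpret B: bounded_bilinear B by (rule B)
  note Bsimps = B.add_left B.add_right B.diff_left B.diff_right B.scaleR_left B.scaleR_right
  let ?\<eta>1 = "velocity \<eta>" and ?\<eta>2 = "velocity (velocity \<eta>)"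
  let ?\<nu>1 = "velocity \<nu>" and ?\<nu>2 = "velocity (velocity \<nu>)"
  let ?k1 = "velocity k" and ?k2 = "velocity (velocity k)"
  have \<eta>1: "smooth_on ?\<eta>1 J" and \<nu>1: "smooth_on ?\<nu>1 J" using smooth_on_velocity[OF J] \<eta> \<nu> by blast+
  have \<eta>2: "smooth_on ?\<eta>2 J" using smooth_on_velocity[OF J \<eta>1] .
  have k_eq: "B (?\<eta>2 t) (\<nu> t) = k t" if "t \<in> J" for t
  proof -
    have "B (?\<eta>2 t + \<rho> *\<^sub>R \<eta> t) (\<nu> t) = k t" unfolding X[OF that] using \<nu>\<nu>[OF that] by (simp add: Bsimps)
    then show ?thesis using \<nu>\<eta>[OF that] by (simp add: Bsimps Bsym[of "\<eta> t"])
  qed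
  have k: "smooth_on k J" by (rule smooth_on_cong[OF J k_eq smooth_on_bilinear[OF B J \<eta>2 \<nu>]])
  have k1: "smooth_on ?k1 J" by (rule smooth_on_velocity[OF J k])
  have diff: "f differentiable (at t)" if "smooth_on f J" "t \<in> J" for t and f :: "real \<Rightarrow> 'w::euclidean_space"
    using smooth_on_differentiable that by blast
  have der: "B (f t) (velocity g t) + B (velocity f t) (g t) = 0"
    if "smooth_on f J" "smooth_on g J" "\<And>s. s \<in> J \<Longrightarrow> B (f s) (g s) = c" "t \<in> J" for f g c t
    using velocity_bilinear[OF B diff[OF that(1,4)] diff[OF that(2,4)]]
      velocity_zero[OF J that(4), of "\<lambda>s. B (f s) (g s)", OF that(3)] by simp
  have a1: "B (?\<nu>1 t) (?\<eta>1 t) = - k t" if "t \<in> J" for t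
    using der[OF \<nu> \<eta>1 \<nu>\<eta>' that] k_eq[OF that] by (simp add: Bsym[of "?\<eta>2 t"])
  have a2: "B (?\<nu>1 t) (\<nu> t) = 0" if "t \<in> J" for t
    using der[OF \<nu> \<nu> \<nu>\<nu> that] by (simp add: Bsym[of "\<nu> t"])
  have a3: "B (?\<nu>2 t) (\<nu> t) = - B (?\<nu>1 t) (?\<nu>1 t)" if "t \<in> J" for t
    using der[OF \<nu>1 \<nu> a2 that] by simp
  have a4: "\<rho> * B (?\<nu>1 t) (\<eta> t) = 0" if "t \<in> J" for t
  proof (cases "\<rho> = 0")
    case False
    then have "B (\<nu> s) (\<eta> s) = 0" if "s \<in> J" for s using \<nu>\<eta>[OF that] by simp
    from der[OF \<nu> \<eta> this \<open>t \<in> J\<close>] show ?thesis using \<nu>\<eta>'[OF \<open>t \<in> J\<close>] by simp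
  qed simp
  \<comment> \<open>The ordinary derivative of \<open>k \<nu>\<close>. It is also the covariant one,
    since \<open>\<nu>\<close> is orthogonal to \<open>\<eta>'\<close> and the correction along
    \<open>\<eta>\<close> drops out.\<close>
  define Y where "Y t = k t *\<^sub>R ?\<nu>1 t + ?k1 t *\<^sub>R \<nu> t" for t
  have Y: "smooth_on Y J"
    unfolding Y_def by (intro smooth_on_add[OF J] smooth_on_scaleR[OF J] k \<nu>1 k1 \<nu>)
  have cX: "cov B \<rho> \<eta> (\<lambda>s. ?\<eta>2 s + \<rho> *\<^sub>R \<eta> s) t = Y t" if "t \<in> J" for t
  proof -
    have "cov B \<rho> \<eta> (\<lambda>s. ?\<eta>2 s + \<rho> *\<^sub>R \<eta> s) t = cov B \<rho> \<eta> (\<lambda>s. k s *\<^sub>R \<nu> s) t"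
      by (rule cov_cong[OF J that X])
    also have "\<dots> = Y t"
      using velocity_bilinear[OF bounded_bilinear_scaleR diff[OF k that] diff[OF \<nu> that]] \<nu>\<eta>'[OF that]
      by (simp add: cov_def Y_def Bsimps)
    finally show ?thesis .
  qed
  have eq: "velocity Y t + (\<rho> * B (Y t) (?\<eta>1 t)) *\<^sub>R \<eta> t + (\<rho> * k t) *\<^sub>R \<nu> t = 0" if "t \<in> J" for t
  proof -
    have "cov B \<rho> \<eta> (cov B \<rho> \<eta> (\<lambda>s. ?\<eta>2 s + \<rho> *\<^sub>R \<eta> s)) t = cov B \<rho> \<eta> Y t"
      by (rule cov_cong[OF J that cX])
    then show ?thesis
      using bih[OF that] X[OF that] by (simp add: biharmonic_ambient_at_def cov_def[of _ _ _ Y])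
  qed
  have Y\<eta>': "B (Y t) (?\<eta>1 t) = - (k t * k t)" if "t \<in> J" for t
    using a1[OF that] \<nu>\<eta>'[OF that] by (simp add: Y_def Bsimps)
  \<comment> \<open>\<open>B (Y t) (?\<eta>2 t)\<close> is computed twice. Differentiating
    \<open>B Y \<eta>' = - k\<^sup>2\<close> and using the tangential equation gives
    \<open>-2 k k'\<close>; inserting \<open>\<eta>'' = k \<nu> - \<rho> \<eta>\<close> gives
    \<open>k k'\<close>.\<close>
  have kk: "k t * ?k1 t = 0" if "t \<in> J" for t
  proof -
    have "B (velocity Y t + (\<rho> * B (Y t) (?\<eta>1 t)) *\<^sub>R \<eta> t + (\<rho> * k t) *\<^sub>R \<nu> t) (?\<eta>1 t) = 0"
      unfolding eq[OF that] by (rule B.zero_left)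
    then have "B (velocity Y t) (?\<eta>1 t) + B (Y t) (?\<eta>1 t) * (\<rho> * B (\<eta> t) (?\<eta>1 t)) = 0"
      using \<nu>\<eta>'[OF that] by (simp add: Bsimps algebra_simps)
    then have e1: "B (velocity Y t) (?\<eta>1 t) = 0" using \<eta>\<eta>'[OF that] by simp
    have "velocity (\<lambda>s. B (Y s) (?\<eta>1 s)) t = velocity (\<lambda>s. - (k s * k s)) t"
      by (rule velocity_cong[OF J that Y\<eta>'])
    moreover have "velocity (\<lambda>s. - (k s * k s)) t = - (2 * k t * ?k1 t)"
      using has_vector_derivative_minus[OF bounded_bilinear.has_vector_derivative[OF bounded_bilinear_mult
            has_velocity[OF diff[OF k that]] has_velocity[OF diff[OF k that]]]]
      by (intro velocity_eqI) (simp add: algebra_simps)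
    ultimately have e2: "B (Y t) (?\<eta>2 t) = - (2 * k t * ?k1 t)"
      using velocity_bilinear[OF B diff[OF Y that] diff[OF \<eta>1 that]] e1 by simp
    have e3: "?\<eta>2 t = k t *\<^sub>R \<nu> t - \<rho> *\<^sub>R \<eta> t" using X[OF that] by (simp add: algebra_simps)
    have e4: "B (Y t) (\<nu> t) = ?k1 t" using a2[OF that] \<nu>\<nu>[OF that] by (simp add: Y_def Bsimps)
    have "\<rho> * B (Y t) (\<eta> t) = k t * (\<rho> * B (?\<nu>1 t) (\<eta> t)) + ?k1 t * (\<rho> * B (\<nu> t) (\<eta> t))"
      by (simp add: Y_def Bsimps algebra_simps)
    then have e5: "\<rho> * B (Y t) (\<eta> t) = 0" using a4[OF that] \<nu>\<eta>[OF that] by simp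
    have "B (Y t) (?\<eta>2 t) = k t * ?k1 t" unfolding e3 using e4 e5 by (simp add: Bsimps)
    with e2 show ?thesis by simp
  qed
  show ?thesis
  proof (cases "k t0 = 0")
    case False
    \<comment> \<open>The relation \<open>k k' = 0\<close> yields \<open>k' = 0\<close> only where
      \<open>k\<close> is nonzero. Continuity makes this a whole neighbourhood of \<open>t0\<close>,
      so that \<open>k''\<close> vanishes at \<open>t0\<close> as well.\<close>
    have "isCont k t0"
      using smooth_on_continuous_on[OF k] continuous_on_eq_continuous_at[OF J] t0 by blast
    then obtain e where e: "e > 0" "\<And>t. dist t0 t < e \<Longrightarrow> k t \<noteq> 0"
      using continuous_at_avoid[of t0 k 0] False by blast
    define J' where "J' = ball t0 e"
    have J': "open J'" "t0 \<in> J'" "\<And>t. t \<in> J' \<Longrightarrow> k t \<noteq> 0"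
      using e by (auto simp: J'_def)
    have k1z: "?k1 t = 0" if "t \<in> J \<inter> J'" for t using kk[of t] J'(3)[of t] that by auto
    have k2z: "?k2 t0 = 0" by (rule velocity_zero[of "J \<inter> J'"]) (use J J' t0 k1z in auto)
    have "velocity Y t0 = k t0 *\<^sub>R ?\<nu>2 t0"
    proof (rule velocity_eqI)
      have "(Y has_vector_derivative ((k t0 *\<^sub>R ?\<nu>2 t0 + ?k1 t0 *\<^sub>R ?\<nu>1 t0) + (?k1 t0 *\<^sub>R ?\<nu>1 t0 + ?k2 t0 *\<^sub>R \<nu> t0))) (at t0)"
        unfolding Y_def
        by (rule has_vector_derivative_add[OF
              bounded_bilinear.has_vector_derivative[OF bounded_bilinear_scaleR has_velocity has_velocity]
              bounded_bilinear.has_vector_derivative[OF bounded_bilinear_scaleR has_velocity has_velocity]])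
           (use diff t0 k k1 \<nu> \<nu>1 in auto)
      then show "(Y has_vector_derivative k t0 *\<^sub>R ?\<nu>2 t0) (at t0)" using k1z k2z J' t0 by simp
    qed
    moreover have "B (velocity Y t0 + (\<rho> * B (Y t0) (?\<eta>1 t0)) *\<^sub>R \<eta> t0 + (\<rho> * k t0) *\<^sub>R \<nu> t0) (\<nu> t0) = 0"
      unfolding eq[OF t0] by (rule B.zero_left)
    ultimately have "k t0 * B (?\<nu>2 t0) (\<nu> t0) + B (Y t0) (?\<eta>1 t0) * (\<rho> * B (\<nu> t0) (\<eta> t0)) + \<rho> * k t0 = 0"
      using \<nu>\<nu>[OF t0] by (simp add: Bsimps algebra_simps Bsym[of "\<eta> t0"])
    then have "k t0 * (\<rho> - B (?\<nu>1 t0) (?\<nu>1 t0)) = 0"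
      using a3[OF t0] \<nu>\<eta>[OF t0] by (simp add: algebra_simps)
    then show ?thesis using False by simp
  qed simp
qed

section \<open>Charts of the space forms\<close>

definition amb :: "real \<Rightarrow> 'n::euclidean_space \<times> real \<Rightarrow> 'n \<times> real \<Rightarrow> real" where
  "amb \<rho> v w = (if \<rho> < 0 then lorentz v w else v \<bullet> w)"

definition space_form_set :: "real \<Rightarrow> ('n::euclidean_space \<times> real) set" where
  "space_form_set \<rho> = (if \<rho> < 0 then {v. lorentz v v = 1 / \<rho> \<and> snd v > 0}
     else if \<rho> = 0 then {v. snd v = 0} else sphere 0 (1 / sqrt \<rho>))"

lemma space_form_eq: "space_form \<rho> = submanifold (amb \<rho>) (space_form_set \<rho>)"
  by (auto simp: space_form_def amb_def[abs_def] space_form_set_def)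

lemma space_form_simps:
  "mtop (space_form \<rho>) = top_of_set (space_form_set \<rho>)"
  "charts (space_form \<rho>) = submanifold_charts (space_form_set \<rho>)"
  "metric_in (space_form \<rho>) d = (\<lambda>x u v. amb \<rho> (DD (chart_inv d) x u) (DD (chart_inv d) x v))"
  by (simp_all add: space_form_eq submanifold_def)

lemma bounded_bilinear_amb: "bounded_bilinear (amb \<rho> :: 'n::euclidean_space \<times> real \<Rightarrow> _)"
proof -
  have "bilinear (amb \<rho> :: 'n \<times> real \<Rightarrow> _)"
    unfolding bilinear_def amb_def lorentz_def
    by (auto intro!: linearI simp: inner_add_left inner_add_right algebra_simps)
  then show ?thesis using bilinear_conv_bounded_bilinear by blast
qed

lemma amb_commute: "amb \<rho> v w = amb \<rho> w v"
  by (simp add: amb_def lorentz_def inner_commute mult.commute)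

lemma amb_nondegenerate:
  assumes "\<And>w. amb \<rho> r w = 0" shows "r = 0"
proof (cases "\<rho> < 0")
  case True
  have "fst r \<bullet> fst r = 0" using assms[of "(fst r, 0)"] True by (simp add: amb_def lorentz_def)
  moreover have "snd r * 1 = 0" using assms[of "(0, 1)"] True by (simp add: amb_def lorentz_def)
  ultimately show ?thesis by (simp add: prod_eq_iff)
next
  case False
  then show ?thesis using assms[of r] by (simp add: amb_def)
qed

lemma space_form_quadric: "v \<in> space_form_set \<rho> \<Longrightarrow> \<rho> \<noteq> 0 \<Longrightarrow> amb \<rho> v v = 1 / \<rho>"
  by (auto simp: space_form_set_def amb_def dot_square_norm power_divide split: if_splits)

lemma space_form_flat: "v \<in> space_form_set 0 \<Longrightarrow> amb 0 (0, 1) v = 0"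
  by (simp add: space_form_set_def amb_def inner_prod_def)

text \<open>The Householder reflection in the hyperplane orthogonal to \<open>a - b\<close>. Being
  its own inverse, it spares a separate inverse map wherever it is used.\<close>

lemma orthogonal_transformation_exists_involution:
  fixes a b :: "'v::euclidean_space"
  assumes "norm a = norm b"
  obtains T where "orthogonal_transformation T" "T a = b" "\<And>v. T (T v) = v"
proof (cases "a = b")
  case True
  then show thesis using that[of "\<lambda>v. v"] orthogonal_transformation_id by auto
next
  case False
  define c where "c = a - b"
  define k where "k = 2 / (c \<bullet> c)"
  have cc: "c \<bullet> c \<noteq> 0" using False by (simp add: c_def)
  have k: "k * (c \<bullet> c) = 2" using cc by (simp add: k_def)
  define T where "T v = v - (k * (v \<bullet> c)) *\<^sub>R c" for v
  have lin: "linear T"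
    by (rule linearI) (simp_all add: T_def inner_add_left algebra_simps)
  have "T v \<bullet> T w = v \<bullet> w - 2 * (k * (v \<bullet> c) * (w \<bullet> c)) + (k * (c \<bullet> c)) * (k * (v \<bullet> c) * (w \<bullet> c))" for v w
    by (simp add: T_def inner_diff_left inner_diff_right algebra_simps inner_commute)
  then have orth: "orthogonal_transformation T"
    using lin by (simp add: orthogonal_transformation_def k)
  have aa: "a \<bullet> a = b \<bullet> b" using assms by (simp add: dot_square_norm)
  have "2 * (a \<bullet> c) = c \<bullet> c"
    using aa by (simp add: c_def inner_diff_left inner_diff_right inner_commute)
  then have "k * (a \<bullet> c) = 1" using k cc by (simp add: k_def)
  then have "T a = b" by (simp add: T_def c_def)
  moreover have "T (T v) = v" for v
  proof -
    have "T v \<bullet> c = (v \<bullet> c) - (k * (c \<bullet> c)) * (v \<bullet> c)"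
      by (simp add: T_def inner_diff_left)
    then have e: "T v \<bullet> c = - (v \<bullet> c)" by (simp add: k)
    show ?thesis unfolding T_def[of "T v"] e by (simp add: T_def)
  qed
  ultimately show thesis using that orth by blast
qed

text \<open>A linear left inverse \<open>\<pi>\<close> gives two things at once: a continuous
  coordinate map, and injectivity of the derivative, because \<open>\<pi>\<close> composed with it
  is the identity.\<close>

lemma submanifold_chart_of_parametrization:
  fixes \<sigma> :: "'e::euclidean_space \<Rightarrow> 'v::euclidean_space"
  assumes \<Omega>: "open \<Omega>" and \<sigma>: "smooth_on \<sigma> \<Omega>" and \<pi>: "bounded_linear \<pi>"
    and inv: "\<And>x. x \<in> \<Omega> \<Longrightarrow> \<pi> (\<sigma> x) = x" and op: "openin (top_of_set X) (\<sigma> ` \<Omega>)"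
  shows "(\<sigma> ` \<Omega>, \<pi>) \<in> submanifold_charts X"
proof -
  let ?d = "(\<sigma> ` \<Omega>, \<pi>)"
  have im: "\<pi> ` \<sigma> ` \<Omega> = \<Omega>" using inv by force
  have ci: "chart_inv ?d x = \<sigma> x" if "x \<in> \<Omega>" for x
  proof -
    have "inj_on \<pi> (\<sigma> ` \<Omega>)" using inv by (auto intro!: inj_onI)
    then show ?thesis using inv_into_f_f[of \<pi> "\<sigma> ` \<Omega>" "\<sigma> x"] that inv by (simp add: chart_inv_def)
  qed
  have "homeomorphic_maps (top_of_set (\<sigma> ` \<Omega>)) (top_of_set \<Omega>) \<pi> \<sigma>"
    using smooth_on_continuous_on[OF \<sigma>] linear_continuous_on[OF \<pi>] inv
    by (auto simp: homeomorphic_maps_def)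
  then have h: "homeomorphic_map (top_of_set (\<sigma> ` \<Omega>)) (top_of_set \<Omega>) \<pi>"
    using homeomorphic_map_maps by blast
  have s: "smooth_on (chart_inv ?d) \<Omega>"
    by (rule smooth_on_cong[OF \<Omega> _ \<sigma>]) (simp add: ci)
  have i: "inj (DD (chart_inv ?d) x)" if x: "x \<in> \<Omega>" for x
  proof -
    have "((\<lambda>y. \<pi> (chart_inv ?d y)) has_derivative (\<lambda>u. \<pi> (DD (chart_inv ?d) x u))) (at x)"
      by (rule bounded_linear.has_derivative[OF \<pi> smooth_on_has_derivative[OF s x]])
    then have "((\<lambda>y. y) has_derivative (\<lambda>u. \<pi> (DD (chart_inv ?d) x u))) (at x)"
      by (rule has_derivative_transform_within_open[OF _ \<Omega> x]) (simp add: ci inv)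
    then have "(\<lambda>u. \<pi> (DD (chart_inv ?d) x u)) = (\<lambda>u. u)"
      using has_derivative_unique has_derivative_ident by blast
    then show ?thesis by (metis injI)
  qed
  show ?thesis
    unfolding submanifold_charts_def using op \<Omega> h s i by (simp add: im inv)
qed

text \<open>Graph parametrisations: one chart covers the hyperboloid or the hyperplane, and on the
  sphere an open hemisphere centred at \<open>p\<close> is enough.\<close>

lemma space_form_chart_exists:
  fixes p :: "'n::euclidean_space \<times> real"
  assumes "p \<in> space_form_set \<rho>"
  obtains d :: "('n \<times> real, 'n) chart" where "d \<in> submanifold_charts (space_form_set \<rho>)" "p \<in> fst d"
proof -
  have bl: "bounded_linear (fst :: 'n \<times> real \<Rightarrow> 'n)" by (rule bounded_linear_fst)
  have id: "smooth_on (\<lambda>x::'n. x) \<Omega>" for \<Omega> by (rule smooth_on_ident)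
  consider "\<rho> < 0" | "\<rho> = 0" | "\<rho> > 0" by linarith
  then show thesis
  proof cases
    case 1
    let ?\<sigma> = "\<lambda>x::'n. (x, sqrt (x \<bullet> x - 1 / \<rho>))"
    have pos: "x \<bullet> x - 1 / \<rho> > 0" for x :: 'n
      using less_le_trans[OF _ inner_ge_zero[of x], of "1 / \<rho>"] 1 by (simp add: divide_less_0_iff)
    have "smooth_on (\<lambda>x::'n. x \<bullet> x - 1 / \<rho>) UNIV"
      by (rule smooth_on_diff[OF open_UNIV smooth_on_inner[OF open_UNIV id id] smooth_on_const])
    from smooth_on_Pair[OF open_UNIV id smooth_on_sqrt[OF open_UNIV this pos]]
    have s: "smooth_on ?\<sigma> UNIV" .
    have im: "range ?\<sigma> = space_form_set \<rho>"
    proof (intro equalityI subsetI)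
      fix v :: "'n \<times> real" assume "v \<in> space_form_set \<rho>"
      then have v: "fst v \<bullet> fst v - snd v * snd v = 1 / \<rho>" "snd v > 0"
        using 1 by (simp_all add: space_form_set_def lorentz_def)
      have "(snd v)\<^sup>2 = fst v \<bullet> fst v - 1 / \<rho>" using v by (simp add: power2_eq_square)
      then have "snd v = sqrt (fst v \<bullet> fst v - 1 / \<rho>)" using v(2) by (metis real_sqrt_unique less_imp_le)
      then have "v = ?\<sigma> (fst v)" by (simp add: prod_eq_iff)
      then show "v \<in> range ?\<sigma>" by blast
    next
      fix v assume "v \<in> range ?\<sigma>"
      then show "v \<in> space_form_set \<rho>"
        using 1 pos less_imp_le[OF pos] by (auto simp: space_form_set_def lorentz_def)
    qed
    have "(range ?\<sigma>, fst) \<in> submanifold_charts (space_form_set \<rho>)"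
      by (rule submanifold_chart_of_parametrization[OF open_UNIV s bl]) (simp_all add: im)
    then show thesis using that im assms by force
  next
    case 2
    let ?\<sigma> = "\<lambda>x::'n. (x, 0::real)"
    have s: "smooth_on ?\<sigma> UNIV" by (rule smooth_on_Pair[OF open_UNIV id smooth_on_const])
    have im: "range ?\<sigma> = space_form_set \<rho>" using 2 by (auto simp: space_form_set_def)
    have "(range ?\<sigma>, fst) \<in> submanifold_charts (space_form_set \<rho>)"
      by (rule submanifold_chart_of_parametrization[OF open_UNIV s bl]) (simp_all add: im)
    then show thesis using that im assms by force
  next
    case 3
    define r where "r = 1 / sqrt \<rho>"
    have r: "r > 0" using 3 by (simp add: r_def)
    have X: "space_form_set \<rho> = sphere (0 :: 'n \<times> real) r" using 3 by (simp add: space_form_set_def r_def)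
    have "norm p = norm ((0, r) :: 'n \<times> real)" using assms r by (simp add: X norm_Pair)
    then obtain T where T: "orthogonal_transformation T" "T p = (0, r)" "\<And>v. T (T v) = v"
      using orthogonal_transformation_exists_involution by blast
    have blT: "bounded_linear T" using T(1) orthogonal_transformation_linear linear_conv_bounded_linear by blast
    \<comment> \<open>The upper hemisphere, carried by the reflection \<open>T\<close> from the pole
      to \<open>p\<close>. Since \<open>T\<close> is an involution, the coordinate map is
      \<open>fst \<circ> T\<close>.\<close>
    let ?\<Omega> = "ball (0::'n) r" and ?\<sigma> = "\<lambda>x::'n. T (x, sqrt (r\<^sup>2 - x \<bullet> x))"
    have pos: "r\<^sup>2 - x \<bullet> x > 0" if "x \<in> ?\<Omega>" for x :: 'n
    proof -
      have "(norm x)\<^sup>2 < r\<^sup>2" using that by (intro power_strict_mono) auto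
      then show ?thesis by (simp add: dot_square_norm)
    qed
    have "smooth_on (\<lambda>x::'n. r\<^sup>2 - x \<bullet> x) ?\<Omega>"
      by (rule smooth_on_diff[OF open_ball smooth_on_const smooth_on_inner[OF open_ball id id]])
    from smooth_on_bounded_linear[OF blT open_ball smooth_on_Pair[OF open_ball id smooth_on_sqrt[OF open_ball this pos]]]
    have s: "smooth_on ?\<sigma> ?\<Omega>" by simp
    have nT: "norm (T v) = norm v" for v using orthogonal_transformation_norm[OF T(1)] .
    have im: "?\<sigma> ` ?\<Omega> = space_form_set \<rho> \<inter> {v. snd (T v) > 0}"
    proof (intro equalityI subsetI)
      fix v :: "'n \<times> real" assume v: "v \<in> space_form_set \<rho> \<inter> {v. snd (T v) > 0}"
      let ?w = "T v"
      have "norm ?w = r" using v by (simp add: X nT)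
      then have "?w \<bullet> ?w = r\<^sup>2" by (simp add: dot_square_norm)
      then have w: "fst ?w \<bullet> fst ?w + (snd ?w)\<^sup>2 = r\<^sup>2"
        by (simp add: inner_prod_def power2_eq_square)
      have sp: "snd ?w > 0" using v by simp
      have "snd ?w = sqrt (r\<^sup>2 - fst ?w \<bullet> fst ?w)"
        using w sp by (intro real_sqrt_unique[symmetric]) auto
      then have "v = ?\<sigma> (fst ?w)" using T(3) by (metis prod.collapse)
      moreover have "(norm (fst ?w))\<^sup>2 < r\<^sup>2"
        using w zero_less_power[OF sp, of 2] unfolding dot_square_norm by linarith
      then have "norm (fst ?w) < r" using r by (meson less_imp_le power_less_imp_less_base)
      then have "fst ?w \<in> ?\<Omega>" by simp
      ultimately show "v \<in> ?\<sigma> ` ?\<Omega>" by blast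
    next
      fix v assume "v \<in> ?\<sigma> ` ?\<Omega>"
      then obtain x where x: "x \<in> ?\<Omega>" "v = ?\<sigma> x" by blast
      have "norm v = sqrt ((norm x)\<^sup>2 + (r\<^sup>2 - x \<bullet> x))"
        using pos[OF x(1)] by (simp add: x(2) nT norm_Pair)
      then have "norm v = r" using r by (simp add: dot_square_norm)
      then show "v \<in> space_form_set \<rho> \<inter> {v. snd (T v) > 0}"
        using pos[OF x(1)] by (simp add: X x(2) T(3))
    qed
    have "continuous_on UNIV (\<lambda>v. snd (T v))"
      by (intro continuous_on_snd linear_continuous_on[OF blT])
    then have "open {v. snd (T v) > 0}" using open_Collect_less[of "\<lambda>_. 0" "\<lambda>v. snd (T v)"] by simp
    then have "openin (top_of_set (space_form_set \<rho>)) (?\<sigma> ` ?\<Omega>)" unfolding im by (rule openin_open_Int)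
    then have "(?\<sigma> ` ?\<Omega>, \<lambda>v. fst (T v)) \<in> submanifold_charts (space_form_set \<rho>)"
      by (intro submanifold_chart_of_parametrization[OF open_ball s bounded_linear_compose[OF bl blT]])
         (simp_all add: T(3))
    moreover have "p \<in> ?\<sigma> ` ?\<Omega>" unfolding im using assms T(2) r by simp
    ultimately show thesis using that by simp
  qed
qed

lemma submanifold_chartD:
  assumes "d \<in> submanifold_charts X"
  shows "open (snd d ` fst d)" "fst d \<subseteq> X" "smooth_on (chart_inv d) (snd d ` fst d)"
    and "openin (top_of_set X) (fst d)"
    and "x \<in> snd d ` fst d \<Longrightarrow> inj (DD (chart_inv d) x)"
    and "q \<in> fst d \<Longrightarrow> chart_inv d (snd d q) = q"
    and "x \<in> snd d ` fst d \<Longrightarrow> chart_inv d x \<in> fst d"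
    and "x \<in> snd d ` fst d \<Longrightarrow> snd d (chart_inv d x) = x"
    and "continuous_on (fst d) (snd d)"
proof -
  have h: "homeomorphic_map (top_of_set (fst d)) (top_of_set (snd d ` fst d)) (snd d)"
    using assms by (simp add: submanifold_charts_def)
  then have "inj_on (snd d) (fst d)" using homeomorphic_imp_injective_map by fastforce
  then show "q \<in> fst d \<Longrightarrow> chart_inv d (snd d q) = q" by (simp add: chart_inv_def)
  show "continuous_on (fst d) (snd d)"
    using homeomorphic_imp_continuous_map[OF h] by (simp add: continuous_map_in_subtopology)
  show "x \<in> snd d ` fst d \<Longrightarrow> chart_inv d x \<in> fst d" "x \<in> snd d ` fst d \<Longrightarrow> snd d (chart_inv d x) = x"
    by (simp_all add: chart_inv_def inv_into_into f_inv_into_f)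
qed (use assms openin_imp_subset in \<open>auto simp: submanifold_charts_def\<close>)

lemma quadric_derivative:
  assumes S: "open S" and sm: "smooth_on \<sigma> S" and x: "x \<in> S"
    and X: "\<And>y. y \<in> S \<Longrightarrow> \<sigma> y \<in> space_form_set \<rho>"
  shows "amb \<rho> (if \<rho> = 0 then (0, 1) else \<sigma> x) (DD \<sigma> x u) = 0"
proof -
  interpret B: bounded_bilinear "amb \<rho> :: 'a \<times> real \<Rightarrow> _" by (rule bounded_bilinear_amb)
  have d: "\<sigma> differentiable (at x)" using smooth_on_differentiable[OF sm x] .
  show ?thesis
  proof (cases "\<rho> = 0")
    case True
    have "DD (\<lambda>y. amb 0 (0, 1) (\<sigma> y)) x = DD (\<lambda>y. 0) x"
      by (rule DD_cong[OF S x]) (use X True space_form_flat in blast)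
    then show ?thesis
      using DD_bilinear[OF bounded_bilinear_amb differentiable_const d, of 0 "(0, 1)" u] True
        bounded_bilinear.zero_left[OF bounded_bilinear_amb, of 0 "\<sigma> x"] by simp
  next
    case False
    have "DD (\<lambda>y. amb \<rho> (\<sigma> y) (\<sigma> y)) x = DD (\<lambda>y. 1 / \<rho>) x"
      by (rule DD_cong[OF S x]) (use X False space_form_quadric in blast)
    then have "DD (\<lambda>y. amb \<rho> (\<sigma> y) (\<sigma> y)) x u = 0" by simp
    then show ?thesis
      using DD_bilinear[OF bounded_bilinear_amb d d, of \<rho> u] False amb_commute[of \<rho> "DD \<sigma> x u"] by simp
  qed
qed

lemma amb_normal: "v \<in> space_form_set \<rho> \<Longrightarrow>
    amb \<rho> (if \<rho> = 0 then (0, 1) else v) (if \<rho> = 0 then (0, 1) else v) \<noteq> 0"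
  using space_form_quadric[of v \<rho>] by (auto simp: amb_def inner_prod_def)

text \<open>A vector orthogonal to the tangent space and to the normal \<open>nv x\<close> is
  orthogonal to everything, hence 0. Nondegeneracy on tangent vectors is the special case of a
  tangent vector, which is orthogonal to \<open>nv x\<close> anyway.\<close>

lemma space_form_chart_submanifold:
  fixes d :: "('n::euclidean_space \<times> real, 'n) chart"
  assumes d: "d \<in> submanifold_charts (space_form_set \<rho>)"
  shows "space_form_chart (snd d ` fst d) (chart_inv d) (amb \<rho>) \<rho> (0, 1)"
proof -
  note D = submanifold_chartD[OF d]
  interpret B: bounded_bilinear "amb \<rho> :: 'n \<times> real \<Rightarrow> _" by (rule bounded_bilinear_amb)
  have X: "chart_inv d x \<in> space_form_set \<rho>" if "x \<in> snd d ` fst d" for x using D(2,7) that by blast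
  define nv where "nv x = (if \<rho> = 0 then (0, 1) else chart_inv d x)" for x
  have nn: "amb \<rho> (nv x) (nv x) \<noteq> 0" if "x \<in> snd d ` fst d" for x
    using amb_normal[OF X[OF that]] by (simp add: nv_def)
  have n0: "amb \<rho> (nv x) (DD (chart_inv d) x u) = 0" if "x \<in> snd d ` fst d" for x u
    using quadric_derivative[OF D(1,3) that X] by (simp add: nv_def)
  have fr: "r = 0" if x: "x \<in> snd d ` fst d" and r: "\<And>w. amb \<rho> r (DD (chart_inv d) x w) = 0" "amb \<rho> r (nv x) = 0"
    for x r
  proof -
    have lin: "linear (DD (chart_inv d) x)"
      using DD_linear[OF smooth_on_differentiable[OF D(3) x]] by simp
    \<comment> \<open>Tangent coordinates together with a multiple of the normal. The dimensions
      agree, so injectivity of \<open>K\<close> shows that tangent space and normal span the ambient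
      space.\<close>
    define K where "K p = DD (chart_inv d) x (fst p) + snd p *\<^sub>R nv x" for p :: "'n \<times> real"
    have Klin: "linear K"
      by (rule linearI) (simp_all add: K_def linear_add[OF lin] linear_scale[OF lin] algebra_simps)
    have "p = 0" if p: "K p = 0" for p
    proof -
      have "amb \<rho> (nv x) (K p) = 0" using p B.zero_right by simp
      then have "snd p = 0" using nn[OF x] n0[OF x] by (simp add: K_def B.add_right B.scaleR_right)
      moreover then have "DD (chart_inv d) x (fst p) = DD (chart_inv d) x 0"
        using p linear_0[OF lin] by (simp add: K_def)
      then have "fst p = 0" by (rule injD[OF D(5)[OF x]])
      ultimately show ?thesis by (simp add: prod_eq_iff)
    qed
    then have "inj K" using Klin by (simp add: linear_injective_0)
    then have "surj K" using linear_injective_imp_surjective[OF Klin] by blast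
    moreover have "amb \<rho> r (K p) = 0" for p using r by (simp add: K_def B.add_right B.scaleR_right)
    ultimately have "amb \<rho> r w = 0" for w by (metis surjD)
    then show ?thesis by (rule amb_nondegenerate)
  qed
  show ?thesis
  proof (intro space_form_chart.intro immersion.intro space_form_chart_axioms.intro D(1,3) bounded_bilinear_amb)
    show "amb \<rho> v w = amb \<rho> w v" for v w :: "'n \<times> real" by (rule amb_commute)
    show "amb \<rho> (chart_inv d x) (chart_inv d x) = 1 / \<rho>" if "\<rho> \<noteq> 0" "x \<in> snd d ` fst d" for x
      by (rule space_form_quadric[OF X[OF that(2)] that(1)])
    show "amb \<rho> (0, 1) (chart_inv d x) = 0" if "\<rho> = 0" "x \<in> snd d ` fst d" for x
      using X[OF that(2)] that(1) space_form_flat by blast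
    show "z = 0" if x: "x \<in> snd d ` fst d" and
      z: "\<And>w. amb \<rho> (DD (chart_inv d) x z) (DD (chart_inv d) x w) = 0" for x z
    proof -
      have "DD (chart_inv d) x z = 0"
        by (rule fr[OF x z]) (use n0[OF x] amb_commute in metis)
      then have "DD (chart_inv d) x z = DD (chart_inv d) x 0"
        using linear_0[OF DD_linear[OF smooth_on_differentiable[OF D(3) x]]] by simp
      then show ?thesis by (rule injD[OF D(5)[OF x]])
    qed
    show "r = 0" if "x \<in> snd d ` fst d" "\<And>w. amb \<rho> r (DD (chart_inv d) x w) = 0"
      "amb \<rho> r (if \<rho> = 0 then (0, 1) else chart_inv d x) = 0" for x r
      using fr[OF that(1,2)] that(3) by (simp add: nv_def)
  qed
qed

text \<open>Needed for transition maps of submanifold charts, which by definition have smooth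
  inverses but are themselves only continuous. An immersion \<open>f\<close> can be cancelled on the
  left as far as differentiability is concerned.\<close>

lemma differentiable_lift:
  fixes f :: "'e::euclidean_space \<Rightarrow> 'v::euclidean_space"
  assumes f: "f differentiable (at (\<tau> x))" "inj (DD f (\<tau> x))" and g: "g differentiable (at x)"
    and \<tau>: "isCont \<tau> x" and U: "open U" "x \<in> U" "\<And>y. y \<in> U \<Longrightarrow> f (\<tau> y) = g y"
  shows "\<tau> differentiable (at x)"
proof -
  obtain K where K: "linear K" "\<And>u. K (DD f (\<tau> x) u) = u"
    using linear_injective_left_inverse[OF DD_linear[OF f(1)]] f(2) by (auto simp: fun_eq_iff)
  have blK: "bounded_linear K" using K(1) linear_conv_bounded_linear by blast
  \<comment> \<open>Composition with the left inverse \<open>K\<close> normalises the derivative at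
    \<open>\<tau> x\<close> to the identity. Near \<open>x\<close> the increments of
    \<open>\<tau>\<close> and of \<open>s\<close> then differ by a small fraction of the increment
    of \<open>\<tau>\<close>.\<close>
  define h where "h y = K (f y)" for y
  define s where "s y = K (g y)" for y
  define s' where "s' v = K (DD g x v)" for v
  have h: "(h has_derivative (\<lambda>u. u)) (at (\<tau> x))"
    using bounded_linear.has_derivative[OF blK has_derivative_DD[OF f(1)]] by (simp add: h_def[abs_def] K(2))
  have s: "(s has_derivative s') (at x)"
    using bounded_linear.has_derivative[OF blK has_derivative_DD[OF g]] by (simp add: s_def[abs_def] s'_def[abs_def])
  have hs: "h (\<tau> y) = s y" if "y \<in> U" for y using U(3)[OF that] by (simp add: h_def s_def)
  have h1: "\<exists>d>0. \<forall>z. norm (z - \<tau> x) < d \<longrightarrow> norm (h z - h (\<tau> x) - (z - \<tau> x)) \<le> e * norm (z - \<tau> x)"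
    if "e > 0" for e using h that unfolding has_derivative_at_alt by blast
  have s1: "\<exists>d>0. \<forall>y. norm (y - x) < d \<longrightarrow> norm (s y - s x - s' (y - x)) \<le> e * norm (y - x)"
    if "e > 0" for e using s that unfolding has_derivative_at_alt by blast
  have \<tau>1: "\<exists>d>0. \<forall>y. norm (y - x) < d \<longrightarrow> norm (\<tau> y - \<tau> x) < e" if "e > 0" for e
    using \<tau> that by (simp add: continuous_at_eps_delta dist_norm)
  obtain dU where dU: "dU > 0" "\<And>y. norm (y - x) < dU \<Longrightarrow> y \<in> U"
    using U(1,2) open_dist by (metis dist_norm)
  have h2: "\<exists>d>0. \<forall>y. norm (y - x) < d \<longrightarrow> norm (s y - s x - (\<tau> y - \<tau> x)) \<le> e * norm (\<tau> y - \<tau> x)"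
    if e: "e > 0" for e
  proof -
    obtain d where d: "d > 0" "\<And>z. norm (z - \<tau> x) < d \<Longrightarrow> norm (h z - h (\<tau> x) - (z - \<tau> x)) \<le> e * norm (z - \<tau> x)"
      using h1[OF e] by blast
    obtain d' where d': "d' > 0" "\<And>y. norm (y - x) < d' \<Longrightarrow> norm (\<tau> y - \<tau> x) < d"
      using \<tau>1[OF d(1)] by blast
    show ?thesis
    proof (intro exI[of _ "min d' dU"] conjI allI impI)
      fix y assume y: "norm (y - x) < min d' dU"
      have "h (\<tau> y) = s y" "h (\<tau> x) = s x" using hs dU(2)[of y] y U(2) by auto
      then show "norm (s y - s x - (\<tau> y - \<tau> x)) \<le> e * norm (\<tau> y - \<tau> x)"
        using d(2)[OF d'(2)[of y]] y by simp
    qed (use d' dU in simp)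
  qed
  obtain C where C: "C > 0" "\<And>v. norm (s' v) \<le> norm v * C"
    using bounded_linear.pos_bounded[OF has_derivative_bounded_linear[OF s]] by blast
  have "(\<tau> has_derivative s') (at x)"
    unfolding has_derivative_at_alt
  proof (intro conjI allI impI)
    show "bounded_linear s'" using has_derivative_bounded_linear[OF s] .
    fix e :: real assume e: "e > 0"
    \<comment> \<open>The increment of \<open>\<tau>\<close> will be at most
      \<open>2 * (C + 1) * norm (y - x)\<close>, so an error of \<open>e2\<close> relative to it
      costs half of \<open>e\<close>.\<close>
    define e2 where "e2 = e / (4 * (C + 1))"
    have e2: "e2 > 0" using e C(1) by (simp add: e2_def)
    obtain d1 where d1: "d1 > 0" "\<And>y. norm (y - x) < d1 \<Longrightarrow> norm (s y - s x - (\<tau> y - \<tau> x)) \<le> e2 * norm (\<tau> y - \<tau> x)"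
      using h2[OF e2] by blast
    obtain d2 where d2: "d2 > 0" "\<And>y. norm (y - x) < d2 \<Longrightarrow> norm (s y - s x - (\<tau> y - \<tau> x)) \<le> 1/2 * norm (\<tau> y - \<tau> x)"
      using h2[of "1/2"] by auto
    have e3: "min 1 (e / 2) > 0" using e by simp
    obtain d3 where d3: "d3 > 0" "\<And>y. norm (y - x) < d3 \<Longrightarrow> norm (s y - s x - s' (y - x)) \<le> min 1 (e / 2) * norm (y - x)"
      using s1[OF e3] by blast
    show "\<exists>d>0. \<forall>y. norm (y - x) < d \<longrightarrow> norm (\<tau> y - \<tau> x - s' (y - x)) \<le> e * norm (y - x)"
    proof (intro exI[of _ "min d1 (min d2 d3)"] conjI allI impI)
      show "min d1 (min d2 d3) > 0" using d1 d2 d3 by simp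
      fix y assume y: "norm (y - x) < min d1 (min d2 d3)"
      have a: "norm (s y - s x - s' (y - x)) \<le> min 1 (e / 2) * norm (y - x)" using d3(2)[of y] y by simp
      have a1: "norm (s y - s x - s' (y - x)) \<le> norm (y - x)"
        using order_trans[OF a mult_right_mono[of _ 1]] by simp
      have a2: "norm (s y - s x - s' (y - x)) \<le> e / 2 * norm (y - x)"
        by (rule order_trans[OF a mult_right_mono]) simp_all
      have b: "norm (s y - s x) \<le> (C + 1) * norm (y - x)"
        using norm_triangle_ineq[of "s y - s x - s' (y - x)" "s' (y - x)"] a1 C(2)[of "y - x"]
        by (simp add: algebra_simps)
      have "norm (\<tau> y - \<tau> x) \<le> 2 * norm (s y - s x)"
        using d2(2)[of y] y norm_triangle_ineq2[of "\<tau> y - \<tau> x" "s y - s x"] norm_minus_commute[of "s y - s x" "\<tau> y - \<tau> x"]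
        by simp
      then have c: "norm (\<tau> y - \<tau> x) \<le> 2 * (C + 1) * norm (y - x)" using b by linarith
      have "norm (s y - s x - (\<tau> y - \<tau> x)) \<le> e2 * (2 * (C + 1) * norm (y - x))"
        using order_trans[OF d1(2)[of y] mult_left_mono[OF c, of e2]] y e2 by simp
      also have "\<dots> = e / 2 * norm (y - x)" using C(1) by (simp add: e2_def field_simps)
      finally have f: "norm (s y - s x - (\<tau> y - \<tau> x)) \<le> e / 2 * norm (y - x)" .
      have "\<tau> y - \<tau> x - s' (y - x) = (s y - s x - s' (y - x)) - (s y - s x - (\<tau> y - \<tau> x))" by simp
      then have "norm (\<tau> y - \<tau> x - s' (y - x)) \<le> norm (s y - s x - s' (y - x)) + norm (s y - s x - (\<tau> y - \<tau> x))"
        by (metis norm_triangle_ineq4)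
      then show "norm (\<tau> y - \<tau> x - s' (y - x)) \<le> e * norm (y - x)" using a2 f by (simp add: algebra_simps)
    qed
  qed
  then show ?thesis by (auto simp: differentiable_def)
qed

section \<open>The shape operator of a totally biharmonic hypersurface\<close>

text \<open>On the line through \<open>u\<close> in direction \<open>v\<close> both forms are
  polynomials in \<open>\<tau>\<close>, and their product vanishes identically, so one of them is
  the zero polynomial. Its constant coefficient \<open>P u u\<close> or its leading coefficient
  \<open>Q v v\<close> gives the contradiction.\<close>

lemma quadratic_forms_product_zero:
  fixes P Q :: "'a::real_vector \<Rightarrow> 'a \<Rightarrow> real"
  assumes P: "bilinear P" and Q: "bilinear Q" and zero: "\<And>u. P u u * Q u u = 0"
  shows "(\<forall>u. P u u = 0) \<or> (\<forall>u. Q u u = 0)"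
proof (rule ccontr)
  assume "\<not> ?thesis"
  then obtain u v where u: "P u u \<noteq> 0" and v: "Q v v \<noteq> 0" by blast
  have e: "F (u + \<tau> *\<^sub>R v) (u + \<tau> *\<^sub>R v) = poly [:F u u, F u v + F v u, F v v:] \<tau>"
    if "bilinear F" for F :: "'a \<Rightarrow> 'a \<Rightarrow> real" and \<tau>
    using that by (simp add: bilinear_ladd bilinear_radd bilinear_lmul bilinear_rmul algebra_simps)
  have "poly ([:P u u, P u v + P v u, P v v:] * [:Q u u, Q u v + Q v u, Q v v:]) \<tau> = 0" for \<tau>
    unfolding poly_mult e[OF P, symmetric] e[OF Q, symmetric] by (rule zero)
  then have "[:P u u, P u v + P v u, P v v:] * [:Q u u, Q u v + Q v u, Q v v:] = 0"
    using poly_all_0_iff_0 by blast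
  then have "[:P u u, P u v + P v u, P v v:] = 0 \<or> [:Q u u, Q u v + Q v u, Q v v:] = 0"
    by (simp only: mult_eq_0_iff)
  then show False using u v by auto
qed

text \<open>The ambient space has two dimensions more than the chart: besides \<open>\<nu>\<close>
  there is the normal of the space form, \<open>e0\<close> or the position. \<open>B\<close> may be
  Lorentzian but is positive on the tangent vectors of the hypersurface.\<close>

locale hypersurface_chart = immersion S \<sigma> B
  for S :: "'m::euclidean_space set" and \<sigma> :: "'m \<Rightarrow> 'v::euclidean_space" and B +
  fixes \<nu> :: "'m \<Rightarrow> 'v" and \<rho> :: real and e0 :: 'v
  assumes \<nu>_smooth: "smooth_on \<nu> S"
    and \<nu>_unit: "x \<in> S \<Longrightarrow> B (\<nu> x) (\<nu> x) = 1"
    and \<nu>_normal: "x \<in> S \<Longrightarrow> B (\<nu> x) (d1 x u) = 0"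
    and \<nu>_position: "x \<in> S \<Longrightarrow> B (\<nu> x) (if \<rho> = 0 then e0 else \<sigma> x) = 0"
    and position_tangent: "x \<in> S \<Longrightarrow> B (if \<rho> = 0 then e0 else \<sigma> x) (d1 x u) = 0"
    and frame: "x \<in> S \<Longrightarrow> (\<And>w. B r (d1 x w) = 0) \<Longrightarrow> B r (\<nu> x) = 0 \<Longrightarrow>
          B r (if \<rho> = 0 then e0 else \<sigma> x) = 0 \<Longrightarrow> r = 0"
    and pos: "x \<in> S \<Longrightarrow> u \<noteq> 0 \<Longrightarrow> B (d1 x u) (d1 x u) > 0"
    and quadric: "\<rho> \<noteq> 0 \<Longrightarrow> x \<in> S \<Longrightarrow> B (\<sigma> x) (\<sigma> x) = 1 / \<rho>"
begin

abbreviation dn :: "'m \<Rightarrow> 'm \<Rightarrow> 'v" where "dn x u \<equiv> DD \<nu> x u"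

lemma \<nu>_differentiable: "x \<in> S \<Longrightarrow> \<nu> differentiable (at x)"
  using smooth_on_differentiable[OF \<nu>_smooth] .

lemma \<sigma>_differentiable: "x \<in> S \<Longrightarrow> \<sigma> differentiable (at x)"
  using smooth_on_differentiable[OF sm] .

lemma dn_linear: "x \<in> S \<Longrightarrow> linear (dn x)"
  using DD_linear[OF \<nu>_differentiable] by simp

lemmas dn_simps = linear_add[OF dn_linear] linear_diff[OF dn_linear] linear_scale[OF dn_linear]
  linear_0[OF dn_linear] linear_neg[OF dn_linear]

lemma derivative_orthogonal:
  assumes x: "x \<in> S" and f: "f differentiable (at x)" and g: "g differentiable (at x)"
    and c: "\<And>y. y \<in> S \<Longrightarrow> B (f y) (g y) = c"
  shows "B (f x) (DD g x u) + B (DD f x u) (g x) = 0"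
proof -
  have "DD (\<lambda>y. B (f y) (g y)) x = DD (\<lambda>y. c) x"
    by (rule DD_cong[OF S x c])
  then have "DD (\<lambda>y. B (f y) (g y)) x u = 0" by simp
  then show ?thesis using DD_bilinear[OF B f g, of u] by simp
qed

lemma \<nu>_dn: "x \<in> S \<Longrightarrow> B (\<nu> x) (dn x u) = 0"
  using derivative_orthogonal[OF _ \<nu>_differentiable \<nu>_differentiable \<nu>_unit, of x u]
  by (simp add: Bsym[of "dn x u"])

lemma position_dn: "x \<in> S \<Longrightarrow> B (if \<rho> = 0 then e0 else \<sigma> x) (dn x u) = 0"
proof (cases "\<rho> = 0")
  case True
  assume x: "x \<in> S"
  have "B (\<nu> y) e0 = 0" if "y \<in> S" for y using \<nu>_position[OF that] True by simp
  from derivative_orthogonal[OF x \<nu>_differentiable[OF x] differentiable_const this]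
  show ?thesis using True by (simp add: Bsimps Bsym[of e0])
next
  case False
  assume x: "x \<in> S"
  have "B (\<nu> y) (\<sigma> y) = 0" if "y \<in> S" for y using \<nu>_position[OF that] False by simp
  from derivative_orthogonal[OF x \<nu>_differentiable[OF x] \<sigma>_differentiable[OF x] this]
  show ?thesis using False \<nu>_normal[OF x] by (simp add: Bsym[of "\<sigma> x"])
qed

text \<open>The Weingarten relation, from differentiating the orthogonality of \<open>\<nu>\<close>
  and \<open>d1\<close>. Its sign shows that \<open>dn\<close> represents minus the usual shape
  operator.\<close>

lemma second_form: "x \<in> S \<Longrightarrow> B (\<nu> x) (d2 x u v) = - B (dn x v) (d1 x u)"
  using derivative_orthogonal[OF _ \<nu>_differentiable d1_differentiable \<nu>_normal, of x u v] by simp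

lemma shape_sym: "x \<in> S \<Longrightarrow> B (dn x v) (d1 x u) = B (dn x u) (d1 x v)"
  using second_form[of x u v] second_form[of x v u] d2_sym[of x u v] by simp

text \<open>\<open>dn x u\<close> is orthogonal to both normal directions and therefore equal to its
  tangential part, by the frame property.\<close>

lemma dn_tangent:
  assumes x: "x \<in> S" obtains z where "dn x u = d1 x z"
proof -
  obtain z where z: "\<And>w. B (d1 x z) (d1 x w) = B (dn x u) (d1 x w)"
    using tangential_part_exists[OF x] by blast
  have "dn x u - d1 x z = 0"
  proof (rule frame[OF x])
    show "B (dn x u - d1 x z) (d1 x w) = 0" for w by (simp add: Bsimps z)
    show "B (dn x u - d1 x z) (\<nu> x) = 0"
      using \<nu>_dn[OF x] \<nu>_normal[OF x] by (simp add: Bsimps Bsym[of _ "\<nu> x"])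
    show "B (dn x u - d1 x z) (if \<rho> = 0 then e0 else \<sigma> x) = 0"
      using position_dn[OF x] position_tangent[OF x] by (simp only: Bsimps Bsym[of "dn x u"] Bsym[of "d1 x z"])
  qed
  then show thesis using that by simp
qed

text \<open>Polarisation of the symmetric second fundamental form shows that \<open>dn x u\<close>
  is orthogonal to all tangent vectors; its pairings with the normals vanish anyway.\<close>

lemma shape_operator_zero:
  assumes x: "x \<in> S" and z: "\<And>u. B (dn x u) (d1 x u) = 0"
  shows "dn x u = 0"
proof -
  have "B (dn x u) (d1 x v) = 0" for v
    using z[of "u + v"] z[of u] z[of v] shape_sym[OF x, of u v]
    by (simp add: dn_simps d1_simps x Bsimps)
  then show ?thesis
    by (rule frame[OF x]) (use \<nu>_dn[OF x] position_dn[OF x] Bsym in metis)+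
qed

text \<open>Scaling turns the alternative for unit vectors into a product of two quadratic forms
  that vanishes on all vectors. Whichever factor is identically zero is then polarised.\<close>

lemma shape_alternative:
  assumes x: "x \<in> S"
    and unit: "\<And>u. B (d1 x u) (d1 x u) = 1 \<Longrightarrow> B (dn x u) (d1 x u) = 0 \<or> B (dn x u) (dn x u) = \<rho>"
  shows "(\<forall>u. dn x u = 0) \<or> (\<forall>u v. B (dn x u) (dn x v) = \<rho> * B (d1 x u) (d1 x v))"
proof -
  let ?P = "\<lambda>u v. B (dn x u) (d1 x v)"
  let ?Q = "\<lambda>u v. B (dn x u) (dn x v) - \<rho> * B (d1 x u) (d1 x v)"
  have P: "bilinear ?P" and Q: "bilinear ?Q"
    unfolding bilinear_def by (auto intro!: linearI simp: dn_simps d1_simps x Bsimps algebra_simps)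
  have "?P u u * ?Q u u = 0" for u
  proof (cases "u = 0")
    case True then show ?thesis by (simp add: d1_simps x Bsimps)
  next
    case False
    define c where "c = sqrt (B (d1 x u) (d1 x u))"
    have c: "c > 0" "c * c = B (d1 x u) (d1 x u)" using pos[OF x False] by (simp_all add: c_def)
    define w where "w = (1 / c) *\<^sub>R u"
    have u: "u = c *\<^sub>R w" using c by (simp add: w_def)
    have "d1 x u = c *\<^sub>R d1 x w" using c by (simp add: w_def d1_simps x)
    then have ww: "B (d1 x w) (d1 x w) = 1" using c by (simp add: Bsimps)
    from unit[OF this] show ?thesis
      unfolding u using ww by (auto simp: d1_simps dn_simps x Bsimps)
  qed
  from quadratic_forms_product_zero[OF P Q this]
  show ?thesis
  proof
    assume "\<forall>u. ?P u u = 0"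
    then show ?thesis using shape_operator_zero[OF x] by blast
  next
    assume q: "\<forall>u. ?Q u u = 0"
    have "?Q u v = 0" for u v
      using q[rule_format, of "u + v"] q[rule_format, of u] q[rule_format, of v] Bsym[of "dn x v" "dn x u"] Bsym[of "d1 x v" "d1 x u"]
      by (simp add: dn_simps d1_simps x Bsimps algebra_simps)
    then show ?thesis by simp
  qed
qed

text \<open>\<open>dn x u\<close> is tangent, and \<open>B\<close> is positive definite on tangent
  vectors, so its square cannot be the nonpositive number \<open>\<rho> B (d1 x u) (d1 x u)\<close>
  unless it vanishes.\<close>

lemma nonpositive_curvature:
  assumes x: "x \<in> S" and \<rho>: "\<rho> \<le> 0" and q: "\<And>u v. B (dn x u) (dn x v) = \<rho> * B (d1 x u) (d1 x v)"
  shows "dn x u = 0"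
proof (cases "u = 0")
  case True then show ?thesis by (simp add: dn_simps x)
next
  case False
  obtain z where z: "dn x u = d1 x z" using dn_tangent[OF x] .
  have "B (d1 x z) (d1 x z) \<le> 0"
    using q[of u u] z pos[OF x False] \<rho> by (simp add: mult_nonpos_nonneg)
  then have "z = 0" using pos[OF x, of z] by force
  then show ?thesis by (simp add: z d1_simps x)
qed

section \<open>Curves in the hypersurface and their ambient acceleration\<close>

context
  fixes J :: "real set" and a :: "real \<Rightarrow> 'm" and G :: "'m local_metric"
  assumes J: "open J" and a: "smooth_on a J" "a ` J \<subseteq> S"
    and G: "\<And>x. x \<in> S \<Longrightarrow> G x = ind x"
begin

abbreviation (input) \<eta> :: "real \<Rightarrow> 'v" where "\<eta> \<equiv> \<lambda>s. \<sigma> (a s)"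

lemma curve_in: "t \<in> J \<Longrightarrow> a t \<in> S" using a(2) by blast

lemma curve_differentiable: "t \<in> J \<Longrightarrow> a differentiable (at t)"
  using smooth_on_differentiable[OF a(1)] .

lemma velocity_lift: "t \<in> J \<Longrightarrow> velocity \<eta> t = d1 (a t) (velocity a t)"
  using has_vector_derivative_DD[OF \<sigma>_differentiable[OF curve_in] has_velocity[OF curve_differentiable]]
  by (rule velocity_eqI)

lemma velocity_normal: "t \<in> J \<Longrightarrow> velocity (\<lambda>s. \<nu> (a s)) t = dn (a t) (velocity a t)"
  using has_vector_derivative_DD[OF \<nu>_differentiable[OF curve_in] has_velocity[OF curve_differentiable]]
  by (rule velocity_eqI)

lemma smooth_lift: "smooth_on \<eta> J" "smooth_on (\<lambda>s. \<nu> (a s)) J"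
  by (rule smooth_on_compose[OF S J a(2) sm a(1)], rule smooth_on_compose[OF S J a(2) \<nu>_smooth a(1)])

lemma acceleration_tangential:
  assumes t: "t \<in> J"
  shows "B (velocity (velocity \<eta>) t) (d1 (a t) w)
    = B (d1 (a t) (nabla_along G a (velocity a) t)) (d1 (a t) w)"
proof -
  have "velocity (velocity \<eta>) t = velocity (\<lambda>s. d1 (a s) (velocity a s)) t"
    by (rule velocity_cong[OF J t velocity_lift])
  then show ?thesis
    using nabla_along_ind[OF G curve_in[OF t] curve_differentiable[OF t]
        smooth_on_differentiable[OF smooth_on_velocity[OF J a(1)] t], of w]
    by (simp add: velocity_def)
qed

lemma curve_orthogonal:
  assumes "smooth_on f J" "smooth_on g J" "\<And>s. s \<in> J \<Longrightarrow> B (f s) (g s) = c" "t \<in> J"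
  shows "B (f t) (velocity g t) + B (velocity f t) (g t) = 0"
  using velocity_bilinear[OF B smooth_on_differentiable[OF assms(1,4)] smooth_on_differentiable[OF assms(2,4)]]
    velocity_zero[OF J assms(4), of "\<lambda>s. B (f s) (g s)", OF assms(3)] by simp

lemma acceleration_normal:
  assumes t: "t \<in> J"
  shows "B (velocity (velocity \<eta>) t) (\<nu> (a t)) = - B (dn (a t) (velocity a t)) (d1 (a t) (velocity a t))"
proof -
  have "B (\<nu> (a s)) (velocity \<eta> s) = 0" if "s \<in> J" for s
    using \<nu>_normal[OF curve_in[OF that]] velocity_lift[OF that] by simp
  from curve_orthogonal[OF smooth_lift(2) smooth_on_velocity[OF J smooth_lift(1)] this t]
  show ?thesis
    by (simp add: velocity_normal[OF t] velocity_lift[OF t] Bsym[of "velocity (velocity \<eta>) t"])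
qed

lemma acceleration_position:
  assumes t: "t \<in> J"
  shows "B (velocity (velocity \<eta>) t + (\<rho> * B (velocity \<eta> t) (velocity \<eta> t)) *\<^sub>R \<sigma> (a t))
    (if \<rho> = 0 then e0 else \<sigma> (a t)) = 0"
proof (cases "\<rho> = 0")
  case True
  have "B e0 (velocity \<eta> s) = 0" if "s \<in> J" for s
    using position_tangent[OF curve_in[OF that]] True velocity_lift[OF that] by simp
  from curve_orthogonal[OF smooth_on_const smooth_on_velocity[OF J smooth_lift(1)] this t]
  show ?thesis using True by (simp add: Bsimps velocity_def[of "\<lambda>_. e0"] Bsym[of e0])
next
  case False
  have "B (\<sigma> (a s)) (velocity \<eta> s) = 0" if "s \<in> J" for s
    using position_tangent[OF curve_in[OF that]] False velocity_lift[OF that] by simp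
  from curve_orthogonal[OF smooth_lift(1) smooth_on_velocity[OF J smooth_lift(1)] this t]
  show ?thesis
    using False quadric[OF False curve_in[OF t]]
    by (simp add: Bsimps Bsym[of "\<sigma> (a t)" "velocity (velocity \<eta>) t"])
qed

text \<open>Tangential, normal and positional components of the acceleration are compared by means
  of the frame. The factor \<open>B \<eta>' \<eta>'\<close> is kept because totally geodesic
  immersions must be tested on geodesics of any speed.\<close>

lemma geodesic_acceleration:
  assumes t: "t \<in> J" and geo: "nabla_along G a (velocity a) t = 0"
  shows "velocity (velocity \<eta>) t
      + (\<rho> * B (velocity \<eta> t) (velocity \<eta> t)) *\<^sub>R \<sigma> (a t)
    = - B (dn (a t) (velocity a t)) (d1 (a t) (velocity a t)) *\<^sub>R \<nu> (a t)"
    (is "?X = ?k *\<^sub>R _")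
proof -
  have at: "a t \<in> S" using curve_in[OF t] .
  have p: "\<rho> * B (\<sigma> (a t)) (d1 (a t) w) = 0" "\<rho> * B (\<sigma> (a t)) (\<nu> (a t)) = 0" for w
    using position_tangent[OF at, of w] \<nu>_position[OF at] Bsym[of "\<sigma> (a t)" "\<nu> (a t)"]
    by (cases "\<rho> = 0"; simp)+
  have "?X - ?k *\<^sub>R \<nu> (a t) = 0"
  proof (rule frame[OF at])
    show "B (?X - ?k *\<^sub>R \<nu> (a t)) (d1 (a t) w) = 0" for w
      using acceleration_tangential[OF t, of w] p(1)[of w] \<nu>_normal[OF at]
      by (auto simp: Bsimps geo d1_simps at)
    show "B (?X - ?k *\<^sub>R \<nu> (a t)) (\<nu> (a t)) = 0"
      using acceleration_normal[OF t] p(2) \<nu>_unit[OF at] by (auto simp: Bsimps)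
    show "B (?X - ?k *\<^sub>R \<nu> (a t)) (if \<rho> = 0 then e0 else \<sigma> (a t)) = 0"
      using acceleration_position[OF t] \<nu>_position[OF at] by (simp only: Bsimps) simp
  qed
  then show ?thesis by (rule iffD2[OF eq_iff_diff_eq_0])
qed

lemma biharmonic_alternative:
  assumes t: "t \<in> J" and geo: "\<And>s. s \<in> J \<Longrightarrow> nabla_along G a (velocity a) s = 0"
    and unit: "\<And>s. s \<in> J \<Longrightarrow> ind (a s) (velocity a s) (velocity a s) = 1"
    and bih: "\<And>s. s \<in> J \<Longrightarrow> biharmonic_ambient_at B \<rho> \<eta> s"
  shows "B (dn (a t) (velocity a t)) (d1 (a t) (velocity a t)) = 0 \<or>
    B (dn (a t) (velocity a t)) (dn (a t) (velocity a t)) = \<rho>"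
proof -
  let ?k = "\<lambda>s. - B (dn (a s) (velocity a s)) (d1 (a s) (velocity a s))"
  have u: "B (velocity \<eta> s) (velocity \<eta> s) = 1" if "s \<in> J" for s
    using unit[OF that] velocity_lift[OF that] by (simp add: ind_def)
  have "?k t = 0 \<or> B (velocity (\<lambda>s. \<nu> (a s)) t) (velocity (\<lambda>s. \<nu> (a s)) t) = \<rho>"
  proof (rule biharmonic_geodesic_alternative[OF B Bsym J t smooth_lift])
    fix s assume s: "s \<in> J"
    show "\<rho> * B (\<sigma> (a s)) (velocity \<eta> s) = 0"
      using position_tangent[OF curve_in[OF s], of "velocity a s"] velocity_lift[OF s] by (auto split: if_splits)
    show "B (\<nu> (a s)) (\<nu> (a s)) = 1" using \<nu>_unit[OF curve_in[OF s]] .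
    show "B (\<nu> (a s)) (velocity \<eta> s) = 0" using \<nu>_normal[OF curve_in[OF s]] velocity_lift[OF s] by simp
    show "\<rho> * B (\<nu> (a s)) (\<sigma> (a s)) = 0" using \<nu>_position[OF curve_in[OF s]] by (auto split: if_splits)
    show "velocity (velocity \<eta>) s + \<rho> *\<^sub>R \<sigma> (a s) = ?k s *\<^sub>R \<nu> (a s)"
      using geodesic_acceleration[OF s geo[OF s]] u[OF s] by simp
  qed (rule bih)
  then show ?thesis using velocity_normal[OF t] by simp
qed

end

text \<open>The acceleration of a geodesic is \<open>B\<close>-orthogonal to its velocity, so the
  speed keeps its initial value.\<close>

lemma unit_speed_geodesic_exists:
  assumes G: "\<And>x. x \<in> S \<Longrightarrow> G x = ind x" and x0: "x0 \<in> S" and u0: "ind x0 u0 u0 = 1"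
  obtains \<delta> a where "\<delta> > 0" "a 0 = x0" "velocity a 0 = u0" "smooth_on a {-\<delta><..<\<delta>}"
    "a ` {-\<delta><..<\<delta>} \<subseteq> S" "\<And>t. t \<in> {-\<delta><..<\<delta>} \<Longrightarrow> nabla_along G a (velocity a) t = 0"
    "\<And>t. t \<in> {-\<delta><..<\<delta>} \<Longrightarrow> ind (a t) (velocity a t) (velocity a t) = 1"
proof -
  obtain \<delta> a where \<delta>: "\<delta> > 0" and a0: "a 0 = x0" "velocity a 0 = u0" and a: "smooth_on a {-\<delta><..<\<delta>}"
    "a ` {-\<delta><..<\<delta>} \<subseteq> S" and geo: "\<And>t. t \<in> {-\<delta><..<\<delta>} \<Longrightarrow> nabla_along G a (velocity a) t = 0"
    using geodesic_exists[OF G x0, of u0] by blast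
  let ?J = "{-\<delta><..<\<delta>}"
  let ?\<eta>1 = "velocity (\<lambda>s. \<sigma> (a s))"
  have J: "open ?J" by simp
  have \<eta>1: "smooth_on ?\<eta>1 ?J" by (rule smooth_on_velocity[OF J smooth_lift(1)[OF J a G]])
  define f where "f t = B (?\<eta>1 t) (?\<eta>1 t)" for t
  have "(f has_vector_derivative 0) (at t)" if t: "t \<in> ?J" for t
  proof -
    have "B (velocity ?\<eta>1 t) (?\<eta>1 t) = 0"
      using acceleration_tangential[OF J a G t, of "velocity a t"] velocity_lift[OF J a G t] geo[OF t] curve_in[OF J a G t]
      by (simp add: d1_simps Bsimps)
    then show ?thesis
      using bounded_bilinear.has_vector_derivative[OF B has_velocity has_velocity, of ?\<eta>1 t ?\<eta>1]
        smooth_on_differentiable[OF \<eta>1 t] by (simp add: f_def[abs_def] Bsym[of "?\<eta>1 t"])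
  qed
  then have d: "(f has_derivative (\<lambda>h. 0)) (at t within ?J)" if "t \<in> ?J" for t
    using that by (auto simp: has_vector_derivative_def intro: has_derivative_at_withinI)
  have f: "f t = ind (a t) (velocity a t) (velocity a t)" if "t \<in> ?J" for t
    using velocity_lift[OF J a G that] by (simp add: f_def ind_def)
  obtain c where c: "\<And>t. t \<in> ?J \<Longrightarrow> f t = c"
    using has_derivative_zero_constant[OF _ d] by (auto simp: convex_real_interval)
  have "c = 1" using c[of 0] f[of 0] \<delta> u0 a0 by simp
  then have "ind (a t) (velocity a t) (velocity a t) = 1" if "t \<in> ?J" for t using c[OF that] f[OF that] by simp
  then show thesis using that[OF \<delta> a0 a geo] by blast
qed

end

section \<open>Clifford tori\<close>

definition reflects :: "('m::euclidean_space \<Rightarrow> 'v::euclidean_space) \<Rightarrow> ('m \<Rightarrow> 'v) \<Rightarrow> 'm \<Rightarrow> ('v \<Rightarrow> 'v) \<Rightarrow> bool" where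
  "reflects \<psi> \<nu> x R \<longleftrightarrow> linear R \<and> R (\<psi> x) = \<nu> x \<and> R (\<nu> x) = \<psi> x \<and> (\<forall>u. R (DD \<psi> x u) = DD \<nu> x u)"

text \<open>The assumption \<open>isom\<close> expresses that the shape operator squares to the
  identity, without naming the operator. By \<open>dim\<close>, the tangent space together with
  \<open>\<psi>\<close> and \<open>\<nu>\<close> fills the ambient space.\<close>

locale clifford_chart =
  fixes S :: "'m::euclidean_space set" and \<psi> \<nu> :: "'m \<Rightarrow> 'v::euclidean_space"
  assumes S: "open S" and \<psi>: "smooth_on \<psi> S" and \<nu>: "smooth_on \<nu> S"
    and \<psi>\<psi>: "x \<in> S \<Longrightarrow> \<psi> x \<bullet> \<psi> x = 1" and \<nu>\<nu>: "x \<in> S \<Longrightarrow> \<nu> x \<bullet> \<nu> x = 1"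
    and \<psi>\<nu>: "x \<in> S \<Longrightarrow> \<psi> x \<bullet> \<nu> x = 0" and \<nu>\<psi>': "x \<in> S \<Longrightarrow> \<nu> x \<bullet> DD \<psi> x u = 0"
    and isom: "x \<in> S \<Longrightarrow> DD \<nu> x u \<bullet> DD \<nu> x v = DD \<psi> x u \<bullet> DD \<psi> x v"
    and inj: "x \<in> S \<Longrightarrow> DD \<psi> x u = 0 \<Longrightarrow> u = 0"
    and dim: "DIM('v) = DIM('m) + 2"
begin

lemma diff: "smooth_on f S \<Longrightarrow> x \<in> S \<Longrightarrow> f differentiable (at x)" for f :: "'m \<Rightarrow> 'w::euclidean_space"
  by (rule smooth_on_differentiable)

lemma lin: "smooth_on f S \<Longrightarrow> x \<in> S \<Longrightarrow> linear (DD f x)" for f :: "'m \<Rightarrow> 'w::euclidean_space"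
  by (rule linear_frechet_derivative[OF smooth_on_differentiable])

lemma orthogonal_derivative:
  fixes f g :: "'m \<Rightarrow> 'v"
  assumes x: "x \<in> S" and f: "smooth_on f S" and g: "smooth_on g S" and c: "\<And>y. y \<in> S \<Longrightarrow> f y \<bullet> g y = c"
  shows "f x \<bullet> DD g x u + DD f x u \<bullet> g x = 0"
proof -
  have "DD (\<lambda>y. f y \<bullet> g y) x = DD (\<lambda>y. c) x" by (rule DD_cong[OF S x c])
  then have "DD (\<lambda>y. f y \<bullet> g y) x u = 0" by simp
  then show ?thesis using DD_bilinear[OF bounded_bilinear_inner diff[OF f x] diff[OF g x], of u] by simp
qed

lemma \<psi>\<psi>': "x \<in> S \<Longrightarrow> \<psi> x \<bullet> DD \<psi> x u = 0"
  using orthogonal_derivative[OF _ \<psi> \<psi> \<psi>\<psi>, of x u] by (simp add: inner_commute)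

lemma \<nu>\<nu>': "x \<in> S \<Longrightarrow> \<nu> x \<bullet> DD \<nu> x u = 0"
  using orthogonal_derivative[OF _ \<nu> \<nu> \<nu>\<nu>, of x u] by (simp add: inner_commute)

lemma \<psi>\<nu>': "x \<in> S \<Longrightarrow> \<psi> x \<bullet> DD \<nu> x u = 0"
  using orthogonal_derivative[OF _ \<psi> \<nu> \<psi>\<nu>, of x u] \<nu>\<psi>'[of x u] by (simp add: inner_commute)

lemma sym: "x \<in> S \<Longrightarrow> DD \<psi> x u \<bullet> DD \<nu> x v = DD \<psi> x v \<bullet> DD \<nu> x u"
  using orthogonal_derivative[OF _ \<nu> smooth_on_DD[OF \<psi>] \<nu>\<psi>', of x u v]
    orthogonal_derivative[OF _ \<nu> smooth_on_DD[OF \<psi>] \<nu>\<psi>', of x v u]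
    symmetric_second_derivative[OF S _ \<psi>, of x u v] by (simp add: inner_commute)

lemmas orth = \<psi>\<psi> \<nu>\<nu> \<psi>\<nu> \<nu>\<psi>' \<psi>\<psi>' \<nu>\<nu>' \<psi>\<nu>'

lemma orth':
  assumes "x \<in> S"
  shows "\<nu> x \<bullet> \<psi> x = 0" "DD \<psi> x u \<bullet> \<nu> x = 0" "DD \<psi> x u \<bullet> \<psi> x = 0" "DD \<nu> x u \<bullet> \<nu> x = 0" "DD \<nu> x u \<bullet> \<psi> x = 0"
  using orth[OF assms] by (simp_all add: inner_commute)

text \<open>The moving frame at \<open>x\<close> as a linear map from coordinates to the ambient
  space.\<close>

definition K :: "'m \<Rightarrow> 'm \<times> real \<times> real \<Rightarrow> 'v" where
  "K x z = DD \<psi> x (fst z) + fst (snd z) *\<^sub>R \<psi> x + snd (snd z) *\<^sub>R \<nu> x"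

text \<open>The images of the frame vectors under the desired reflection, which is thus
  \<open>H x\<close> after the inverse of \<open>K x\<close>.\<close>

definition H :: "'m \<Rightarrow> 'm \<times> real \<times> real \<Rightarrow> 'v" where
  "H x z = DD \<nu> x (fst z) + fst (snd z) *\<^sub>R \<nu> x + snd (snd z) *\<^sub>R \<psi> x"

lemma K_linear: "x \<in> S \<Longrightarrow> linear (K x)"
  unfolding K_def
  by (rule linearI) (simp_all add: linear_add[OF lin[OF \<psi>]] linear_scale[OF lin[OF \<psi>]] algebra_simps)

lemma H_linear: "x \<in> S \<Longrightarrow> linear (H x)"
  unfolding H_def
  by (rule linearI) (simp_all add: linear_add[OF lin[OF \<nu>]] linear_scale[OF lin[OF \<nu>]] algebra_simps)

lemma H_K_sym: "x \<in> S \<Longrightarrow> H x z \<bullet> K x z' = K x z \<bullet> H x z'"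
  using sym[of x "fst z" "fst z'"]
  by (simp add: H_def K_def inner_add_left inner_add_right orth orth' inner_commute[of "DD \<nu> x (fst z)"])

lemma H_isom: "x \<in> S \<Longrightarrow> H x z \<bullet> H x z' = K x z \<bullet> K x z'"
  by (simp add: H_def K_def inner_add_left inner_add_right orth orth' isom)

lemma K_inj: assumes x: "x \<in> S" and z: "K x z = 0" shows "z = 0"
proof -
  have "K x z \<bullet> \<psi> x = 0" "K x z \<bullet> \<nu> x = 0" using z by simp_all
  then have "snd z = 0" by (simp add: K_def inner_add_left orth[OF x] orth'[OF x] prod_eq_iff)
  moreover from this have "fst z = 0" using z inj[OF x] by (simp add: K_def)
  ultimately show ?thesis by (simp add: prod_eq_iff)
qed

lemma K_surj: assumes x: "x \<in> S" obtains z where "K x z = w"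
proof -
  have l: "linear (K x)" by (rule K_linear[OF x])
  have "inj (K x)" using K_inj[OF x] l by (simp add: linear_injective_0)
  then have "dim (range (K x)) = DIM('m \<times> real \<times> real)" using dim_image_eq[OF l, of UNIV] by simp
  also have "\<dots> = DIM('v)" using dim by simp
  finally have "range (K x) = UNIV"
    using dim_eq_full[of "range (K x)"] span_linear_image[OF l, of UNIV] by simp
  then show thesis using that by (metis surjD)
qed

lemma reflection_exists:
  assumes x: "x \<in> S"
  obtains R where "reflects \<psi> \<nu> x R" "\<And>z. R (K x z) = H x z"
proof -
  have l: "linear (K x)" by (rule K_linear[OF x])
  have "inj (K x)" using K_inj[OF x] l by (simp add: linear_injective_0)
  then obtain L where L: "linear L" "\<And>z. L (K x z) = z"
    using linear_injective_left_inverse[OF l] by (auto simp: fun_eq_iff)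
  let ?R = "\<lambda>w. H x (L w)"
  have RK: "?R (K x z) = H x z" for z by (simp add: L)
  have "reflects \<psi> \<nu> x ?R"
    unfolding reflects_def
  proof (intro conjI allI)
    show "linear ?R" using linear_compose[OF L(1) H_linear[OF x]] by (simp add: o_def)
    show "?R (\<psi> x) = \<nu> x" using RK[of "(0, 1, 0)"]
      by (simp add: K_def H_def linear_0[OF lin[OF \<psi> x]] linear_0[OF lin[OF \<nu> x]])
    show "?R (\<nu> x) = \<psi> x" using RK[of "(0, 0, 1)"]
      by (simp add: K_def H_def linear_0[OF lin[OF \<psi> x]] linear_0[OF lin[OF \<nu> x]])
    show "?R (DD \<psi> x u) = DD \<nu> x u" for u using RK[of "(u, 0, 0)"] by (simp add: K_def H_def)
  qed
  then show thesis using that RK by blast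
qed

context
  fixes x :: 'm and R :: "'v \<Rightarrow> 'v"
  assumes x: "x \<in> S" and R: "reflects \<psi> \<nu> x R"
begin

lemma R_linear: "linear R" using R by (simp add: reflects_def)

lemmas R_simps = linear_add[OF R_linear] linear_diff[OF R_linear] linear_scale[OF R_linear]

lemma R_K: "R (K x z) = H x z"
  using R by (simp add: K_def H_def R_simps reflects_def)

lemma R_sym: "R v \<bullet> w = v \<bullet> R w"
  by (rule K_surj[OF x, of v], rule K_surj[OF x, of w]) (metis R_K H_K_sym[OF x])

lemma R_isom: "R v \<bullet> R w = v \<bullet> w"
  by (rule K_surj[OF x, of v], rule K_surj[OF x, of w]) (metis R_K H_isom[OF x])

text \<open>A symmetric isometry is an involution, since
  \<open>R (R v) \<bullet> w = R v \<bullet> R w = v \<bullet> w\<close>.\<close>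

lemma R_involution: "R (R v) = v"
proof -
  have "R (R v) \<bullet> w = v \<bullet> w" for w using R_sym R_isom by simp
  then show ?thesis using vector_eq_rdot by blast
qed

lemma R_normal_derivative: "R (DD \<nu> x u) = DD \<psi> x u"
  using R R_involution by (metis reflects_def)

text \<open>The derivative of \<open>\<nu>\<close> is orthogonal to \<open>\<psi>\<close> and
  \<open>\<nu>\<close>, so in frame coordinates only the tangential entry \<open>z\<close> survives;
  applying \<open>R\<close> gives the second equation.\<close>

lemma shape_vector: obtains z where "DD \<nu> x u = DD \<psi> x z" "DD \<nu> x z = DD \<psi> x u"
proof -
  obtain w where w: "K x w = DD \<nu> x u" using K_surj[OF x] .
  have "K x w \<bullet> \<psi> x = 0" "K x w \<bullet> \<nu> x = 0" unfolding w by (simp_all add: orth'[OF x])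
  then have "snd w = 0" by (simp add: K_def inner_add_left orth[OF x] orth'[OF x] prod_eq_iff)
  then have "DD \<nu> x u = DD \<psi> x (fst w)" using w by (simp add: K_def)
  moreover from this have "DD \<nu> x (fst w) = DD \<psi> x u"
    using R R_normal_derivative[of u] by (simp add: reflects_def)
  ultimately show thesis using that by blast
qed

text \<open>\<open>a\<close> and \<open>b\<close> are twice the components of \<open>\<psi>\<close> in the eigenspaces of \<open>R\<close>. The trilinear form
  \<open>D\<^sup>2a(u,w) \<bullet> Db(v) = - Da(u) \<bullet> D\<^sup>2b(v,w)\<close> is totally symmetric and vanishes as soon as one
  argument is annihilated by \<open>Da\<close> or \<open>Db\<close>; such arguments span the tangent space.\<close>

lemma reflection_second_derivative:
  "R (DD (\<lambda>y. DD \<psi> y u) x w) = DD (\<lambda>y. DD \<nu> y u) x w"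
proof -
  define a where "a y = \<psi> y + \<nu> y" for y
  define b where "b y = \<psi> y - \<nu> y" for y
  have as: "smooth_on a S" and bs: "smooth_on b S"
    unfolding a_def b_def by (rule smooth_on_add[OF S \<psi> \<nu>], rule smooth_on_diff[OF S \<psi> \<nu>])
  have a1: "DD a y u = DD \<psi> y u + DD \<nu> y u" and b1: "DD b y u = DD \<psi> y u - DD \<nu> y u" if "y \<in> S" for y u
    using fun_cong[OF DD_eq[OF has_derivative_add[OF has_derivative_DD[OF diff[OF \<psi> that]] has_derivative_DD[OF diff[OF \<nu> that]]]], of u]
      fun_cong[OF DD_eq[OF has_derivative_diff[OF has_derivative_DD[OF diff[OF \<psi> that]] has_derivative_DD[OF diff[OF \<nu> that]]]], of u]
    by (simp_all add: a_def[abs_def] b_def[abs_def])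
  let ?A = "\<lambda>u w. DD (\<lambda>y. DD a y u) x w"
  let ?B = "\<lambda>u w. DD (\<lambda>y. DD b y u) x w"
  have As: "?A u w = ?A w u" and Bs: "?B u w = ?B w u" for u w
    using symmetric_second_derivative[OF S x as] symmetric_second_derivative[OF S x bs] by auto
  have o1: "DD a y u \<bullet> DD b y v = 0" if "y \<in> S" for y u v
    using isom[OF that] sym[OF that, of u v]
    by (simp add: a1 b1 that inner_add_left inner_diff_right inner_commute[of "DD \<nu> y u" "DD \<psi> y v"])
  have o2: "DD a y u \<bullet> b y = 0" and o3: "DD b y u \<bullet> a y = 0" if "y \<in> S" for y u
    by (simp_all add: a1 b1 that a_def b_def inner_add_left inner_add_right inner_diff_left inner_diff_right orth'[OF that])
  have t: "?A u w \<bullet> DD b x v = - (DD a x u \<bullet> ?B v w)" for u v w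
    using orthogonal_derivative[OF x smooth_on_DD[OF as] smooth_on_DD[OF bs] o1, of u v w] by simp
  have ts: "?A u w \<bullet> DD b x v = ?A u v \<bullet> DD b x w" for u v w using t[of u w v] t[of u v w] Bs by simp
  \<comment> \<open>\<open>v\<close> is half the sum of \<open>v - z\<close> and
    \<open>v + z\<close>, the first annihilated by \<open>DD a x\<close> and the second by
    \<open>DD b x\<close>. For the first, total symmetry moves it to a slot that
    \<open>DD a x\<close> governs.\<close>
  have tz: "?A u w \<bullet> DD b x v = 0" for u w v
  proof -
    obtain z where z: "DD \<nu> x v = DD \<psi> x z" "DD \<nu> x z = DD \<psi> x v" by (rule shape_vector)
    have za: "DD a x (v - z) = 0" and zb: "DD b x (v + z) = 0"
      using z by (simp_all add: a1 b1 x linear_diff[OF lin[OF \<psi> x]] linear_add[OF lin[OF \<psi> x]]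
          linear_diff[OF lin[OF \<nu> x]] linear_add[OF lin[OF \<nu> x]])
    have "?A u w \<bullet> DD b x (v - z) = ?A (v - z) u \<bullet> DD b x w"
      using ts[of u w "v - z"] As[of u "v - z"] by simp
    also have "\<dots> = 0" using t[of "v - z" u w] za by simp
    finally have "?A u w \<bullet> DD b x (v - z) = 0" .
    moreover have "?A u w \<bullet> DD b x (v + z) = 0" using zb by simp
    ultimately show ?thesis
      by (simp add: linear_diff[OF lin[OF bs x]] linear_add[OF lin[OF bs x]] inner_diff_right inner_add_right)
  qed
  have ab: "?A u w \<bullet> b x = 0" and ba: "?B u w \<bullet> a x = 0" for u w
    using orthogonal_derivative[OF x smooth_on_DD[OF as] bs o2, of u w] o1[OF x, of u w]
      orthogonal_derivative[OF x smooth_on_DD[OF bs] as o3, of u w] o1[OF x, of w u]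
    by (simp_all add: inner_commute)
  have tz': "?B u w \<bullet> DD a x v = 0" for u w v using t[of v w u] tz by (simp add: inner_commute)
  have "R (?A u w) = ?A u w"
  proof -
    have "R (?A u w) \<bullet> y = ?A u w \<bullet> y" for y
    proof -
      obtain z where y: "K x z = y" using K_surj[OF x] .
      \<comment> \<open>Vectors of the form \<open>y - R y\<close> lie in the span of
        \<open>b x\<close> and the image of \<open>DD b x\<close>, to which the second derivative of
        \<open>a\<close> is orthogonal. Hence \<open>R\<close> fixes that second derivative.\<close>
      have "y - R y = DD b x (fst z) + (fst (snd z) - snd (snd z)) *\<^sub>R b x"
        unfolding y[symmetric] R_K by (simp add: K_def H_def b1 x b_def algebra_simps)
      then have "?A u w \<bullet> (y - R y) = 0" by (simp add: inner_add_right tz ab)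
      then show ?thesis using R_sym by (simp add: inner_diff_right)
    qed
    then show ?thesis using vector_eq_rdot by blast
  qed
  moreover have "R (?B u w) = - ?B u w"
  proof -
    have "R (?B u w) \<bullet> y = - ?B u w \<bullet> y" for y
    proof -
      obtain z where y: "K x z = y" using K_surj[OF x] .
      have "y + R y = DD a x (fst z) + (fst (snd z) + snd (snd z)) *\<^sub>R a x"
        unfolding y[symmetric] R_K by (simp add: K_def H_def a1 x a_def algebra_simps)
      then have "?B u w \<bullet> (y + R y) = 0" by (simp add: inner_add_right tz' ba)
      then show ?thesis using R_sym by (simp add: inner_add_right)
    qed
    then show ?thesis using vector_eq_rdot by blast
  qed
  moreover have "?A u w = DD (\<lambda>y. DD \<psi> y u) x w + DD (\<lambda>y. DD \<nu> y u) x w"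
    "?B u w = DD (\<lambda>y. DD \<psi> y u) x w - DD (\<lambda>y. DD \<nu> y u) x w"
  proof -
    have p: "((\<lambda>y. DD \<psi> y u) has_derivative DD (\<lambda>y. DD \<psi> y u) x) (at x)"
      and n: "((\<lambda>y. DD \<nu> y u) has_derivative DD (\<lambda>y. DD \<nu> y u) x) (at x)"
      using smooth_on_has_derivative[OF smooth_on_DD[OF \<psi>] x] smooth_on_has_derivative[OF smooth_on_DD[OF \<nu>] x] by auto
    show "?A u w = DD (\<lambda>y. DD \<psi> y u) x w + DD (\<lambda>y. DD \<nu> y u) x w"
      using DD_cong[OF S x, of "\<lambda>y. DD a y u" "\<lambda>y. DD \<psi> y u + DD \<nu> y u"] a1
        fun_cong[OF DD_eq[OF has_derivative_add[OF p n]], of w] by simp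
    show "?B u w = DD (\<lambda>y. DD \<psi> y u) x w - DD (\<lambda>y. DD \<nu> y u) x w"
      using DD_cong[OF S x, of "\<lambda>y. DD b y u" "\<lambda>y. DD \<psi> y u - DD \<nu> y u"] b1
        fun_cong[OF DD_eq[OF has_derivative_diff[OF p n]], of w] by simp
  qed
  \<comment> \<open>\<open>R\<close> fixes the second derivative of \<open>\<psi> + \<nu>\<close>
    and negates that of \<open>\<psi> - \<nu>\<close>; adding the two equations isolates
    \<open>\<psi>\<close>.\<close>
  ultimately have "R (DD (\<lambda>y. DD \<psi> y u) x w) + R (DD (\<lambda>y. DD \<nu> y u) x w)
      = DD (\<lambda>y. DD \<psi> y u) x w + DD (\<lambda>y. DD \<nu> y u) x w"
    "R (DD (\<lambda>y. DD \<psi> y u) x w) - R (DD (\<lambda>y. DD \<nu> y u) x w)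
      = - (DD (\<lambda>y. DD \<psi> y u) x w - DD (\<lambda>y. DD \<nu> y u) x w)"
    by (simp_all add: R_simps)
  from arg_cong2[OF this, of "(+)"]
  have "2 *\<^sub>R R (DD (\<lambda>y. DD \<psi> y u) x w) = 2 *\<^sub>R DD (\<lambda>y. DD \<nu> y u) x w"
    by (simp add: scaleR_2)
  then show ?thesis by simp
qed

end

text \<open>The reflection at \<open>y\<close> sends \<open>w\<close> to \<open>H y (z y w)\<close>,
  where \<open>z y w\<close> are the frame coordinates of \<open>w\<close>. The derivative of this
  expression is the image under the reflection of the derivative of \<open>K y (z y w) = w\<close>,
  hence 0.\<close>

lemma reflection_locally_constant:
  assumes e: "ball x0 e \<subseteq> S" "e > 0" and R: "reflects \<psi> \<nu> x0 R" and x: "x \<in> ball x0 e"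
  shows "reflects \<psi> \<nu> x R"
proof -
  \<comment> \<open>Frame coordinates exist by surjectivity and are unique by injectivity of
    \<open>K y\<close>; their smooth dependence on \<open>y\<close> comes from the theorem on linear
    systems.\<close>
  define z where "z y w = (SOME z. K y z = w)" for y w
  have z: "K y (z y w) = w" if "y \<in> S" for y w
    unfolding z_def by (rule someI_ex) (metis K_surj[OF that])
  have Ks: "smooth_on (\<lambda>y. K y p) S" and Hs: "smooth_on (\<lambda>y. H y p) S" for p
    unfolding K_def H_def
    by (intro smooth_on_add[OF S] smooth_on_DD \<psi> \<nu> smooth_on_bounded_linear[OF bounded_linear_scaleR_right S])+
  have zs: "smooth_on (\<lambda>y. z y w) S" for w
    by (rule smooth_on_solution[OF S K_linear K_inj Ks smooth_on_const[of w] z])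
  have K': "DD (\<lambda>y. K y p) y h = DD (\<lambda>y. DD \<psi> y (fst p)) y h + fst (snd p) *\<^sub>R DD \<psi> y h + snd (snd p) *\<^sub>R DD \<nu> y h"
    and H': "DD (\<lambda>y. H y p) y h = DD (\<lambda>y. DD \<nu> y (fst p)) y h + fst (snd p) *\<^sub>R DD \<nu> y h + snd (snd p) *\<^sub>R DD \<psi> y h"
    if y: "y \<in> S" for y p h
    unfolding K_def H_def
    by (rule fun_cong[OF DD_eq], intro has_derivative_add has_derivative_scaleR_right
        smooth_on_has_derivative[OF smooth_on_DD[OF \<psi>] y] smooth_on_has_derivative[OF smooth_on_DD[OF \<nu>] y]
        smooth_on_has_derivative[OF \<psi> y] smooth_on_has_derivative[OF \<nu> y])+
  have fam: "((\<lambda>y. L y (z y w)) has_derivative (\<lambda>h. DD (\<lambda>y. L y (z x w)) x h + L x (DD (\<lambda>y. z y w) x h))) (at x)"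
    if x: "x \<in> S" and L: "\<And>y. y \<in> S \<Longrightarrow> linear (L y)" "\<And>p. smooth_on (\<lambda>y. L y p) S"
    for L :: "'m \<Rightarrow> 'm \<times> real \<times> real \<Rightarrow> 'v" and w x
    by (rule has_derivative_linear_family[OF S x L(1) smooth_on_has_derivative[OF L(2) x] smooth_on_has_derivative[OF zs x]])
  have const: "((\<lambda>y. H y (z y w)) has_derivative (\<lambda>h. 0)) (at y)" if y: "y \<in> S" for y w
  proof -
    obtain Q where Q: "reflects \<psi> \<nu> y Q" "\<And>p. Q (K y p) = H y p" using reflection_exists[OF y] by blast
    have Ql: "linear Q" using Q by (simp add: reflects_def)
    \<comment> \<open>The reflection carries the derivative of the frame to the derivative of its
      image. On the tangential entries this is the statement about second derivatives, on the other
      two the definition of \<open>reflects\<close> and the involution property.\<close>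
    have QK': "Q (DD (\<lambda>y. K y p) y h) = DD (\<lambda>y. H y p) y h" for p h
      using Q(1) R_normal_derivative[OF y Q(1)] reflection_second_derivative[OF y Q(1)]
      by (simp add: K' H' y linear_add[OF Ql] linear_scale[OF Ql] reflects_def)
    have "((\<lambda>y. w) has_derivative (\<lambda>h. DD (\<lambda>y'. K y' (z y w)) y h + K y (DD (\<lambda>y. z y w) y h))) (at y)"
      by (rule has_derivative_transform_within_open[OF fam[OF y K_linear Ks] S y]) (assumption | rule z)+
    then have "(\<lambda>h. DD (\<lambda>y'. K y' (z y w)) y h + K y (DD (\<lambda>y. z y w) y h)) = (\<lambda>h. 0)"
      using has_derivative_unique has_derivative_const by blast
    then have "DD (\<lambda>y'. K y' (z y w)) y h + K y (DD (\<lambda>y. z y w) y h) = 0" for h by (rule fun_cong)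
    then have "Q (DD (\<lambda>y'. K y' (z y w)) y h + K y (DD (\<lambda>y. z y w) y h)) = 0" for h
      using linear_0[OF Ql] by simp
    then have "DD (\<lambda>y'. H y' (z y w)) y h + H y (DD (\<lambda>y. z y w) y h) = 0" for h
      by (simp add: linear_add[OF Ql] QK' Q(2))
    then show ?thesis using fam[OF y H_linear Hs, of w] by simp
  qed
  have x0: "x0 \<in> ball x0 e" using e by simp
  then have x0S: "x0 \<in> S" using e by blast
  have xS: "x \<in> S" using x e by blast
  obtain Q where Q: "reflects \<psi> \<nu> x Q" "\<And>p. Q (K x p) = H x p" using reflection_exists[OF xS] by blast
  have "R w = Q w" for w
  proof -
    have d: "((\<lambda>y. H y (z y w)) has_derivative (\<lambda>h. 0)) (at y within ball x0 e)" if "y \<in> ball x0 e" for y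
      using const[of y w] that e has_derivative_at_withinI by blast
    obtain c where c: "\<And>y. y \<in> ball x0 e \<Longrightarrow> H y (z y w) = c"
      using has_derivative_zero_constant[OF convex_ball d] by blast
    have "R w = H x0 (z x0 w)" using R_K[OF x0S R, of "z x0 w"] z[OF x0S, of w] by simp
    also have "\<dots> = H x (z x w)" using c[OF x0] c[OF x] by simp
    also have "\<dots> = Q w" using Q(2)[of "z x w"] z[OF xS, of w] by simp
    finally show ?thesis .
  qed
  then have "R = Q" by (rule ext)
  then show ?thesis using Q by simp
qed

end

section \<open>Orthogonal involutions, their eigenspaces and the associated Clifford tori\<close>

locale reflection =
  fixes R :: "'v::euclidean_space \<Rightarrow> 'v"
  assumes R_linear: "linear R" and R_involution: "R (R v) = v" and R_sym: "R v \<bullet> w = v \<bullet> R w"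
begin

lemmas R_simps = linear_add[OF R_linear] linear_diff[OF R_linear] linear_scale[OF R_linear] R_involution

definition P :: "'v \<Rightarrow> 'v" where "P v = (1/2) *\<^sub>R (v + R v)"
definition Q :: "'v \<Rightarrow> 'v" where "Q v = (1/2) *\<^sub>R (v - R v)"
definition E :: "'v set" where "E = {v. R v = v}"

lemma R_isom: "R v \<bullet> R w = v \<bullet> w"
  by (simp add: R_sym R_involution)

lemma subspace_E: "subspace E"
  by (auto simp: E_def subspace_def R_simps linear_0[OF R_linear])

lemma P_in_E: "P v \<in> E"
  by (simp add: P_def E_def R_simps add.commute)

lemma PQ: "P v + Q v = v"
proof -
  have "P v + Q v = (1/2) *\<^sub>R v + (1/2) *\<^sub>R v" by (simp add: P_def Q_def algebra_simps)
  also have "\<dots> = v" by (simp add: scaleR_left_distrib[symmetric])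
  finally show ?thesis .
qed

lemma comp_E: "E\<^sup>\<bottom> = {v. R v = - v}"
proof (intro equalityI subsetI)
  fix b assume "b \<in> E\<^sup>\<bottom>"
  then have "P b \<bullet> b = 0" using P_in_E[of b] by (auto simp: orthogonal_comp_def orthogonal_def)
  then have "(b + R b) \<bullet> b = 0" by (simp add: P_def)
  then have "(b + R b) \<bullet> (b + R b) = 0"
    by (simp add: inner_add_left inner_add_right R_involution R_sym inner_commute)
  then have "b + R b = 0" by simp
  then show "b \<in> {v. R v = - v}" by (simp add: eq_neg_iff_add_eq_0 add.commute)
next
  fix b assume "b \<in> {v. R v = - v}"
  then have b: "R b = - b" by simp
  have "a \<bullet> b = 0" if "R a = a" for a using R_sym[of a b] that b by simp
  then show "b \<in> E\<^sup>\<bottom>" by (auto simp: orthogonal_comp_def orthogonal_def E_def)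
qed

lemma Q_in_comp: "Q v \<in> E\<^sup>\<bottom>"
  unfolding comp_E by (simp add: Q_def R_simps algebra_simps)

lemma P_Q_eq: assumes "a \<in> E" "b \<in> E\<^sup>\<bottom>" shows "P (s *\<^sub>R a + t *\<^sub>R b) = s *\<^sub>R a" "Q (s *\<^sub>R a + t *\<^sub>R b) = t *\<^sub>R b"
proof -
  have "R a = a" "R b = - b" using assms unfolding comp_E by (simp_all add: E_def)
  then have "P (s *\<^sub>R a + t *\<^sub>R b) = (1/2) *\<^sub>R (s *\<^sub>R a) + (1/2) *\<^sub>R (s *\<^sub>R a)"
    "Q (s *\<^sub>R a + t *\<^sub>R b) = (1/2) *\<^sub>R (t *\<^sub>R b) + (1/2) *\<^sub>R (t *\<^sub>R b)"
    by (simp_all add: P_def Q_def R_simps algebra_simps)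
  then show "P (s *\<^sub>R a + t *\<^sub>R b) = s *\<^sub>R a" "Q (s *\<^sub>R a + t *\<^sub>R b) = t *\<^sub>R b"
    by (simp_all add: scaleR_left_distrib[symmetric] del: scaleR_scaleR)
qed

lemma clifford_torus_iff: "v \<in> clifford_torus E \<longleftrightarrow> norm (P v) = 1 / sqrt 2 \<and> norm (Q v) = 1 / sqrt 2"
proof
  assume "v \<in> clifford_torus E"
  then obtain a b where "v = a + b" "a \<in> E" "norm a = 1 / sqrt 2" "b \<in> E\<^sup>\<bottom>" "norm b = 1 / sqrt 2"
    by (auto simp: clifford_torus_def)
  then show "norm (P v) = 1 / sqrt 2 \<and> norm (Q v) = 1 / sqrt 2" using P_Q_eq[of a b 1 1] by simp
next
  assume "norm (P v) = 1 / sqrt 2 \<and> norm (Q v) = 1 / sqrt 2"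
  then show "v \<in> clifford_torus E"
    unfolding clifford_torus_def using PQ[of v] P_in_E[of v] Q_in_comp[of v]
    by (intro CollectI exI[of _ "P v"] exI[of _ "Q v"]) simp
qed

text \<open>The vectors \<open>v\<close> and \<open>R v\<close> are orthonormal, so
  \<open>v + R v\<close> and \<open>v - R v\<close> both have norm \<open>sqrt 2\<close>.\<close>

lemma norm_PQ:
  assumes "v \<bullet> v = 1" "v \<bullet> R v = 0"
  shows "norm (P v) = 1 / sqrt 2" "norm (Q v) = 1 / sqrt 2"
proof -
  have "P v \<bullet> P v = 1 / 2" "Q v \<bullet> Q v = 1 / 2"
    using assms by (simp_all add: P_def Q_def inner_add_left inner_add_right inner_diff_left inner_diff_right R_isom inner_commute[of "R v"])
  then show "norm (P v) = 1 / sqrt 2" "norm (Q v) = 1 / sqrt 2"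
    unfolding norm_eq_sqrt_inner by (simp_all only: real_sqrt_divide real_sqrt_one)
qed

text \<open>Moving the two components of \<open>\<psi>\<close> radially turns the hypersurface into an open subset of the
  ambient space, so that invariance of domain applies.\<close>

lemma clifford_torus_open_embedding:
  fixes \<psi> :: "'m::euclidean_space \<Rightarrow> 'v"
  assumes U: "open U" and c: "continuous_on U \<psi>" and i: "inj_on \<psi> U"
    and \<psi>: "\<And>x. x \<in> U \<Longrightarrow> \<psi> x \<bullet> \<psi> x = 1" "\<And>x. x \<in> U \<Longrightarrow> \<psi> x \<bullet> R (\<psi> x) = 0"
    and dim: "DIM('v) = DIM('m) + 2"
  shows "openin (top_of_set (clifford_torus E)) (\<psi> ` U)"
    and "\<exists>g. homeomorphism U (\<psi> ` U) \<psi> g"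
proof -
  let ?V = "U \<times> {0::real<..} \<times> {0::real<..}"
  let ?\<Phi> = "\<lambda>z. fst (snd z) *\<^sub>R P (\<psi> (fst z)) + snd (snd z) *\<^sub>R Q (\<psi> (fst z))"
  have nP: "norm (P (\<psi> x)) = 1 / sqrt 2" "norm (Q (\<psi> x)) = 1 / sqrt 2" if "x \<in> U" for x
    using norm_PQ \<psi> that by auto
  have PQ\<Phi>: "P (?\<Phi> z) = fst (snd z) *\<^sub>R P (\<psi> (fst z))" "Q (?\<Phi> z) = snd (snd z) *\<^sub>R Q (\<psi> (fst z))" for z
    by (rule P_Q_eq[OF P_in_E Q_in_comp])+
  have V: "open ?V" using U by (intro open_Times) simp_all
  have blR: "bounded_linear R" using R_linear linear_conv_bounded_linear by blast
  have c1: "continuous_on ?V (\<lambda>z. \<psi> (fst z))"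
    by (rule continuous_on_compose2[OF c continuous_on_fst[OF continuous_on_id]]) auto
  have c2: "continuous_on ?V (\<lambda>z. R (\<psi> (fst z)))" by (rule bounded_linear.continuous_on[OF blR c1])
  have \<Phi>c: "continuous_on ?V ?\<Phi>"
    unfolding P_def Q_def by (intro continuous_intros c1 c2)
  have \<Phi>i: "inj_on ?\<Phi> ?V"
  proof (rule inj_onI)
    fix z z' assume z: "z \<in> ?V" and z': "z' \<in> ?V" and eq: "?\<Phi> z = ?\<Phi> z'"
    have e1: "fst (snd z) *\<^sub>R P (\<psi> (fst z)) = fst (snd z') *\<^sub>R P (\<psi> (fst z'))"
      and e2: "snd (snd z) *\<^sub>R Q (\<psi> (fst z)) = snd (snd z') *\<^sub>R Q (\<psi> (fst z'))"
      using arg_cong[OF eq, of P] arg_cong[OF eq, of Q] unfolding PQ\<Phi> by auto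
    have s: "fst (snd z) = fst (snd z')"
      using arg_cong[OF e1, of norm] z z' nP by (auto simp: mem_Times_iff)
    have t: "snd (snd z) = snd (snd z')"
      using arg_cong[OF e2, of norm] z z' nP by (auto simp: mem_Times_iff)
    have "P (\<psi> (fst z)) = P (\<psi> (fst z'))" "Q (\<psi> (fst z)) = Q (\<psi> (fst z'))"
      using e1 e2 s t z z' by (auto simp: mem_Times_iff)
    then have "\<psi> (fst z) = \<psi> (fst z')" using PQ by metis
    then have "fst z = fst z'" using i z z' by (auto simp: mem_Times_iff inj_on_def)
    then show "z = z'" using s t by (simp add: prod_eq_iff)
  qed
  have dim': "DIM('v) \<le> DIM('m \<times> real \<times> real)" using dim by simp
  have O: "open (?\<Phi> ` ?V)" by (rule invariance_of_domain_gen[OF V \<Phi>c \<Phi>i dim'])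
  have \<Phi>1: "?\<Phi> (x, 1, 1) = \<psi> x" for x using PQ by simp
  \<comment> \<open>In the image of \<open>?\<Phi>\<close> the two scalars are the ratios of the
    component norms to \<open>1 / sqrt 2\<close>; the torus is met exactly where both are 1, which
    gives back \<open>\<psi>\<close>.\<close>
  have eq: "\<psi> ` U = clifford_torus E \<inter> ?\<Phi> ` ?V"
  proof (intro equalityI subsetI)
    fix v assume "v \<in> \<psi> ` U"
    then obtain x where x: "x \<in> U" "v = \<psi> x" by blast
    have "v \<in> ?\<Phi> ` ?V" using \<Phi>1[of x] x by (intro image_eqI[of _ _ "(x, 1, 1)"]) auto
    then show "v \<in> clifford_torus E \<inter> ?\<Phi> ` ?V" using nP[OF x(1)] x by (simp add: clifford_torus_iff)
  next
    fix v assume v: "v \<in> clifford_torus E \<inter> ?\<Phi> ` ?V"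
    then obtain z where z: "z \<in> ?V" "v = ?\<Phi> z" by blast
    have n: "norm (P v) = 1 / sqrt 2" "norm (Q v) = 1 / sqrt 2" using v clifford_torus_iff by auto
    have "fst (snd z) = 1" "snd (snd z) = 1"
      using n z(1) nP unfolding z(2) PQ\<Phi> by (auto simp: mem_Times_iff)
    then have "v = \<psi> (fst z)" using z(2) PQ by simp
    then show "v \<in> \<psi> ` U" using z(1) by auto
  qed
  show "openin (top_of_set (clifford_torus E)) (\<psi> ` U)"
    unfolding eq by (rule openin_open_Int[OF O])
  \<comment> \<open>Since \<open>\<psi> x = ?\<Phi> (x, 1, 1)\<close>, the inverse of
    \<open>\<psi>\<close> is a component of the inverse of \<open>?\<Phi>\<close> and inherits its
    continuity.\<close>
  define g where "g v = fst (inv_into ?V ?\<Phi> v)" for v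
  have gi: "inv_into ?V ?\<Phi> (?\<Phi> z) = z" if "z \<in> ?V" for z using inv_into_f_f[OF \<Phi>i that] .
  have "continuous_on (?\<Phi> ` ?V) (inv_into ?V ?\<Phi>)"
    by (rule continuous_on_inverse_open[OF V \<Phi>c dim' gi])
  moreover have "\<psi> ` U \<subseteq> ?\<Phi> ` ?V" by (subst eq) (rule Int_lower2)
  ultimately have "continuous_on (\<psi> ` U) (inv_into ?V ?\<Phi>)" by (rule continuous_on_subset)
  then have gc: "continuous_on (\<psi> ` U) g" unfolding g_def by (rule continuous_on_fst)
  have g\<psi>: "g (\<psi> x) = x" if "x \<in> U" for x using gi[of "(x, 1, 1)"] \<Phi>1[of x] that by (simp add: g_def)
  have "homeomorphism U (\<psi> ` U) \<psi> g"
    by (rule homeomorphismI[OF c gc]) (auto simp only: g\<psi> image_iff)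
  then show "\<exists>g. homeomorphism U (\<psi> ` U) \<psi> g" by blast
qed

text \<open>If \<open>E\<close> is a line, the torus consists of two parallel small hyperspheres, on
  which \<open>P v\<close> is \<open>a0\<close> or \<open>- a0\<close>; positivity of
  \<open>v \<bullet> a0\<close> selects one. The plane \<open>v \<bullet> a0 = 1 / 2\<close> has
  distance \<open>1 / sqrt 2\<close> from the origin because \<open>a0\<close> has norm
  \<open>1 / sqrt 2\<close>.\<close>

lemma small_hypersphere_open:
  fixes Y :: "'v set"
  assumes dimE: "dim E = 1" and Y: "openin (top_of_set (clifford_torus E)) Y"
    and a0: "a0 \<in> E" "norm a0 = 1 / sqrt 2" and pos: "\<And>v. v \<in> Y \<Longrightarrow> v \<bullet> a0 > 0"
  shows "openin (top_of_set {v \<in> sphere 0 1. v \<bullet> a0 = 1 / 2}) Y"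
proof -
  have aa: "a0 \<bullet> a0 = 1 / 2" using a0(2) by (simp add: dot_square_norm power_divide)
  have "a0 \<noteq> 0" using aa by auto
  then have d1: "dim (span {a0}) = 1" unfolding dim_span by simp
  have "span {a0} \<subseteq> E" using a0(1) subspace_E by (intro span_minimal) auto
  then have E: "E = span {a0}"
    using subspace_dim_equal[OF subspace_span subspace_E, of "{a0}"] dimE d1 by (metis order_refl)
  have P: "P v = (2 * (v \<bullet> a0)) *\<^sub>R a0" for v
  proof -
    obtain k where k: "P v = k *\<^sub>R a0" using P_in_E[of v] unfolding E by (auto simp: span_singleton)
    have "Q v \<bullet> a0 = 0" using Q_in_comp[of v] a0(1) by (auto simp: orthogonal_comp_def orthogonal_def inner_commute)
    then have "v \<bullet> a0 = P v \<bullet> a0" using PQ[of v] inner_add_left[of "P v" "Q v" a0] by simp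
    then show ?thesis using k aa by simp
  qed
  have pyth: "v \<bullet> v = (norm (P v))\<^sup>2 + (norm (Q v))\<^sup>2" for v
  proof -
    have "P v \<bullet> Q v = 0" using Q_in_comp[of v] P_in_E[of v] by (auto simp: orthogonal_comp_def orthogonal_def)
    then have "(P v + Q v) \<bullet> (P v + Q v) = (norm (P v))\<^sup>2 + (norm (Q v))\<^sup>2"
      unfolding power2_norm_eq_inner
      by (simp only: inner_add_left inner_add_right inner_commute[of "Q v" "P v"] add_0_left add_0_right)
    then show ?thesis unfolding PQ .
  qed
  have half: "(1 / sqrt 2)\<^sup>2 = (1 / 2 :: real)" by (simp add: power_divide)
  let ?T = "{v \<in> sphere 0 1. v \<bullet> a0 = 1 / 2}"
  have T: "?T \<subseteq> clifford_torus E"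
  proof
    fix v assume v: "v \<in> ?T"
    then have "2 * (v \<bullet> a0) = 1" by simp
    then have "P v = a0" using P[of v] by (metis scaleR_one)
    then have p: "norm (P v) = 1 / sqrt 2" using a0 by simp
    have "v \<bullet> v = 1" using v by (simp add: dot_square_norm)
    then have "(norm (Q v))\<^sup>2 = (1 / sqrt 2)\<^sup>2" using pyth[of v] half \<open>v \<bullet> v = 1\<close> unfolding p by linarith
    then have "norm (Q v) = 1 / sqrt 2"
      by (rule power2_eq_imp_eq) simp_all
    then show "v \<in> clifford_torus E" using p clifford_torus_iff by simp
  qed
  have "Y \<subseteq> ?T"
  proof
    fix v assume v: "v \<in> Y"
    then have n: "norm (P v) = 1 / sqrt 2" "norm (Q v) = 1 / sqrt 2"
      using openin_imp_subset[OF Y] clifford_torus_iff by auto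
    obtain k where k: "P v = k *\<^sub>R a0" "k = 2 * (v \<bullet> a0)" using P[of v] by blast
    have "k > 0" using k(2) pos[OF v] by simp
    then have "k = 1" using n(1) k(1) a0(2) by simp
    moreover have "v \<bullet> v = 1" using pyth[of v] n half by simp
    then have "norm v = 1" by (simp add: norm_eq_1)
    ultimately show "v \<in> ?T" using k(2) by simp
  qed
  then show ?thesis using openin_subset_trans[OF Y _ T] by blast
qed

end

text \<open>\<open>F\<close> is the reflection that exchanges \<open>a0\<close> with the vector
  \<open>(0, 1 / sqrt 2)\<close>, so \<open>v \<bullet> a0\<close> becomes a multiple of the last
  coordinate of \<open>F v\<close>.\<close>

lemma rotate_small_hypersphere:
  fixes a0 :: "'n::euclidean_space \<times> real"
  assumes a0: "norm a0 = 1 / sqrt 2" and Y: "openin (top_of_set {v \<in> sphere 0 1. v \<bullet> a0 = 1 / 2}) Y"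
  obtains F :: "'n \<times> real \<Rightarrow> 'n \<times> real"
  where "orthogonal_transformation F" "openin (top_of_set small_hypersphere) (F ` Y)"
proof -
  have "norm a0 = norm ((0, 1 / sqrt 2) :: 'n \<times> real)" using a0 by simp
  then obtain F where F: "orthogonal_transformation F" "F a0 = (0, 1 / sqrt 2)" "\<And>v. F (F v) = v"
    using orthogonal_transformation_exists_involution by blast
  have blF: "bounded_linear F" using F(1) orthogonal_transformation_linear linear_conv_bounded_linear by blast
  let ?T = "{v \<in> sphere 0 1. v \<bullet> a0 = 1 / 2}"
  have inner: "F v \<bullet> F w = v \<bullet> w" for v w
    using F(1) unfolding orthogonal_transformation_def by blast
  have snd: "snd (F v) = sqrt 2 * (v \<bullet> a0)" for v
    using inner[of v a0] unfolding F(2) by (simp add: inner_prod_def field_simps)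
  have mem: "F v \<in> small_hypersphere \<longleftrightarrow> v \<in> ?T" for v
  proof -
    have "sqrt 2 * (v \<bullet> a0) = 1 / sqrt 2 \<longleftrightarrow> v \<bullet> a0 = 1 / 2"
      by (simp add: field_simps)
    then show ?thesis
      using orthogonal_transformation_norm[OF F(1), of v] by (simp add: small_hypersphere_def snd)
  qed
  have T: "F ` ?T = small_hypersphere"
  proof (intro equalityI subsetI)
    fix v assume "v \<in> F ` ?T"
    then obtain w where "w \<in> ?T" "v = F w" by blast
    then show "v \<in> small_hypersphere" using mem[of w] by (simp only:)
  next
    fix v :: "'n \<times> real" assume "v \<in> small_hypersphere"
    then have "F v \<in> ?T" using mem[of "F v"] unfolding F(3) by (simp only:)
    then have "F (F v) \<in> F ` ?T" by (rule imageI)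
    then show "v \<in> F ` ?T" unfolding F(3) .
  qed
  obtain Z where Z: "open Z" "Y = ?T \<inter> Z" using Y unfolding openin_open by blast
  have "F ` Y = small_hypersphere \<inter> F -` Z"
  proof -
    have "F ` Y = F ` ?T \<inter> F ` Z" unfolding Z(2) by (rule image_Int[OF orthogonal_transformation_inj[OF F(1)]])
    moreover have "F ` Z = F -` Z"
    proof (intro equalityI subsetI)
      fix v assume "v \<in> F -` Z"
      then have "F (F v) \<in> F ` Z" by blast
      then show "v \<in> F ` Z" unfolding F(3) .
    qed (auto simp: F(3))
    ultimately show ?thesis using T by simp
  qed
  moreover have "open (F -` Z)"
    using continuous_open_vimage[OF Z(1)] linear_continuous_at[OF blF] by blast
  ultimately have "openin (top_of_set small_hypersphere) (F ` Y)" by (simp add: openin_open_Int)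
  then show thesis by (rule that[OF F(1)])
qed

text \<open>The continuous function \<open>s\<close> bounds the operator norm of the change of the
  derivative and vanishes at \<open>a\<close>; together with a left inverse of the derivative at
  \<open>a\<close> this gives injectivity on a small ball.\<close>

lemma smooth_on_locally_injective:
  fixes f :: "'a::euclidean_space \<Rightarrow> 'b::euclidean_space"
  assumes S: "open S" and a: "a \<in> S" and f: "smooth_on f S" and inj: "inj (DD f a)"
  obtains r where "r > 0" "ball a r \<subseteq> S" "inj_on f (ball a r)"
proof -
  have fd: "f differentiable (at x)" if "x \<in> S" for x using smooth_on_differentiable[OF f that] .
  obtain K where K: "linear K" "\<And>u. K (DD f a u) = u"
    using linear_injective_left_inverse[OF DD_linear[OF fd[OF a]]] inj by (auto simp: fun_eq_iff)
  define s where "s x = (\<Sum>b\<in>Basis. norm (DD f x b - DD f a b))" for x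
  have "continuous_on S s"
    unfolding s_def
    by (intro continuous_on_sum continuous_on_norm continuous_on_diff continuous_on_const
        smooth_on_continuous_on[OF smooth_on_DD[OF f]])
  then have "isCont s a" using S a continuous_on_eq_continuous_at[OF S] by blast
  then have sc: "\<exists>d>0. \<forall>x. dist a x < d \<longrightarrow> s x < e" if "e > 0" for e
  proof -
    have "s a = 0" by (simp add: s_def)
    then show ?thesis
      using \<open>isCont s a\<close> that unfolding continuous_at_eps_delta
      by (metis abs_le_D1 diff_zero dist_commute dist_norm dist_real_def le_less_trans less_irrefl not_le real_norm_def)
  qed
  have on: "onorm (\<lambda>v. DD f x v - DD f a v) \<le> s x" if x: "x \<in> S" for x
  proof (rule onorm_bound)
    show "0 \<le> s x" by (simp add: s_def sum_nonneg)
    fix v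
    have l: "linear (\<lambda>v. DD f x v - DD f a v)"
      by (rule linear_compose_sub[OF DD_linear[OF fd[OF x]] DD_linear[OF fd[OF a]]])
    have "norm (DD f x v - DD f a v) = norm (\<Sum>b\<in>Basis. (v \<bullet> b) *\<^sub>R (DD f x b - DD f a b))"
      by (rule arg_cong[OF linear_euclidean_expand[OF l]])
    also have "\<dots> \<le> (\<Sum>b\<in>Basis. norm v * norm (DD f x b - DD f a b))"
      by (rule sum_norm_le) (auto intro!: mult_right_mono Basis_le_norm)
    finally show "norm (DD f x v - DD f a v) \<le> s x * norm v"
      by (simp add: s_def sum_distrib_left mult.commute)
  qed
  obtain d0 where d0: "d0 > 0" "ball a d0 \<subseteq> S" using S a openE by blast
  show thesis
  proof (rule has_derivative_locally_injective[of a S K "DD f" f, OF a S])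
    show "bounded_linear K" using K(1) linear_conv_bounded_linear by blast
    show "K \<circ> DD f a = id" using K(2) by (auto simp: fun_eq_iff)
    show "(f has_derivative DD f x) (at x)" if "x \<in> S" for x by (rule smooth_on_has_derivative[OF f that])
    show "\<exists>d>0. \<forall>x. dist a x < d \<longrightarrow> onorm (\<lambda>v. DD f x v - DD f a v) < e" if "e > 0" for e
    proof -
      obtain d where d: "d > 0" "\<And>x. dist a x < d \<Longrightarrow> s x < e" using sc[OF \<open>e > 0\<close>] by blast
      have "onorm (\<lambda>v. DD f x v - DD f a v) < e" if "dist a x < min d d0" for x
        using on[of x] d(2)[of x] d0(2) that by force
      then show ?thesis using d(1) d0(1) by (intro exI[of _ "min d d0"]) auto
    qed
  qed (rule that)
qed

lemma connected_space_locally_constant: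
  assumes X: "connected_space X"
    and loc: "\<And>p. p \<in> topspace X \<Longrightarrow> \<exists>W. openin X W \<and> p \<in> W \<and> (\<forall>q\<in>W. P q = P p)"
    and p: "p \<in> topspace X" "P p" and q: "q \<in> topspace X"
  shows "P q"
proof (rule ccontr)
  assume nq: "\<not> P q"
  have op: "openin X {r \<in> topspace X. Q (P r)}" for Q
  proof (subst openin_subopen, intro ballI)
    fix r assume r: "r \<in> {r \<in> topspace X. Q (P r)}"
    then have rX: "r \<in> topspace X" by simp
    obtain W where W': "openin X W \<and> r \<in> W \<and> (\<forall>q\<in>W. P q = P r)" using loc[OF rX] ..
    have "W \<subseteq> {r \<in> topspace X. Q (P r)}"
    proof
      fix q assume q: "q \<in> W"
      have "P q = P r" using W'[THEN conjunct2, THEN conjunct2] q by (rule bspec)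
      moreover have "Q (P r)" using r by simp
      ultimately have "Q (P q)" by (simp only:)
      moreover have "q \<in> topspace X" using openin_subset[OF W'[THEN conjunct1]] q by (rule subsetD)
      ultimately show "q \<in> {r \<in> topspace X. Q (P r)}" by (simp only: mem_Collect_eq)
    qed
    with W'[THEN conjunct1] W'[THEN conjunct2, THEN conjunct1]
    show "\<exists>T. openin X T \<and> r \<in> T \<and> T \<subseteq> {r \<in> topspace X. Q (P r)}" by blast
  qed
  have o1: "openin X {r \<in> topspace X. P r}" and o2: "openin X {r \<in> topspace X. \<not> P r}"
    using op[of "\<lambda>b. b"] op[of "\<lambda>b. \<not> b"] by auto
  have "topspace X \<subseteq> {r \<in> topspace X. P r} \<union> {r \<in> topspace X. \<not> P r}"
    "{r \<in> topspace X. P r} \<inter> {r \<in> topspace X. \<not> P r} = {}"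
    "{r \<in> topspace X. P r} \<noteq> {}" "{r \<in> topspace X. \<not> P r} \<noteq> {}"
    using p q nq by auto
  then show False using X o1 o2 unfolding connected_space_def by blast
qed

section \<open>Hypersurfaces in ambient coordinates\<close>

locale space_form_hypersurface =
  fixes M :: "('p, 'm::euclidean_space) riemannian" and \<phi> :: "'p \<Rightarrow> 'n::euclidean_space \<times> real"
    and \<rho> :: real and \<xi> :: "('n \<times> real, 'n) chart \<Rightarrow> 'p \<Rightarrow> 'n"
  assumes hyp: "hypersurface M (space_form \<rho> :: ('n \<times> real, 'n) riemannian) \<phi>"
    and \<xi>: "unit_normal_field M (space_form \<rho> :: ('n \<times> real, 'n) riemannian) \<phi> \<xi>"
begin

abbreviation X :: "('n \<times> real) set" where "X \<equiv> space_form_set \<rho>"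
abbreviation CN :: "('n \<times> real, 'n) chart set" where "CN \<equiv> submanifold_charts X"
abbreviation U :: "('q, 'e) chart \<Rightarrow> 'e set" where "U c \<equiv> snd c ` fst c"

lemma dim: "DIM('n) = DIM('m) + 1" using hyp by (simp add: hypersurface_def)

lemma riem: "riemannian_manifold M" using hyp by (simp add: hypersurface_def)

lemma connected_M: "connected_space (mtop M)" using hyp by (simp add: hypersurface_def)

lemma immersed: "smooth_map M (space_form \<rho> :: ('n \<times> real, 'n) riemannian) \<phi>"
  "preserves_metric M (space_form \<rho> :: ('n \<times> real, 'n) riemannian) \<phi>"
  using hyp by (simp_all add: hypersurface_def isometric_immersion_def)

lemma \<phi>_continuous: "continuous_map (mtop M) (top_of_set X) \<phi>"
  using immersed(1) by (simp add: smooth_map_def space_form_simps)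

lemma \<phi>_in: "p \<in> topspace (mtop M) \<Longrightarrow> \<phi> p \<in> X"
  using continuous_map_image_subset_topspace[OF \<phi>_continuous] by auto

lemma chartD:
  assumes "c \<in> charts M"
  shows "openin (mtop M) (fst c)" "open (U c)"
    "homeomorphic_map (subtopology (mtop M) (fst c)) (top_of_set (U c)) (snd c)"
    "fst c \<subseteq> topspace (mtop M)"
proof -
  show 1: "openin (mtop M) (fst c)" "open (U c)"
    "homeomorphic_map (subtopology (mtop M) (fst c)) (top_of_set (U c)) (snd c)"
    using riem assms by (simp_all add: riemannian_manifold_def smooth_atlas_def)
  show "fst c \<subseteq> topspace (mtop M)" using openin_subset[OF 1(1)] .
qed

lemma topspace_chart: "c \<in> charts M \<Longrightarrow> topspace (subtopology (mtop M) (fst c)) = fst c"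
  using chartD(4)[of c] by (simp add: Int_absorb1)

lemma chart_cover:
  assumes "p \<in> topspace (mtop M)" obtains c where "c \<in> charts M" "p \<in> fst c"
proof -
  have "(\<Union>c\<in>charts M. fst c) = topspace (mtop M)"
    using riem by (simp add: riemannian_manifold_def smooth_atlas_def)
  then show thesis using assms that by blast
qed

lemma chart_inv:
  assumes "c \<in> charts M"
  shows "p \<in> fst c \<Longrightarrow> chart_inv c (snd c p) = p"
    "x \<in> U c \<Longrightarrow> chart_inv c x \<in> fst c" "x \<in> U c \<Longrightarrow> snd c (chart_inv c x) = x"
proof -
  have "inj_on (snd c) (fst c)"
    using homeomorphic_imp_injective_map[OF chartD(3)[OF assms]] topspace_chart[OF assms] by simp
  then show "p \<in> fst c \<Longrightarrow> chart_inv c (snd c p) = p" by (simp add: chart_inv_def)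
  show "x \<in> U c \<Longrightarrow> chart_inv c x \<in> fst c" "x \<in> U c \<Longrightarrow> snd c (chart_inv c x) = x"
    by (simp_all add: chart_inv_def inv_into_into f_inv_into_f)
qed

lemma chart_image_open:
  assumes c: "c \<in> charts M" and W: "openin (mtop M) W"
  shows "open (snd c ` (fst c \<inter> W))"
proof -
  have "openin (subtopology (mtop M) (fst c)) (fst c \<inter> W)"
    using W by (rule openin_subtopology_Int2)
  then have "openin (top_of_set (U c)) (snd c ` (fst c \<inter> W))"
    using homeomorphic_map_openness_eq[OF chartD(3)[OF c]] by blast
  then show ?thesis using openin_open_eq[OF chartD(2)[OF c]] by blast
qed

lemma chart_preimage_open:
  assumes c: "c \<in> charts M" and V: "open V" "V \<subseteq> U c"
  shows "openin (mtop M) (chart_inv c ` V)"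
proof -
  have sub: "chart_inv c ` V \<subseteq> fst c" using chart_inv(2)[OF c] V(2) by blast
  have "snd c ` chart_inv c ` V = V" using chart_inv(3)[OF c] V(2) by force
  then have "openin (top_of_set (U c)) (snd c ` chart_inv c ` V)"
    using V by (simp add: openin_open_eq[OF chartD(2)[OF c]])
  then have "openin (subtopology (mtop M) (fst c)) (chart_inv c ` V)"
    using homeomorphic_map_openness[OF chartD(3)[OF c], of "chart_inv c ` V"] sub
    unfolding topspace_chart[OF c] by blast
  then show ?thesis using openin_open_subtopology[OF chartD(1)[OF c]] by blast
qed

lemma rep_dom_iff:
  assumes "c \<in> charts M" shows "x \<in> rep_dom f c d \<longleftrightarrow> x \<in> U c \<and> f (chart_inv c x) \<in> fst d"
  unfolding rep_dom_def using chart_inv[OF assms] by auto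

lemma preimage_open: "d \<in> CN \<Longrightarrow> openin (mtop M) {p \<in> topspace (mtop M). \<phi> p \<in> fst d}"
  using openin_continuous_map_preimage[OF \<phi>_continuous submanifold_chartD(4)] .

lemma rep_dom_open:
  assumes c: "c \<in> charts M" and d: "d \<in> CN" shows "open (rep_dom \<phi> c d)"
proof -
  have "fst c \<inter> \<phi> -` fst d = fst c \<inter> {p \<in> topspace (mtop M). \<phi> p \<in> fst d}" using chartD(4)[OF c] by auto
  then show ?thesis unfolding rep_dom_def using chart_image_open[OF c preimage_open[OF d]] by simp
qed

lemma transition_open:
  assumes c: "c \<in> charts M" and c': "c' \<in> charts M" shows "open (rep_dom (\<lambda>p. p) c c')"
  unfolding rep_dom_def using chart_image_open[OF c chartD(1)[OF c']] by simp

lemma transition_smooth: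
  "c \<in> charts M \<Longrightarrow> c' \<in> charts M \<Longrightarrow> smooth_on (rep (\<lambda>p. p) c c') (rep_dom (\<lambda>p. p) c c')"
  using riem by (simp add: riemannian_manifold_def smooth_atlas_def)

lemma rep_smooth: "c \<in> charts M \<Longrightarrow> d \<in> CN \<Longrightarrow> smooth_on (rep \<phi> c d) (rep_dom \<phi> c d)"
  using immersed(1) by (simp add: smooth_map_def space_form_simps)

lemma ambient_chart:
  assumes "p \<in> topspace (mtop M)" obtains d where "d \<in> CN" "\<phi> p \<in> fst d"
  using space_form_chart_exists[OF \<phi>_in[OF assms]] .

definition Psi :: "('p, 'm) chart \<Rightarrow> 'm \<Rightarrow> 'n \<times> real" where "Psi c x = \<phi> (chart_inv c x)"

lemma in_topspace: "c \<in> charts M \<Longrightarrow> x \<in> U c \<Longrightarrow> chart_inv c x \<in> topspace (mtop M)"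
  using chart_inv(2) chartD(4) by blast

lemma Psi_in: "c \<in> charts M \<Longrightarrow> x \<in> U c \<Longrightarrow> Psi c x \<in> X"
  unfolding Psi_def by (rule \<phi>_in[OF in_topspace])

lemma rep_in: "c \<in> charts M \<Longrightarrow> x \<in> rep_dom \<phi> c d \<Longrightarrow> rep \<phi> c d x \<in> U d"
  by (simp add: rep_dom_iff rep_def)

lemma Psi_rep: "c \<in> charts M \<Longrightarrow> d \<in> CN \<Longrightarrow> x \<in> rep_dom \<phi> c d \<Longrightarrow> chart_inv d (rep \<phi> c d x) = Psi c x"
  by (simp add: rep_dom_iff rep_def Psi_def submanifold_chartD(6))

lemma rep_cover:
  assumes "c \<in> charts M" "x \<in> U c" obtains d where "d \<in> CN" "x \<in> rep_dom \<phi> c d"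
  using ambient_chart[OF in_topspace[OF assms]] rep_dom_iff[OF assms(1)] assms(2) by metis

lemma Psi_smooth: assumes c: "c \<in> charts M" shows "smooth_on (Psi c) (U c)"
proof (rule smooth_on_local)
  fix x assume x: "x \<in> U c"
  obtain d where d: "d \<in> CN" "x \<in> rep_dom \<phi> c d" by (rule rep_cover[OF c x])
  have "smooth_on (\<lambda>x. chart_inv d (rep \<phi> c d x)) (rep_dom \<phi> c d)"
    using rep_in[OF c] by (intro smooth_on_compose[OF submanifold_chartD(1)[OF d(1)] rep_dom_open[OF c d(1)] _
          submanifold_chartD(3)[OF d(1)] rep_smooth[OF c d(1)]]) blast
  then have "smooth_on (Psi c) (rep_dom \<phi> c d)"
    by (rule smooth_on_cong[OF rep_dom_open[OF c d(1)], rotated]) (rule Psi_rep[OF c d(1)])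
  then show "\<exists>T. open T \<and> x \<in> T \<and> smooth_on (Psi c) T" using rep_dom_open[OF c d(1)] d(2) by blast
qed

lemma DD_Psi:
  assumes c: "c \<in> charts M" and d: "d \<in> CN" and x: "x \<in> rep_dom \<phi> c d"
  shows "DD (Psi c) x u = DD (chart_inv d) (rep \<phi> c d x) (DD (rep \<phi> c d) x u)"
proof -
  have "DD (Psi c) x = DD (\<lambda>x. chart_inv d (rep \<phi> c d x)) x"
    by (rule DD_cong[OF rep_dom_open[OF c d] x]) (simp add: Psi_rep[OF c d])
  then show ?thesis
    using DD_compose[OF smooth_on_differentiable[OF submanifold_chartD(3)[OF d] rep_in[OF c x]]
        smooth_on_differentiable[OF rep_smooth[OF c d] x], of u] by simp
qed

lemma metric_Psi:
  assumes c: "c \<in> charts M" and x: "x \<in> U c"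
  shows "metric_in M c x u v = amb \<rho> (DD (Psi c) x u) (DD (Psi c) x v)"
proof -
  obtain d where d: "d \<in> CN" "x \<in> rep_dom \<phi> c d" by (rule rep_cover[OF c x])
  have "d \<in> charts (space_form \<rho>)" using d(1) by (simp add: space_form_simps)
  then show ?thesis
    using immersed(2) c d(2) unfolding preserves_metric_def
    by (auto simp: space_form_simps DD_Psi[OF c d])
qed

lemma metric_pos:
  assumes "c \<in> charts M" "x \<in> U c" "u \<noteq> 0"
  shows "amb \<rho> (DD (Psi c) x u) (DD (Psi c) x u) > 0"
proof -
  have "local_riemannian_metric (metric_in M c) (U c)"
    using riem assms(1) unfolding riemannian_manifold_def by blast
  then have "metric_in M c x u u > 0"
    using assms(2,3) unfolding local_riemannian_metric_def by blast
  then show ?thesis by (simp only: metric_Psi[OF assms(1,2)])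
qed

text \<open>The unit normal as a vector of the ambient space. The chart is chosen arbitrarily at
  each point; the transformation law of \<open>\<xi>\<close> makes the value independent of that
  choice.\<close>

definition nu :: "'p \<Rightarrow> 'n \<times> real" where
  "nu p = (let d = SOME d. d \<in> CN \<and> \<phi> p \<in> fst d in DD (chart_inv d) (snd d (\<phi> p)) (\<xi> d p))"

lemma \<xi>D:
  assumes "d \<in> CN"
  shows "c \<in> charts M \<Longrightarrow> smooth_on (\<lambda>x. \<xi> d (chart_inv c x)) (rep_dom \<phi> c d)"
    and "p \<in> topspace (mtop M) \<Longrightarrow> d' \<in> CN \<Longrightarrow> \<phi> p \<in> fst d \<Longrightarrow> \<phi> p \<in> fst d' \<Longrightarrow>
      \<xi> d' p = DD (rep (\<lambda>q. q) d d') (snd d (\<phi> p)) (\<xi> d p)"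
    and "p \<in> topspace (mtop M) \<Longrightarrow> \<phi> p \<in> fst d \<Longrightarrow>
      metric_in (space_form \<rho>) d (snd d (\<phi> p)) (\<xi> d p) (\<xi> d p) = 1"
    and "c \<in> charts M \<Longrightarrow> x \<in> rep_dom \<phi> c d \<Longrightarrow>
      metric_in (space_form \<rho>) d (rep \<phi> c d x) (\<xi> d (chart_inv c x)) (DD (rep \<phi> c d) x u) = 0"
proof -
  have d: "d \<in> charts (space_form \<rho>)" using assms by (simp add: space_form_simps)
  note n = \<xi>[unfolded unit_normal_field_def]
  show "c \<in> charts M \<Longrightarrow> smooth_on (\<lambda>x. \<xi> d (chart_inv c x)) (rep_dom \<phi> c d)"
    by (rule bspec[OF bspec[OF n[THEN conjunct1]] d])
  show "p \<in> topspace (mtop M) \<Longrightarrow> d' \<in> CN \<Longrightarrow> \<phi> p \<in> fst d \<Longrightarrow> \<phi> p \<in> fst d' \<Longrightarrow>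
      \<xi> d' p = DD (rep (\<lambda>q. q) d d') (snd d (\<phi> p)) (\<xi> d p)"
    by (rule mp[OF bspec[OF bspec[OF bspec[OF n[THEN conjunct2, THEN conjunct1]] d]]])
       (simp_all add: space_form_simps)
  show "p \<in> topspace (mtop M) \<Longrightarrow> \<phi> p \<in> fst d \<Longrightarrow>
      metric_in (space_form \<rho>) d (snd d (\<phi> p)) (\<xi> d p) (\<xi> d p) = 1"
    by (rule mp[OF bspec[OF bspec[OF n[THEN conjunct2, THEN conjunct2, THEN conjunct1]] d]])
  show "c \<in> charts M \<Longrightarrow> x \<in> rep_dom \<phi> c d \<Longrightarrow>
      metric_in (space_form \<rho>) d (rep \<phi> c d x) (\<xi> d (chart_inv c x)) (DD (rep \<phi> c d) x u) = 0"
    by (rule spec[OF bspec[OF bspec[OF bspec[OF n[THEN conjunct2, THEN conjunct2, THEN conjunct2]] d]]])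
qed

text \<open>The chain rule for a change of ambient chart, with a transition map whose
  differentiability is not part of the definition of a submanifold chart. It is obtained by
  cancelling the immersion \<open>chart_inv d'\<close>.\<close>

lemma ambient_transition_differentiable:
  assumes d: "d \<in> CN" and d': "d' \<in> CN" and q: "q \<in> fst d" "q \<in> fst d'"
  shows "DD (chart_inv d) (snd d q) u = DD (chart_inv d') (snd d' q) (DD (rep (\<lambda>q. q) d d') (snd d q) u)"
proof -
  note D = submanifold_chartD[OF d] and D' = submanifold_chartD[OF d']
  let ?\<tau> = "rep (\<lambda>q. q) d d'" and ?x = "snd d q"
  obtain Z where Z: "open Z" "fst d' = X \<inter> Z" using D'(4) by (auto simp: openin_open)
  define W where "W = U d \<inter> chart_inv d -` Z"
  have W: "open W" unfolding W_def
    by (rule continuous_open_preimage[OF smooth_on_continuous_on[OF D(3)] D(1) Z(1)])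
  have Wd': "chart_inv d x \<in> fst d'" if "x \<in> W" for x
    using that D(7)[of x] D(2) Z by (auto simp: W_def)
  have "chart_inv d ?x \<in> Z" using q D(6)[OF q(1)] Z(2) by simp
  then have xW: "?x \<in> W" using q(1) unfolding W_def by blast
  have \<tau>x: "?\<tau> ?x = snd d' q" using D(6)[OF q(1)] by (simp add: rep_def)
  have \<tau>: "chart_inv d' (?\<tau> x) = chart_inv d x" if "x \<in> W" for x
    using D'(6)[OF Wd'[OF that]] by (simp add: rep_def)
  have "continuous_on W (\<lambda>x. snd d' (chart_inv d x))"
  proof (rule continuous_on_compose2[OF D'(9)])
    show "continuous_on W (chart_inv d)"
      by (rule continuous_on_subset[OF smooth_on_continuous_on[OF D(3)]]) (simp add: W_def)
    show "chart_inv d ` W \<subseteq> fst d'" using Wd' by blast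
  qed
  then have "continuous_on W ?\<tau>" by (simp add: rep_def o_def)
  then have cont: "isCont ?\<tau> ?x" using continuous_on_eq_continuous_at[OF W] xW by blast
  have q': "snd d' q \<in> U d'" using q by blast
  have f1: "chart_inv d' differentiable (at (?\<tau> ?x))" "inj (DD (chart_inv d') (?\<tau> ?x))"
    unfolding \<tau>x using smooth_on_differentiable[OF D'(3) q'] D'(5)[OF q'] by auto
  have g1: "chart_inv d differentiable (at ?x)"
    using smooth_on_differentiable[OF D(3)] q(1) by blast
  have \<tau>d: "?\<tau> differentiable (at ?x)"
    by (rule differentiable_lift[OF f1 g1 cont W xW \<tau>])
  have "DD (chart_inv d) ?x = DD (\<lambda>x. chart_inv d' (?\<tau> x)) ?x"
    by (rule DD_cong[OF W xW]) (simp add: \<tau>)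
  then show ?thesis using DD_compose[OF f1(1) \<tau>d, of u] \<tau>x by simp
qed

lemma nu_eq:
  assumes p: "p \<in> topspace (mtop M)" and d: "d \<in> CN" "\<phi> p \<in> fst d"
  shows "nu p = DD (chart_inv d) (snd d (\<phi> p)) (\<xi> d p)"
proof -
  define d' where "d' = (SOME d. d \<in> CN \<and> \<phi> p \<in> fst d)"
  have d': "d' \<in> CN" "\<phi> p \<in> fst d'"
    using someI[of "\<lambda>d. d \<in> CN \<and> \<phi> p \<in> fst d" d] d by (auto simp: d'_def)
  have "nu p = DD (chart_inv d') (snd d' (\<phi> p)) (\<xi> d' p)" by (simp add: nu_def d'_def[symmetric])
  also have "\<xi> d' p = DD (rep (\<lambda>q. q) d d') (snd d (\<phi> p)) (\<xi> d p)"
    by (rule \<xi>D(2)[OF d(1) p d'(1) d(2) d'(2)])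
  also have "DD (chart_inv d') (snd d' (\<phi> p)) (DD (rep (\<lambda>q. q) d d') (snd d (\<phi> p)) (\<xi> d p))
      = DD (chart_inv d) (snd d (\<phi> p)) (\<xi> d p)"
    by (rule ambient_transition_differentiable[OF d(1) d'(1) d(2) d'(2), symmetric])
  finally show ?thesis .
qed

definition Nu :: "('p, 'm) chart \<Rightarrow> 'm \<Rightarrow> 'n \<times> real" where "Nu c x = nu (chart_inv c x)"

lemma Nu_rep:
  assumes c: "c \<in> charts M" and d: "d \<in> CN" and x: "x \<in> rep_dom \<phi> c d"
  shows "Nu c x = DD (chart_inv d) (rep \<phi> c d x) (\<xi> d (chart_inv c x))"
proof -
  have "x \<in> U c" "\<phi> (chart_inv c x) \<in> fst d" using x unfolding rep_dom_iff[OF c] by blast+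
  then show ?thesis
    using nu_eq[OF in_topspace[OF c] d, of x] by (simp add: Nu_def rep_def)
qed

lemma Nu_smooth: assumes c: "c \<in> charts M" shows "smooth_on (Nu c) (U c)"
proof (rule smooth_on_local)
  fix x assume x: "x \<in> U c"
  obtain d where d: "d \<in> CN" "x \<in> rep_dom \<phi> c d" by (rule rep_cover[OF c x])
  have "smooth_on (\<lambda>x. DD (chart_inv d) (rep \<phi> c d x) (\<xi> d (chart_inv c x))) (rep_dom \<phi> c d)"
    using rep_in[OF c] by (intro smooth_on_DD_compose[OF submanifold_chartD(1)[OF d(1)] rep_dom_open[OF c d(1)] _
          submanifold_chartD(3)[OF d(1)] rep_smooth[OF c d(1)] \<xi>D(1)[OF d(1) c]]) blast
  then have "smooth_on (Nu c) (rep_dom \<phi> c d)"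
    by (rule smooth_on_cong[OF rep_dom_open[OF c d(1)], rotated]) (rule Nu_rep[OF c d(1), symmetric])
  then show "\<exists>T. open T \<and> x \<in> T \<and> smooth_on (Nu c) T" using rep_dom_open[OF c d(1)] d(2) by blast
qed

text \<open>The frame property follows by counting dimensions: tangent space, \<open>Nu c x\<close>
  and the normal \<open>nv x\<close> of the space form are independent, and their number is the
  dimension of the ambient space.\<close>

lemma hypersurface_chart:
  assumes c: "c \<in> charts M"
  shows "hypersurface_chart (U c) (Psi c) (amb \<rho>) (Nu c) \<rho> (0, 1)"
proof -
  interpret B: bounded_bilinear "amb \<rho> :: 'n \<times> real \<Rightarrow> _" by (rule bounded_bilinear_amb)
  define nv where "nv x = (if \<rho> = 0 then (0, 1) else Psi c x)" for x
  have unit: "amb \<rho> (Nu c x) (Nu c x) = 1" and normal: "amb \<rho> (Nu c x) (DD (Psi c) x u) = 0"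
    and Nu_nv: "amb \<rho> (Nu c x) (nv x) = 0" if x: "x \<in> U c" for x u
  proof -
    obtain d where d: "d \<in> CN" "x \<in> rep_dom \<phi> c d" by (rule rep_cover[OF c x])
    have p: "\<phi> (chart_inv c x) \<in> fst d" using d(2) unfolding rep_dom_iff[OF c] by blast
    show "amb \<rho> (Nu c x) (Nu c x) = 1"
      using \<xi>D(3)[OF d(1) in_topspace[OF c x] p] by (simp add: Nu_rep[OF c d] space_form_simps rep_def)
    show "amb \<rho> (Nu c x) (DD (Psi c) x u) = 0"
      using \<xi>D(4)[OF d(1) c d(2)] by (simp add: Nu_rep[OF c d] DD_Psi[OF c d] space_form_simps)
    have "chart_inv d y \<in> X" if "y \<in> U d" for y using submanifold_chartD(2,7)[OF d(1)] that by blast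
    from quadric_derivative[OF submanifold_chartD(1)[OF d(1)] submanifold_chartD(3)[OF d(1)] rep_in[OF c d(2)] this]
    show "amb \<rho> (Nu c x) (nv x) = 0"
      by (simp only: Nu_rep[OF c d] nv_def Psi_rep[OF c d] amb_commute[of \<rho> "DD _ _ _"])
  qed
  have tangent: "amb \<rho> (nv x) (DD (Psi c) x u) = 0" if "x \<in> U c" for x u
    unfolding nv_def by (rule quadric_derivative[OF chartD(2)[OF c] Psi_smooth[OF c] that Psi_in[OF c]])
  have nn: "amb \<rho> (nv x) (nv x) \<noteq> 0" if "x \<in> U c" for x
    unfolding nv_def by (rule amb_normal[OF Psi_in[OF c that]])
  have fr: "r = 0" if x: "x \<in> U c" and r: "\<And>w. amb \<rho> r (DD (Psi c) x w) = 0"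
    "amb \<rho> r (Nu c x) = 0" "amb \<rho> r (nv x) = 0" for x r
  proof -
    have lin: "linear (DD (Psi c) x)"
      by (rule linear_frechet_derivative[OF smooth_on_differentiable[OF Psi_smooth[OF c] x]])
    define K where "K z = DD (Psi c) x (fst z) + fst (snd z) *\<^sub>R Nu c x + snd (snd z) *\<^sub>R nv x"
      for z :: "'m \<times> real \<times> real"
    have Klin: "linear K"
      by (rule linearI) (simp_all add: K_def linear_add[OF lin] linear_scale[OF lin] algebra_simps)
    have "z = 0" if z: "K z = 0" for z
    proof -
      have "amb \<rho> (Nu c x) (K z) = 0" "amb \<rho> (nv x) (K z) = 0" using z B.zero_right by simp_all
      then have s: "fst (snd z) = 0" "snd (snd z) = 0"
        using nn[OF x] tangent[OF x] unit[OF x] normal[OF x] Nu_nv[OF x] amb_commute[of \<rho> "nv x" "Nu c x"]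
        by (simp_all add: K_def B.add_right B.scaleR_right)
      then have "DD (Psi c) x (fst z) = 0" using z by (simp add: K_def)
      then have "\<not> amb \<rho> (DD (Psi c) x (fst z)) (DD (Psi c) x (fst z)) > 0"
        by (simp only: B.zero_left less_irrefl not_False_eq_True)
      then have "fst z = 0" using metric_pos[OF c x, of "fst z"] by blast
      then show ?thesis using s by (simp add: prod_eq_iff)
    qed
    then have "inj K" using Klin by (simp add: linear_injective_0)
    then have "dim (range K) = DIM('m \<times> real \<times> real)" using dim_image_eq[OF Klin, of UNIV] by simp
    also have "\<dots> = DIM('n \<times> real)" using dim by simp
    finally have "range K = UNIV"
      using dim_eq_full[of "range K"] span_linear_image[OF Klin, of UNIV] by simp
    moreover have "amb \<rho> r (K z) = 0" for z using r by (simp add: K_def B.add_right B.scaleR_right)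
    ultimately have "amb \<rho> r w = 0" for w by (metis surjD)
    then show ?thesis by (rule amb_nondegenerate)
  qed
  show ?thesis
  proof (intro hypersurface_chart.intro immersion.intro hypersurface_chart_axioms.intro
      chartD(2)[OF c] Psi_smooth[OF c] Nu_smooth[OF c] bounded_bilinear_amb)
    show "amb \<rho> v w = amb \<rho> w v" for v w :: "'n \<times> real" by (rule amb_commute)
    show "z = 0" if "x \<in> U c" "\<And>w. amb \<rho> (DD (Psi c) x z) (DD (Psi c) x w) = 0" for x z
      using metric_pos[OF c that(1), of z] that(2)[of z] by fastforce
    show "amb \<rho> (Nu c x) (if \<rho> = 0 then (0, 1) else Psi c x) = 0" if "x \<in> U c" for x
      using Nu_nv[OF that] by (simp add: nv_def)
    show "amb \<rho> (if \<rho> = 0 then (0, 1) else Psi c x) (DD (Psi c) x u) = 0" if "x \<in> U c" for x u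
      using tangent[OF that] by (simp add: nv_def)
    show "r = 0" if "x \<in> U c" "\<And>w. amb \<rho> r (DD (Psi c) x w) = 0" "amb \<rho> r (Nu c x) = 0"
      "amb \<rho> r (if \<rho> = 0 then (0, 1) else Psi c x) = 0" for x r
      using fr[OF that(1,2,3)] that(4) by (simp add: nv_def)
    show "amb \<rho> (Psi c x) (Psi c x) = 1 / \<rho>" if "\<rho> \<noteq> 0" "x \<in> U c" for x
      by (rule space_form_quadric[OF Psi_in[OF c that(2)] that(1)])
  qed (use unit normal metric_pos[OF c] in auto)
qed

lemma chart_transfer:
  fixes f :: "'p \<Rightarrow> 'w::euclidean_space"
  assumes c: "c \<in> charts M" and c': "c' \<in> charts M" and p: "p \<in> fst c" "p \<in> fst c'"
    and f: "smooth_on (\<lambda>x. f (chart_inv c x)) (U c)"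
  shows "DD (\<lambda>x. f (chart_inv c' x)) (snd c' p) u
    = DD (\<lambda>x. f (chart_inv c x)) (snd c p) (DD (rep (\<lambda>p. p) c' c) (snd c' p) u)"
proof -
  let ?\<tau> = "rep (\<lambda>p. p) c' c" and ?T = "rep_dom (\<lambda>p. p) c' c"
  have x: "snd c' p \<in> ?T" using p by (auto simp: rep_dom_def)
  have eq: "f (chart_inv c' y) = f (chart_inv c (?\<tau> y))" if "y \<in> ?T" for y
    using that[unfolded rep_dom_iff[OF c']] chart_inv(1)[OF c, of "chart_inv c' y"] by (simp add: rep_def)
  have \<tau>p: "?\<tau> (snd c' p) = snd c p" using chart_inv(1)[OF c' p(2)] by (simp add: rep_def)
  have "DD (\<lambda>x. f (chart_inv c' x)) (snd c' p) = DD (\<lambda>x. f (chart_inv c (?\<tau> x))) (snd c' p)"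
    by (rule DD_cong[OF transition_open[OF c' c] x eq])
  moreover have "(\<lambda>x. f (chart_inv c x)) differentiable (at (?\<tau> (snd c' p)))"
    unfolding \<tau>p using smooth_on_differentiable[OF f] p(1) by blast
  ultimately show ?thesis
    using DD_compose[OF _ smooth_on_differentiable[OF transition_smooth[OF c' c] x], of "\<lambda>x. f (chart_inv c x)" u] \<tau>p
    by simp
qed

lemma Psi_transfer:
  assumes "c \<in> charts M" "c' \<in> charts M" "p \<in> fst c" "p \<in> fst c'"
  shows "DD (Psi c') (snd c' p) u = DD (Psi c) (snd c p) (DD (rep (\<lambda>p. p) c' c) (snd c' p) u)"
  using chart_transfer[OF assms, of \<phi> u] Psi_smooth[OF assms(1)] by (simp add: Psi_def[abs_def])

lemma Nu_transfer:
  assumes "c \<in> charts M" "c' \<in> charts M" "p \<in> fst c" "p \<in> fst c'"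
  shows "DD (Nu c') (snd c' p) u = DD (Nu c) (snd c p) (DD (rep (\<lambda>p. p) c' c) (snd c' p) u)"
  using chart_transfer[OF assms, of nu u] Nu_smooth[OF assms(1)] by (simp add: Nu_def[abs_def])

end

section \<open>Geodesics of the hypersurface described in the ambient space\<close>

lemma acceleration_cong:
  assumes "open J" "t \<in> J" "\<And>s. s \<in> J \<Longrightarrow> f s = g s"
  shows "velocity (velocity f) t = velocity (velocity g) t"
  by (rule velocity_cong[OF assms(1,2)]) (rule velocity_cong[OF assms(1) _ assms(3)])

lemma nabla_along_cong:
  assumes "open J" "t \<in> J" "\<And>s. s \<in> J \<Longrightarrow> a s = b s"
  shows "nabla_along g a (velocity a) t = nabla_along g b (velocity b) t"
  using acceleration_cong[OF assms] velocity_cong[OF assms] assms(3)[OF assms(2)]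
  by (simp add: nabla_along_def velocity_def[of "velocity _"])

lemma biharmonic_ambient_at_cong:
  assumes J: "open J" and t: "t \<in> J" and e: "\<And>s. s \<in> J \<Longrightarrow> \<eta> s = \<eta>' s"
  shows "biharmonic_ambient_at B \<rho> \<eta> t = biharmonic_ambient_at B \<rho> \<eta>' t"
proof -
  have c: "cov B \<rho> \<eta> Y s = cov B \<rho> \<eta>' Z s" if "s \<in> J" "\<And>s. s \<in> J \<Longrightarrow> Y s = Z s" for Y Z s
    using velocity_cong[OF J that] velocity_cong[OF J that(1) e] e[OF that(1)] that(2)[OF that(1)]
    by (simp add: cov_def)
  have x: "velocity (velocity \<eta>) s + \<rho> *\<^sub>R \<eta> s = velocity (velocity \<eta>') s + \<rho> *\<^sub>R \<eta>' s" if "s \<in> J" for s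
    using acceleration_cong[OF J that e] e[OF that] by simp
  have "cov B \<rho> \<eta> (cov B \<rho> \<eta> (\<lambda>s. velocity (velocity \<eta>) s + \<rho> *\<^sub>R \<eta> s)) t
      = cov B \<rho> \<eta>' (cov B \<rho> \<eta>' (\<lambda>s. velocity (velocity \<eta>') s + \<rho> *\<^sub>R \<eta>' s)) t"
    by (rule c[OF t]) (rule c[OF _ x])
  then show ?thesis unfolding biharmonic_ambient_at_def using x[OF t] by simp
qed

context space_form_hypersurface
begin

abbreviation B :: "'n \<times> real \<Rightarrow> 'n \<times> real \<Rightarrow> real" where "B \<equiv> amb \<rho>"

lemma curve_preimage_open:
  assumes "smooth_curve M I \<gamma>" "openin (mtop M) W" shows "open (I \<inter> \<gamma> -` W)"
proof -
  have I: "open I" and \<gamma>: "continuous_map (top_of_set I) (mtop M) \<gamma>"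
    using assms(1) by (simp_all add: smooth_curve_def)
  have "openin (top_of_set I) {t \<in> topspace (top_of_set I). \<gamma> t \<in> W}"
    by (rule openin_continuous_map_preimage[OF \<gamma> assms(2)])
  moreover have "{t \<in> topspace (top_of_set I). \<gamma> t \<in> W} = I \<inter> \<gamma> -` W" by auto
  ultimately show ?thesis using openin_open_eq[OF I] by simp
qed

lemma curve_in_topspace: "smooth_curve M I \<gamma> \<Longrightarrow> t \<in> I \<Longrightarrow> \<gamma> t \<in> topspace (mtop M)"
  using continuous_map_image_subset_topspace[of "top_of_set I" "mtop M" \<gamma>] by (auto simp: smooth_curve_def)

lemma metric_ind:
  assumes "c \<in> charts M" "x \<in> U c"
  shows "metric_in M c x = immersion.ind (Psi c) B x"
proof -
  interpret H: hypersurface_chart "U c" "Psi c" B "Nu c" \<rho> "(0, 1)" by (rule hypersurface_chart[OF assms(1)])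
  show ?thesis by (intro ext) (simp add: metric_Psi[OF assms] H.ind_def)
qed

context
  fixes I :: "real set" and \<gamma> :: "real \<Rightarrow> 'p" and c :: "('p, 'm) chart"
  assumes \<gamma>: "smooth_curve M I \<gamma>" and c: "c \<in> charts M"
begin

lemma curve_chart:
  "open (I \<inter> \<gamma> -` fst c)" "smooth_on (\<lambda>s. snd c (\<gamma> s)) (I \<inter> \<gamma> -` fst c)"
  "(\<lambda>s. snd c (\<gamma> s)) ` (I \<inter> \<gamma> -` fst c) \<subseteq> U c"
proof -
  show "smooth_on (\<lambda>s. snd c (\<gamma> s)) (I \<inter> \<gamma> -` fst c)"
    using \<gamma> c by (simp add: smooth_curve_def o_def)
qed (use curve_preimage_open[OF \<gamma> chartD(1)[OF c]] in auto)

lemma curve_Psi: "s \<in> I \<inter> \<gamma> -` fst c \<Longrightarrow> \<phi> (\<gamma> s) = Psi c (snd c (\<gamma> s))"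
  by (simp add: Psi_def chart_inv(1)[OF c])

lemma curve_velocity:
  assumes t: "t \<in> I \<inter> \<gamma> -` fst c"
  shows "velocity (\<lambda>s. \<phi> (\<gamma> s)) t = DD (Psi c) (snd c (\<gamma> t)) (velocity (\<lambda>s. snd c (\<gamma> s)) t)"
proof -
  interpret H: hypersurface_chart "U c" "Psi c" B "Nu c" \<rho> "(0, 1)" by (rule hypersurface_chart[OF c])
  show ?thesis
    using velocity_cong[OF curve_chart(1) t curve_Psi]
      H.velocity_lift[OF curve_chart metric_ind[OF c] t] by simp
qed

text \<open>The ambient acceleration does not depend on a chart of \<open>M\<close>, nor does the
  image of the tangent space; this makes the geodesic equation chart-independent.\<close>

lemma curve_geodesic_iff:
  assumes t: "t \<in> I \<inter> \<gamma> -` fst c"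
  shows "nabla_along (metric_in M c) (\<lambda>s. snd c (\<gamma> s)) (velocity (\<lambda>s. snd c (\<gamma> s))) t = 0 \<longleftrightarrow>
    (\<forall>w. B (velocity (velocity (\<lambda>s. \<phi> (\<gamma> s))) t) (DD (Psi c) (snd c (\<gamma> t)) w) = 0)"
proof -
  interpret H: hypersurface_chart "U c" "Psi c" B "Nu c" \<rho> "(0, 1)" by (rule hypersurface_chart[OF c])
  have x: "snd c (\<gamma> t) \<in> U c" using t by auto
  let ?z = "nabla_along (metric_in M c) (\<lambda>s. snd c (\<gamma> s)) (velocity (\<lambda>s. snd c (\<gamma> s))) t"
  have "B (velocity (velocity (\<lambda>s. \<phi> (\<gamma> s))) t) (DD (Psi c) (snd c (\<gamma> t)) w)
      = B (DD (Psi c) (snd c (\<gamma> t)) ?z) (DD (Psi c) (snd c (\<gamma> t)) w)" for w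
    using acceleration_cong[OF curve_chart(1) t curve_Psi]
      H.acceleration_tangential[OF curve_chart metric_ind[OF c] t, of w] by simp
  moreover have "?z = 0" if "\<And>w. B (DD (Psi c) (snd c (\<gamma> t)) ?z) (DD (Psi c) (snd c (\<gamma> t)) w) = 0"
    using H.nondeg[OF x that] .
  moreover have "DD (Psi c) (snd c (\<gamma> t)) 0 = 0" using linear_0[OF H.d1_linear[OF x]] .
  ultimately show ?thesis using H.B.zero_left by metis
qed

end

text \<open>The definition demands the geodesic equation in every chart around each point, whereas a
  curve built by the ODE satisfies it in one. The criterion by ambient acceleration bridges the
  gap.\<close>

lemma geodesicI:
  assumes \<gamma>: "smooth_curve M I \<gamma>"
    and geo: "\<And>t. t \<in> I \<Longrightarrow> \<exists>c\<in>charts M. \<gamma> t \<in> fst c \<and>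
      nabla_along (metric_in M c) (\<lambda>s. snd c (\<gamma> s)) (velocity (\<lambda>s. snd c (\<gamma> s))) t = 0"
  shows "geodesic M I \<gamma>"
  unfolding geodesic_def
proof (intro conjI \<gamma> ballI impI)
  fix t c' assume t: "t \<in> I" and c': "c' \<in> charts M" "\<gamma> t \<in> fst c'"
  obtain c where c: "c \<in> charts M" "\<gamma> t \<in> fst c"
    and z: "nabla_along (metric_in M c) (\<lambda>s. snd c (\<gamma> s)) (velocity (\<lambda>s. snd c (\<gamma> s))) t = 0"
    using geo[OF t] by blast
  have tc: "t \<in> I \<inter> \<gamma> -` fst c" and tc': "t \<in> I \<inter> \<gamma> -` fst c'" using t c c' by auto
  have "B (velocity (velocity (\<lambda>s. \<phi> (\<gamma> s))) t) (DD (Psi c') (snd c' (\<gamma> t)) w) = 0" for w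
    using z curve_geodesic_iff[OF \<gamma> c(1) tc] Psi_transfer[OF c(1) c'(1) c(2) c'(2)] by simp
  then show "nabla_along (metric_in M c') (snd c' \<circ> \<gamma>) (velocity (snd c' \<circ> \<gamma>)) t = 0"
    using curve_geodesic_iff[OF \<gamma> c'(1) tc'] by (simp add: o_def)
qed

lemma unit_speedI:
  assumes \<gamma>: "smooth_curve M I \<gamma>"
    and unit: "\<And>t. t \<in> I \<Longrightarrow> B (velocity (\<lambda>s. \<phi> (\<gamma> s)) t) (velocity (\<lambda>s. \<phi> (\<gamma> s)) t) = 1"
  shows "unit_speed M I \<gamma>"
  unfolding unit_speed_def
proof (intro ballI impI)
  fix t c assume t: "t \<in> I" and c: "c \<in> charts M" "\<gamma> t \<in> fst c"
  have "t \<in> I \<inter> \<gamma> -` fst c" using t c by auto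
  from curve_velocity[OF \<gamma> c(1) this] unit[OF t]
  show "metric_in M c (snd c (\<gamma> t)) (velocity (snd c \<circ> \<gamma>) t) (velocity (snd c \<circ> \<gamma>) t) = 1"
    using c by (simp add: metric_Psi o_def)
qed

lemma chart_curve:
  assumes c: "c \<in> charts M" and I: "open I" "is_interval I" and a: "smooth_on a I" "a ` I \<subseteq> U c"
  shows "smooth_curve M I (\<lambda>s. chart_inv c (a s))"
  unfolding smooth_curve_def
proof (intro conjI I ballI)
  have op: "open (I \<inter> a -` V)" if "open V" for V
    using continuous_open_preimage[OF smooth_on_continuous_on[OF a(1)] I(1) that] .
  show "continuous_map (top_of_set I) (mtop M) (\<lambda>s. chart_inv c (a s))"
    unfolding continuous_map_def
  proof (intro conjI allI impI)
    show "(\<lambda>s. chart_inv c (a s)) \<in> topspace (top_of_set I) \<rightarrow> topspace (mtop M)"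
      using in_topspace[OF c] a(2) by auto
    fix W assume W: "openin (mtop M) W"
    have "{t \<in> topspace (top_of_set I). chart_inv c (a t) \<in> W} = I \<inter> a -` (snd c ` (fst c \<inter> W))"
    proof (intro equalityI subsetI)
      fix t assume t: "t \<in> {t \<in> topspace (top_of_set I). chart_inv c (a t) \<in> W}"
      then have "a t \<in> U c" using a(2) by auto
      then have "chart_inv c (a t) \<in> fst c \<inter> W" "a t = snd c (chart_inv c (a t))"
        using t chart_inv[OF c] by auto
      then have "a t \<in> snd c ` (fst c \<inter> W)" by (metis image_eqI)
      then show "t \<in> I \<inter> a -` (snd c ` (fst c \<inter> W))" using t by simp
    next
      fix t assume "t \<in> I \<inter> a -` (snd c ` (fst c \<inter> W))"
      then show "t \<in> {t \<in> topspace (top_of_set I). chart_inv c (a t) \<in> W}" using chart_inv(1)[OF c] by auto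
    qed
    then show "openin (top_of_set I) {t \<in> topspace (top_of_set I). chart_inv c (a t) \<in> W}"
      using op[OF chart_image_open[OF c W]] by (simp add: openin_open_eq[OF I(1)])
  qed
  fix c' assume c': "c' \<in> charts M"
  let ?J = "I \<inter> a -` rep_dom (\<lambda>p. p) c c'"
  have J: "I \<inter> (\<lambda>s. chart_inv c (a s)) -` fst c' = ?J"
    unfolding set_eq_iff Int_iff vimage_eq rep_dom_iff[OF c] using a(2) by blast
  have "smooth_on (\<lambda>s. rep (\<lambda>p. p) c c' (a s)) ?J"
    by (rule smooth_on_compose[OF transition_open[OF c c'] op[OF transition_open[OF c c']] _ transition_smooth[OF c c']
          smooth_on_subset[OF a(1)]]) auto
  then show "smooth_on (snd c' \<circ> (\<lambda>s. chart_inv c (a s))) (I \<inter> (\<lambda>s. chart_inv c (a s)) -` fst c')"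
    unfolding J by (simp add: rep_def o_def)
qed

context
  assumes bih: "totally_biharmonic M (space_form \<rho> :: ('n \<times> real, 'n) riemannian) \<phi>"
begin

text \<open>The biharmonic equation is read in one ambient chart around the point and translated
  there; the resulting ambient equation mentions no chart.\<close>

lemma geodesic_biharmonic_ambient:
  assumes geo: "geodesic M I \<gamma>" and unit: "unit_speed M I \<gamma>" and t: "t \<in> I"
  shows "biharmonic_ambient_at B \<rho> (\<lambda>s. \<phi> (\<gamma> s)) t"
proof -
  let ?\<eta> = "\<phi> \<circ> \<gamma>"
  have bc: "biharmonic_curve (space_form \<rho> :: ('n \<times> real, 'n) riemannian) I ?\<eta>"
    using bih geo unit by (simp add: totally_biharmonic_def)
  have \<gamma>: "smooth_curve M I \<gamma>" using geo by (simp add: geodesic_def)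
  obtain d where d: "d \<in> CN" "\<phi> (\<gamma> t) \<in> fst d" by (rule ambient_chart[OF curve_in_topspace[OF \<gamma> t]])
  have dN: "d \<in> charts (space_form \<rho>)" using d(1) by (simp add: space_form_simps)
  interpret D: space_form_chart "U d" "chart_inv d" B \<rho> "(0, 1)"
    by (rule space_form_chart_submanifold[OF d(1)])
  let ?J = "I \<inter> ?\<eta> -` fst d" and ?a = "snd d \<circ> ?\<eta>"
  have "?J = I \<inter> \<gamma> -` {p \<in> topspace (mtop M). \<phi> p \<in> fst d}" using curve_in_topspace[OF \<gamma>] by auto
  then have J: "open ?J" using curve_preimage_open[OF \<gamma> preimage_open[OF d(1)]] by simp
  have tJ: "t \<in> ?J" using t d(2) by simp
  have a: "smooth_on ?a ?J" "?a ` ?J \<subseteq> U d"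
    using bc dN by (auto simp: biharmonic_curve_def smooth_curve_def)
  have G: "metric_in (space_form \<rho>) d x = D.ind x" for x
    by (intro ext) (simp add: space_form_simps D.ind_def)
  have unitN: "D.ind (?a s) (velocity ?a s) (velocity ?a s) = 1" if "s \<in> ?J" for s
  proof -
    have "unit_speed (space_form \<rho>) I ?\<eta>" using bc by (simp add: biharmonic_curve_def)
    then have "metric_in (space_form \<rho>) d (snd d (?\<eta> s)) (velocity ?a s) (velocity ?a s) = 1"
      unfolding unit_speed_def using dN that by blast
    then show ?thesis by (simp add: G)
  qed
  have eq: "(nabla_along (metric_in (space_form \<rho>) d) ?a ^^ 3) (velocity ?a) t
      + curvature_tensor (metric_in (space_form \<rho>) d) (?a t)
        (nabla_along (metric_in (space_form \<rho>) d) ?a (velocity ?a) t) (velocity ?a t) (velocity ?a t) = 0"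
    using bc dN tJ by (simp add: biharmonic_curve_def Let_def)
  have "biharmonic_ambient_at B \<rho> (\<lambda>s. chart_inv d (?a s)) t"
    by (rule D.biharmonic_ambient[OF G J a tJ unitN eq])
  moreover have "chart_inv d (?a s) = \<phi> (\<gamma> s)" if "s \<in> ?J" for s
    using that submanifold_chartD(6)[OF d(1)] by simp
  ultimately show ?thesis using biharmonic_ambient_at_cong[OF J tJ, of "\<lambda>s. chart_inv d (?a s)" "\<lambda>s. \<phi> (\<gamma> s)"] by blast
qed

text \<open>For every unit vector \<open>u\<close> at \<open>x\<close> there is a unit-speed
  geodesic with initial velocity \<open>u\<close>; the alternative along it is evaluated at time
  0.\<close>

lemma shape_alternative_at:
  assumes c: "c \<in> charts M" and x: "x \<in> U c"
  shows "(\<forall>u. DD (Nu c) x u = 0) \<or>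
    (\<forall>u v. B (DD (Nu c) x u) (DD (Nu c) x v) = \<rho> * B (DD (Psi c) x u) (DD (Psi c) x v))"
proof -
  interpret H: hypersurface_chart "U c" "Psi c" B "Nu c" \<rho> "(0, 1)" by (rule hypersurface_chart[OF c])
  show ?thesis
  proof (rule H.shape_alternative[OF x])
    fix u assume u: "B (DD (Psi c) x u) (DD (Psi c) x u) = 1"
    obtain \<delta> a where \<delta>: "\<delta> > 0" and a0: "a 0 = x" "velocity a 0 = u" and a: "smooth_on a {-\<delta><..<\<delta>}"
      "a ` {-\<delta><..<\<delta>} \<subseteq> U c"
      and geo: "\<And>t. t \<in> {-\<delta><..<\<delta>} \<Longrightarrow> nabla_along (metric_in M c) a (velocity a) t = 0"
      and unit: "\<And>t. t \<in> {-\<delta><..<\<delta>} \<Longrightarrow> H.ind (a t) (velocity a t) (velocity a t) = 1"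
      using H.unit_speed_geodesic_exists[of "metric_in M c", OF metric_ind[OF c] x, of u] u
      unfolding H.ind_def by blast
    let ?I = "{-\<delta><..<\<delta>}" and ?\<gamma> = "\<lambda>s. chart_inv c (a s)"
    have I: "open ?I" "is_interval ?I" by (auto simp: is_interval_1)
    have \<gamma>: "smooth_curve M ?I ?\<gamma>" by (rule chart_curve[OF c I a])
    have aU: "a s \<in> U c" if "s \<in> ?I" for s using a(2) that by blast
    have ac: "snd c (?\<gamma> s) = a s" if "s \<in> ?I" for s using chart_inv(3)[OF c aU[OF that]] .
    have g: "geodesic M ?I ?\<gamma>"
    proof (rule geodesicI[OF \<gamma>])
      fix t assume t: "t \<in> ?I"
      show "\<exists>c\<in>charts M. ?\<gamma> t \<in> fst c \<and>
        nabla_along (metric_in M c) (\<lambda>s. snd c (?\<gamma> s)) (velocity (\<lambda>s. snd c (?\<gamma> s))) t = 0"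
        using c chart_inv(2)[OF c aU[OF t]] nabla_along_cong[OF I(1) t ac, where g = "metric_in M c"] geo[OF t]
        by (intro bexI[of _ c] conjI) simp_all
    qed
    have \<eta>: "velocity (\<lambda>s. \<phi> (?\<gamma> s)) t = DD (Psi c) (a t) (velocity a t)" if "t \<in> ?I" for t
      using H.velocity_lift[OF I(1) a metric_ind[OF c] that] by (simp add: Psi_def)
    have us: "unit_speed M ?I ?\<gamma>"
      by (rule unit_speedI[OF \<gamma>]) (use unit \<eta> in \<open>simp add: H.ind_def\<close>)
    have b: "biharmonic_ambient_at B \<rho> (\<lambda>s. Psi c (a s)) t" if "t \<in> ?I" for t
      using geodesic_biharmonic_ambient[OF g us that] by (simp add: Psi_def)
    have "0 \<in> ?I" using \<delta> by simp
    from H.biharmonic_alternative[OF I(1) a metric_ind[OF c] this geo unit b]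
    show "B (DD (Nu c) x u) (DD (Psi c) x u) = 0 \<or> B (DD (Nu c) x u) (DD (Nu c) x u) = \<rho>"
      by (simp add: a0)
  qed
qed

end

text \<open>With \<open>DD (Nu c)\<close> zero the normal component of the acceleration vanishes,
  and what remains of the formula says that the covariant acceleration in the space form is
  0.\<close>

lemma totally_geodesic:
  assumes flat: "\<And>c x u. c \<in> charts M \<Longrightarrow> x \<in> U c \<Longrightarrow> DD (Nu c) x u = 0"
    and geo: "geodesic M I \<gamma>"
  shows "geodesic (space_form \<rho> :: ('n \<times> real, 'n) riemannian) I (\<phi> \<circ> \<gamma>)"
proof -
  have \<gamma>: "smooth_curve M I \<gamma>" using geo by (simp add: geodesic_def)
  have I: "open I" "is_interval I" and \<gamma>c: "continuous_map (top_of_set I) (mtop M) \<gamma>"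
    using \<gamma> by (simp_all add: smooth_curve_def)
  have op: "open (I \<inter> (\<phi> \<circ> \<gamma>) -` fst d)" if "d \<in> CN" for d
  proof -
    have "I \<inter> (\<phi> \<circ> \<gamma>) -` fst d = I \<inter> \<gamma> -` {p \<in> topspace (mtop M). \<phi> p \<in> fst d}"
      using curve_in_topspace[OF \<gamma>] by auto
    then show ?thesis using curve_preimage_open[OF \<gamma> preimage_open[OF that]] by simp
  qed
  have sm: "smooth_on (snd d \<circ> (\<phi> \<circ> \<gamma>)) (I \<inter> (\<phi> \<circ> \<gamma>) -` fst d)" if d: "d \<in> CN" for d
  proof (rule smooth_on_local)
    fix t assume t: "t \<in> I \<inter> (\<phi> \<circ> \<gamma>) -` fst d"
    then have tI: "t \<in> I" by simp
    obtain c where c: "c \<in> charts M" "\<gamma> t \<in> fst c" by (rule chart_cover[OF curve_in_topspace[OF \<gamma> tI]])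
    let ?T = "(I \<inter> \<gamma> -` fst c) \<inter> (I \<inter> (\<phi> \<circ> \<gamma>) -` fst d)"
    have T: "open ?T" by (intro open_Int curve_chart(1)[OF \<gamma> c(1)] op[OF d])
    have im: "(\<lambda>s. snd c (\<gamma> s)) ` ?T \<subseteq> rep_dom \<phi> c d" by (auto simp: rep_dom_def)
    have "smooth_on (\<lambda>s. rep \<phi> c d (snd c (\<gamma> s))) ?T"
      by (rule smooth_on_compose[OF rep_dom_open[OF c(1) d] T im rep_smooth[OF c(1) d]
            smooth_on_subset[OF curve_chart(2)[OF \<gamma> c(1)]]]) (rule Int_lower1)
    then have "smooth_on (snd d \<circ> (\<phi> \<circ> \<gamma>)) ?T"
      by (rule smooth_on_cong[OF T, rotated]) (simp add: rep_def chart_inv(1)[OF c(1)])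
    then show "\<exists>T. open T \<and> t \<in> T \<and> smooth_on (snd d \<circ> (\<phi> \<circ> \<gamma>)) T" using T t c(2) by blast
  qed
  have "continuous_map (top_of_set I) (top_of_set X) (\<phi> \<circ> \<gamma>)"
    by (rule continuous_map_compose[OF \<gamma>c \<phi>_continuous])
  then have curve: "smooth_curve (space_form \<rho> :: ('n \<times> real, 'n) riemannian) I (\<phi> \<circ> \<gamma>)"
    unfolding smooth_curve_def space_form_simps using I sm by blast
  show ?thesis
    unfolding geodesic_def
  proof (intro conjI curve ballI impI)
    fix t d assume t: "t \<in> I" and d': "d \<in> charts (space_form \<rho> :: ('n \<times> real, 'n) riemannian)" "(\<phi> \<circ> \<gamma>) t \<in> fst d"
    then have d: "d \<in> CN" by (simp add: space_form_simps)
    interpret D: space_form_chart "U d" "chart_inv d" B \<rho> "(0, 1)"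
      by (rule space_form_chart_submanifold[OF d])
    obtain c where c: "c \<in> charts M" "\<gamma> t \<in> fst c" by (rule chart_cover[OF curve_in_topspace[OF \<gamma> t]])
    interpret H: hypersurface_chart "U c" "Psi c" B "Nu c" \<rho> "(0, 1)" by (rule hypersurface_chart[OF c(1)])
    let ?J = "I \<inter> (\<phi> \<circ> \<gamma>) -` fst d" and ?a = "snd d \<circ> (\<phi> \<circ> \<gamma>)"
    let ?\<eta> = "\<lambda>s. \<phi> (\<gamma> s)"
    have tJ: "t \<in> ?J" and tc: "t \<in> I \<inter> \<gamma> -` fst c" using t d'(2) c(2) by auto
    have xc: "snd c (\<gamma> t) \<in> U c" using c(2) by blast
    have at: "?a t \<in> U d" using d'(2) by auto
    have J: "open ?J" by (rule op[OF d])
    have a: "smooth_on ?a ?J" by (rule sm[OF d])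
    have G: "metric_in (space_form \<rho>) d x = D.ind x" for x
      by (intro ext) (simp add: space_form_simps D.ind_def)
    have e: "chart_inv d (?a s) = ?\<eta> s" if "s \<in> ?J" for s
      using that submanifold_chartD(6)[OF d] by simp
    have aS: "?a s \<in> U d" if "s \<in> ?J" for s using that by auto
    have v: "DD (chart_inv d) (?a s) (velocity ?a s) = velocity ?\<eta> s" if "s \<in> ?J" for s
    proof -
      have "velocity (\<lambda>s. chart_inv d (?a s)) s = DD (chart_inv d) (?a s) (velocity ?a s)"
        by (rule velocity_eqI[OF has_vector_derivative_DD[OF smooth_on_differentiable[OF D.sm aS[OF that]]
              has_velocity[OF smooth_on_differentiable[OF a that]]]])
      then show ?thesis using velocity_cong[OF J that e] by simp
    qed
    have "DD (chart_inv d) (?a t) (nabla_along (metric_in (space_form \<rho>) d) ?a (velocity ?a) t)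
        = cov B \<rho> (\<lambda>s. chart_inv d (?a s)) (\<lambda>s. DD (chart_inv d) (?a s) (velocity ?a s)) t"
      by (rule D.nabla_along_space_form[OF G at smooth_on_differentiable[OF a tJ]
            smooth_on_differentiable[OF smooth_on_velocity[OF J a] tJ]])
    also have "\<dots> = velocity (velocity ?\<eta>) t + (\<rho> * B (velocity ?\<eta> t) (velocity ?\<eta> t)) *\<^sub>R ?\<eta> t"
      using velocity_cong[OF J tJ v] velocity_cong[OF J tJ e] v[OF tJ] e[OF tJ] by (simp add: cov_def)
    also have "\<dots> = 0"
    proof -
      have z: "nabla_along (metric_in M c) (\<lambda>s. snd c (\<gamma> s)) (velocity (\<lambda>s. snd c (\<gamma> s))) t = 0"
        using geo c t by (simp add: geodesic_def o_def)
      note k = curve_chart[OF \<gamma> c(1)]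
      from H.geodesic_acceleration[OF k metric_ind[OF c(1)] tc z] flat[OF c(1) xc]
      show ?thesis
        using velocity_cong[OF k(1) tc curve_Psi[OF \<gamma> c(1)]] acceleration_cong[OF k(1) tc curve_Psi[OF \<gamma> c(1)]]
          curve_Psi[OF \<gamma> c(1) tc] D.B.zero_left by simp
    qed
    finally show "nabla_along (metric_in (space_form \<rho>) d) ?a (velocity ?a) t = 0"
      using D.nondeg[OF at] D.B.zero_left by metis
  qed
qed

lemma locally_totally_geodesicI:
  assumes "\<And>c x u. c \<in> charts M \<Longrightarrow> x \<in> U c \<Longrightarrow> DD (Nu c) x u = 0"
  shows "locally_totally_geodesic M (space_form \<rho> :: ('n \<times> real, 'n) riemannian) \<phi>"
  unfolding locally_totally_geodesic_def totally_geodesic_on_def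
  using totally_geodesic[OF assms] openin_topspace by blast

end

section \<open>Positive curvature\<close>

text \<open>Negation exchanges the two eigenspaces, so the case of a one-dimensional complement
  reduces to that of a one-dimensional \<open>E\<close>.\<close>

lemma (in reflection) reflection_uminus: "reflection (\<lambda>v. - R v)"
proof (rule reflection.intro)
  show "linear (\<lambda>v. - R v)" by (rule linear_compose_neg[OF R_linear])
  show "- R (- R v) = v" for v by (simp add: linear_neg[OF R_linear] R_involution)
  show "- R v \<bullet> w = v \<bullet> - R w" for v w by (simp add: R_sym)
qed

lemma (in reflection) uminus_E: "reflection.E (\<lambda>v. - R v) = E\<^sup>\<bottom>"
proof -
  interpret N: reflection "\<lambda>v. - R v" by (rule reflection_uminus)
  show ?thesis unfolding comp_E N.E_def by (auto simp: minus_equation_iff[of "R _"])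
qed

lemma (in reflection) dim_E_comp: "dim (E\<^sup>\<bottom>) + dim E = DIM('v)"
  using dim_subspace_orthogonal_to_vectors[OF subspace_E subspace_UNIV] by (simp add: orthogonal_comp_def)

lemma (in reflection) dim_E_pos:
  assumes "v \<bullet> v = 1" "v \<bullet> R v = 0"
  shows "dim E > 0"
proof -
  have "P v \<noteq> 0" using norm_PQ(1)[OF assms] by auto
  then have "\<not> E \<subseteq> {0}" using P_in_E[of v] by auto
  then show ?thesis using dim_eq_0[of E] by (metis gr0I)
qed

context space_form_hypersurface
begin

context
  assumes \<rho>: "\<rho> > 0"
begin

lemma amb_inner: "amb \<rho> v w = v \<bullet> w"
  using \<rho> by (simp add: amb_def)

text \<open>Since \<open>\<rho> > 0\<close>, the two alternatives exclude each other at a point.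
  Failure of either is an open condition, so the vanishing of the shape operator is locally
  constant, and connectedness applies.\<close>

lemma shape_dichotomy:
  assumes alt: "\<And>c x. c \<in> charts M \<Longrightarrow> x \<in> U c \<Longrightarrow> (\<forall>u. DD (Nu c) x u = 0) \<or>
    (\<forall>u v. B (DD (Nu c) x u) (DD (Nu c) x v) = \<rho> * B (DD (Psi c) x u) (DD (Psi c) x v))"
  shows "(\<forall>c\<in>charts M. \<forall>x\<in>U c. \<forall>u. DD (Nu c) x u = 0) \<or>
    (\<forall>c\<in>charts M. \<forall>x\<in>U c. \<forall>u v. B (DD (Nu c) x u) (DD (Nu c) x v) = \<rho> * B (DD (Psi c) x u) (DD (Psi c) x v))"
proof -
  define P where "P p \<longleftrightarrow> (\<forall>c\<in>charts M. p \<in> fst c \<longrightarrow> (\<forall>u. DD (Nu c) (snd c p) u = 0))" for p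
  have Pc: "P p \<longleftrightarrow> (\<forall>u. DD (Nu c) (snd c p) u = 0)" if c: "c \<in> charts M" "p \<in> fst c" for c p
    unfolding P_def using c Nu_transfer[OF c(1) _ c(2)] by metis
  have loc: "\<exists>W. openin (mtop M) W \<and> p \<in> W \<and> (\<forall>q\<in>W. P q = P p)" if p: "p \<in> topspace (mtop M)" for p
  proof -
    obtain c where c: "c \<in> charts M" "p \<in> fst c" by (rule chart_cover[OF p])
    let ?x = "snd c p"
    have x: "?x \<in> U c" using c by blast
    have Uo: "open (U c)" by (rule chartD(2)[OF c(1)])
    have nbhd: "\<exists>W. openin (mtop M) W \<and> p \<in> W \<and> (\<forall>q\<in>W. q \<in> fst c \<and> f (snd c q) \<noteq> (0 :: 'w::real_normed_vector))"
      if f: "continuous_on (U c) f" "f ?x \<noteq> 0" for f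
    proof -
      have "open (U c \<inter> f -` (- {0}))"
        by (rule continuous_open_preimage[OF f(1) Uo open_Compl[OF closed_singleton]])
      then have V: "open {y \<in> U c. f y \<noteq> 0}" by (simp add: Int_def vimage_def)
      let ?W = "chart_inv c ` {y \<in> U c. f y \<noteq> 0}"
      have "openin (mtop M) ?W" by (rule chart_preimage_open[OF c(1) V]) blast
      moreover have "p \<in> ?W" using x f(2) chart_inv(1)[OF c] by (intro image_eqI[of _ _ ?x]) auto
      moreover have "q \<in> fst c \<and> f (snd c q) \<noteq> 0" if "q \<in> ?W" for q
        using that chart_inv(2,3)[OF c(1)] by auto
      ultimately show ?thesis by blast
    qed
    show ?thesis
    proof (cases "P p")
      case True
      obtain u0 :: 'm where u0: "u0 \<noteq> 0" using nonzero_Basis SOME_Basis by metis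
      \<comment> \<open>Measures the failure of the second alternative on a fixed nonzero vector. At
        \<open>p\<close> it is nonzero because \<open>DD (Nu c)\<close> vanishes there and
        \<open>\<rho> > 0\<close>; where it stays nonzero, the first alternative must hold.\<close>
      let ?f = "\<lambda>y. DD (Nu c) y u0 \<bullet> DD (Nu c) y u0 - \<rho> * (DD (Psi c) y u0 \<bullet> DD (Psi c) y u0)"
      have fc: "continuous_on (U c) ?f"
        by (intro continuous_intros smooth_on_continuous_on[OF smooth_on_DD[OF Nu_smooth[OF c(1)]]]
            smooth_on_continuous_on[OF smooth_on_DD[OF Psi_smooth[OF c(1)]]])
      have "DD (Nu c) ?x u0 = 0" using True Pc[OF c] by blast
      then have "?f ?x \<noteq> 0" using metric_pos[OF c(1) x u0] \<rho> by (simp add: amb_inner)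
      then obtain W where W: "openin (mtop M) W" "p \<in> W" "\<And>q. q \<in> W \<Longrightarrow> q \<in> fst c \<and> ?f (snd c q) \<noteq> 0"
        using nbhd[OF fc] by blast
      have "P q" if "q \<in> W" for q
      proof -
        have q: "q \<in> fst c" "?f (snd c q) \<noteq> 0" using W(3)[OF that] by auto
        then have "snd c q \<in> U c" by blast
        from alt[OF c(1) this] have "\<forall>u. DD (Nu c) (snd c q) u = 0" using q(2) by (auto simp: amb_inner)
        then show ?thesis using Pc[OF c(1) q(1)] by blast
      qed
      then show ?thesis using W(1,2) True by blast
    next
      case False
      then obtain u where u: "DD (Nu c) ?x u \<noteq> 0" using Pc[OF c] by blast
      obtain W where W: "openin (mtop M) W" "p \<in> W" "\<And>q. q \<in> W \<Longrightarrow> q \<in> fst c \<and> DD (Nu c) (snd c q) u \<noteq> 0"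
        using nbhd[OF smooth_on_continuous_on[OF smooth_on_DD[OF Nu_smooth[OF c(1)]]] u] by blast
      have "\<not> P q" if "q \<in> W" for q using W(3)[OF that] Pc[OF c(1)] by blast
      then show ?thesis using W(1,2) False by blast
    qed
  qed
  show ?thesis
  proof (cases "\<exists>p\<in>topspace (mtop M). P p")
    case True
    then obtain p0 where p0: "p0 \<in> topspace (mtop M)" "P p0" by blast
    have "DD (Nu c) x u = 0" if "c \<in> charts M" "x \<in> U c" for c x u
    proof -
      have "P (chart_inv c x)"
        by (rule connected_space_locally_constant[OF connected_M loc p0 in_topspace[OF that]])
      then show ?thesis using Pc[OF that(1) chart_inv(2)[OF that]] chart_inv(3)[OF that] by simp
    qed
    then show ?thesis by blast
  next
    case False
    have "B (DD (Nu c) x u) (DD (Nu c) x v) = \<rho> * B (DD (Psi c) x u) (DD (Psi c) x v)"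
      if "c \<in> charts M" "x \<in> U c" for c x u v
    proof -
      have "\<not> P (chart_inv c x)" using False in_topspace[OF that] by blast
      then show ?thesis using Pc[OF that(1) chart_inv(2)[OF that]] chart_inv(3)[OF that] alt[OF that] by auto
    qed
    then show ?thesis by blast
  qed
qed

section \<open>The immersion rescaled to the unit sphere, its global reflection and the
  classification\<close>

definition psi :: "'p \<Rightarrow> 'n \<times> real" where "psi p = sqrt \<rho> *\<^sub>R \<phi> p"

abbreviation Psi1 :: "('p, 'm) chart \<Rightarrow> 'm \<Rightarrow> 'n \<times> real" where "Psi1 c x \<equiv> sqrt \<rho> *\<^sub>R Psi c x"

lemma Psi1_psi: "Psi1 c x = psi (chart_inv c x)" by (simp add: psi_def Psi_def)

lemma DD_Psi1:
  assumes "c \<in> charts M" "x \<in> U c"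
  shows "DD (Psi1 c) x u = sqrt \<rho> *\<^sub>R DD (Psi c) x u"
  using fun_cong[OF DD_eq[OF has_derivative_scaleR_right[OF smooth_on_has_derivative[OF Psi_smooth[OF assms(1)] assms(2)]]]] .

context
  assumes isom: "\<And>c x u v. c \<in> charts M \<Longrightarrow> x \<in> U c \<Longrightarrow>
    B (DD (Nu c) x u) (DD (Nu c) x v) = \<rho> * B (DD (Psi c) x u) (DD (Psi c) x v)"
begin

text \<open>The factor \<open>sqrt \<rho>\<close> normalises the position vector and absorbs the
  \<open>\<rho>\<close> in the equation for the shape operator.\<close>

lemma clifford_chart:
  assumes c: "c \<in> charts M"
  shows "clifford_chart (U c) (Psi1 c) (Nu c)"
proof -
  interpret H: hypersurface_chart "U c" "Psi c" B "Nu c" \<rho> "(0, 1)" by (rule hypersurface_chart[OF c])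
  note D = DD_Psi1[OF c]
  show ?thesis
  proof
    show "open (U c)" by (rule chartD(2)[OF c])
    show "smooth_on (Psi1 c) (U c)"
      by (rule smooth_on_bounded_linear[OF bounded_linear_scaleR_right chartD(2)[OF c] Psi_smooth[OF c]])
    show "smooth_on (Nu c) (U c)" by (rule Nu_smooth[OF c])
    fix x u v assume x: "x \<in> U c"
    show "Psi1 c x \<bullet> Psi1 c x = 1" using H.quadric[OF _ x] \<rho> by (simp add: amb_inner)
    show "Nu c x \<bullet> Nu c x = 1" using H.\<nu>_unit[OF x] by (simp add: amb_inner)
    show "Psi1 c x \<bullet> Nu c x = 0" using H.\<nu>_position[OF x] \<rho> by (simp add: amb_inner inner_commute)
    show "Nu c x \<bullet> DD (Psi1 c) x u = 0" using H.\<nu>_normal[OF x, of u] by (simp add: D[OF x] amb_inner)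
    show "DD (Nu c) x u \<bullet> DD (Nu c) x v = DD (Psi1 c) x u \<bullet> DD (Psi1 c) x v"
      using isom[OF c x, of u v] \<rho> by (simp add: D[OF x] amb_inner mult.assoc[symmetric])
    show "u = 0" if "DD (Psi1 c) x u = 0"
      using that metric_pos[OF c x, of u] \<rho> by (auto simp: D[OF x] amb_inner)
  next
    show "DIM('n \<times> real) = DIM('m) + 2" using dim by simp
  qed
qed

text \<open>Both differentials change by the same linear map of coordinates when the chart changes,
  and the conditions on \<open>R\<close> concern all tangent vectors.\<close>

lemma reflects_transfer:
  assumes c: "c \<in> charts M" and c': "c' \<in> charts M" and p: "p \<in> fst c" "p \<in> fst c'"
    and R: "reflects (Psi1 c) (Nu c) (snd c p) R"
  shows "reflects (Psi1 c') (Nu c') (snd c' p) R"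
proof -
  have x: "snd c p \<in> U c" "snd c' p \<in> U c'" using p by auto
  have eq: "Psi1 c' (snd c' p) = Psi1 c (snd c p)" "Nu c' (snd c' p) = Nu c (snd c p)"
    by (simp_all add: Psi_def Nu_def chart_inv(1)[OF c p(1)] chart_inv(1)[OF c' p(2)])
  have "R (DD (Psi1 c') (snd c' p) u) = DD (Nu c') (snd c' p) u" for u
  proof -
    let ?u = "DD (rep (\<lambda>p. p) c' c) (snd c' p) u"
    have "DD (Psi1 c') (snd c' p) u = DD (Psi1 c) (snd c p) ?u"
      by (simp only: DD_Psi1[OF c x(1)] DD_Psi1[OF c' x(2)] Psi_transfer[OF c c' p])
    moreover have "R (DD (Psi1 c) (snd c p) ?u) = DD (Nu c) (snd c p) ?u"
      using R unfolding reflects_def by blast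
    ultimately show ?thesis by (simp only: Nu_transfer[OF c c' p])
  qed
  then show ?thesis using R unfolding reflects_def eq by blast
qed

text \<open>The reflection at one point \<open>p0\<close> is fixed, and the points where it serves
  are shown to be everything: this property is locally constant on the connected space.\<close>

lemma global_reflection:
  assumes p0: "p0 \<in> topspace (mtop M)"
  obtains R where "reflection R" "\<And>c p. c \<in> charts M \<Longrightarrow> p \<in> fst c \<Longrightarrow> reflects (Psi1 c) (Nu c) (snd c p) R"
proof -
  obtain c0 where c0: "c0 \<in> charts M" "p0 \<in> fst c0" by (rule chart_cover[OF p0])
  have x0: "snd c0 p0 \<in> U c0" using c0 by blast
  interpret C0: clifford_chart "U c0" "Psi1 c0" "Nu c0" by (rule clifford_chart[OF c0(1)])
  obtain R where R: "reflects (Psi1 c0) (Nu c0) (snd c0 p0) R" using C0.reflection_exists[OF x0] by blast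
  have refl: "reflection R"
  proof (rule reflection.intro)
    show "linear R" by (rule C0.R_linear[OF x0 R])
    show "R (R v) = v" for v by (rule C0.R_involution[OF x0 R])
    show "R v \<bullet> w = v \<bullet> R w" for v w by (rule C0.R_sym[OF x0 R])
  qed
  define P where "P p \<longleftrightarrow> (\<forall>c\<in>charts M. p \<in> fst c \<longrightarrow> reflects (Psi1 c) (Nu c) (snd c p) R)" for p
  have Pc: "P p \<longleftrightarrow> reflects (Psi1 c) (Nu c) (snd c p) R" if c: "c \<in> charts M" "p \<in> fst c" for c p
    unfolding P_def using c reflects_transfer[OF c(1) _ c(2)] by blast
  have loc: "\<exists>W. openin (mtop M) W \<and> p \<in> W \<and> (\<forall>q\<in>W. P q = P p)" if p: "p \<in> topspace (mtop M)" for p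
  proof -
    obtain c where c: "c \<in> charts M" "p \<in> fst c" by (rule chart_cover[OF p])
    have x: "snd c p \<in> U c" using c by blast
    interpret C: clifford_chart "U c" "Psi1 c" "Nu c" by (rule clifford_chart[OF c(1)])
    obtain Q where Q: "reflects (Psi1 c) (Nu c) (snd c p) Q" using C.reflection_exists[OF x] by blast
    obtain e where e: "e > 0" "ball (snd c p) e \<subseteq> U c" using chartD(2)[OF c(1)] x openE by blast
    let ?W = "chart_inv c ` ball (snd c p) e"
    have W: "openin (mtop M) ?W" by (rule chart_preimage_open[OF c(1) open_ball e(2)])
    have pW: "p \<in> ?W" using chart_inv(1)[OF c] e(1) by (intro image_eqI[of _ _ "snd c p"]) auto
    \<comment> \<open>On the ball a single \<open>Q\<close> serves at all points, and the reflection
      at a point is determined by its values on the frame. So \<open>P q\<close> has the same truth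
      value throughout, namely that of \<open>R = Q\<close>.\<close>
    have Pq: "P q \<longleftrightarrow> R = Q" if "q \<in> ?W" for q
    proof -
      from that obtain y where y: "y \<in> ball (snd c p) e" "q = chart_inv c y" by blast
      have yU: "y \<in> U c" using y(1) e(2) by blast
      have q: "q \<in> fst c" "snd c q = y" unfolding y(2) using chart_inv(2,3)[OF c(1) yU] by auto
      have Qy: "reflects (Psi1 c) (Nu c) y Q" by (rule C.reflection_locally_constant[OF e(2,1) Q y(1)])
      have "R = Q" if Ry: "reflects (Psi1 c) (Nu c) y R"
      proof
        fix w
        obtain z where z: "C.K y z = w" using C.K_surj[OF yU] .
        show "R w = Q w" using C.R_K[OF yU Ry, of z] C.R_K[OF yU Qy, of z] z by simp
      qed
      then show ?thesis using Pc[OF c(1) q(1)] Qy q(2) by blast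
    qed
    have "P q = P p" if "q \<in> ?W" for q using Pq[OF that] Pq[OF pW] by (simp only:)
    then show ?thesis using W pW by blast
  qed
  have P0: "P p0" using Pc[OF c0] R by blast
  have "P p" if "p \<in> topspace (mtop M)" for p
    by (rule connected_space_locally_constant[OF connected_M loc p0 P0 that])
  then have "reflects (Psi1 c) (Nu c) (snd c p) R" if "c \<in> charts M" "p \<in> fst c" for c p
    using that chartD(4) unfolding P_def by blast
  then show thesis using that refl by blast
qed

lemma psi_unit: assumes p: "p \<in> topspace (mtop M)" shows "psi p \<bullet> psi p = 1"
proof -
  obtain c where c: "c \<in> charts M" "p \<in> fst c" by (rule chart_cover[OF p])
  have x: "snd c p \<in> U c" using c by blast
  interpret C: clifford_chart "U c" "Psi1 c" "Nu c" by (rule clifford_chart[OF c(1)])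
  show ?thesis using C.\<psi>\<psi>[OF x] by (simp only: Psi1_psi chart_inv(1)[OF c])
qed

lemma psi_reflected:
  assumes R: "\<And>c p. c \<in> charts M \<Longrightarrow> p \<in> fst c \<Longrightarrow> reflects (Psi1 c) (Nu c) (snd c p) R"
    and p: "p \<in> topspace (mtop M)"
  shows "psi p \<bullet> R (psi p) = 0"
proof -
  obtain c where c: "c \<in> charts M" "p \<in> fst c" by (rule chart_cover[OF p])
  have x: "snd c p \<in> U c" using c by blast
  interpret C: clifford_chart "U c" "Psi1 c" "Nu c" by (rule clifford_chart[OF c(1)])
  have "R (Psi1 c (snd c p)) = Nu c (snd c p)" using R[OF c] by (simp add: reflects_def)
  then have "Psi1 c (snd c p) \<bullet> R (Psi1 c (snd c p)) = 0" using C.\<psi>\<nu>[OF x] by (simp only:)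
  then show ?thesis by (simp only: Psi1_psi chart_inv(1)[OF c])
qed

text \<open>The immersion is injective near \<open>p\<close>, and the open embedding into the torus
  is transported from the chart to \<open>M\<close>. The vector \<open>a0\<close> keeps the
  neighbourhood on one side of a hyperplane, which separates the two sheets when \<open>E\<close> is
  a line.\<close>

lemma local_embedding:
  assumes R: "reflection R" and orth: "\<And>q. q \<in> topspace (mtop M) \<Longrightarrow> psi q \<bullet> R (psi q) = 0"
    and p: "p \<in> topspace (mtop M)" and a0: "psi p \<bullet> a0 > 0"
  obtains W where "openin (mtop M) W" "p \<in> W" "embedding_map (subtopology (mtop M) W) euclidean psi"
    "openin (top_of_set (clifford_torus (reflection.E R))) (psi ` W)" "\<And>q. q \<in> W \<Longrightarrow> psi q \<bullet> a0 > 0"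
proof -
  interpret R: reflection R by (rule R)
  obtain c where c: "c \<in> charts M" "p \<in> fst c" by (rule chart_cover[OF p])
  let ?x = "snd c p"
  have x: "?x \<in> U c" using c by blast
  interpret C: clifford_chart "U c" "Psi1 c" "Nu c" by (rule clifford_chart[OF c(1)])
  have l: "linear (DD (Psi1 c) ?x)"
    by (rule linear_frechet_derivative[OF smooth_on_differentiable[OF C.\<psi> x]])
  have "inj (DD (Psi1 c) ?x)" using C.inj[OF x] l by (simp add: linear_injective_0)
  then obtain r where r: "r > 0" "ball ?x r \<subseteq> U c" "inj_on (Psi1 c) (ball ?x r)"
    by (rule smooth_on_locally_injective[OF C.S x C.\<psi>])
  have cont: "continuous_on (U c) (Psi1 c)" by (rule smooth_on_continuous_on[OF C.\<psi>])
  have "open (U c \<inter> (\<lambda>y. Psi1 c y \<bullet> a0) -` {0<..})"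
    by (rule continuous_open_preimage[OF _ C.S open_greaterThan]) (intro continuous_on_inner cont continuous_on_const)
  then have "open (ball ?x r \<inter> (U c \<inter> (\<lambda>y. Psi1 c y \<bullet> a0) -` {0<..}))" by (rule open_Int[OF open_ball])
  moreover define V where "V = ball ?x r \<inter> (U c \<inter> (\<lambda>y. Psi1 c y \<bullet> a0) -` {0<..})"
  ultimately have V: "open V" by simp
  have VU: "V \<subseteq> U c" and Vb: "V \<subseteq> ball ?x r" and Va: "\<And>y. y \<in> V \<Longrightarrow> Psi1 c y \<bullet> a0 > 0" by (auto simp: V_def)
  have px: "Psi1 c ?x = psi p" by (simp only: Psi1_psi chart_inv(1)[OF c])
  have "Psi1 c ?x \<bullet> a0 > 0" unfolding px by (rule a0)
  then have xV: "?x \<in> V" unfolding V_def using x centre_in_ball[of ?x r] r(1) by blast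
  have tV: "chart_inv c y \<in> topspace (mtop M)" if "y \<in> V" for y using in_topspace[OF c(1)] VU that by blast
  have cV: "continuous_on V (Psi1 c)" by (rule continuous_on_subset[OF cont VU])
  have iV: "inj_on (Psi1 c) V" by (rule inj_on_subset[OF r(3) Vb])
  have u: "Psi1 c y \<bullet> Psi1 c y = 1" "Psi1 c y \<bullet> R (Psi1 c y) = 0" if "y \<in> V" for y
    using psi_unit[OF tV[OF that]] orth[OF tV[OF that]] by (simp_all only: Psi1_psi)
  note emb = R.clifford_torus_open_embedding[OF V cV iV u C.dim]
  let ?W = "chart_inv c ` V"
  have im: "psi ` ?W = Psi1 c ` V" by (simp only: image_image Psi1_psi)
  have Wc: "?W \<subseteq> fst c" using chart_inv(2)[OF c(1)] VU by blast
  have W: "openin (mtop M) ?W" by (rule chart_preimage_open[OF c(1) V VU])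
  have tW: "topspace (subtopology (mtop M) ?W) = ?W" using openin_subset[OF W] by (simp add: Int_absorb1)
  have sW: "snd c ` ?W = V" using chart_inv(3)[OF c(1)] VU by force
  have "homeomorphic_map (subtopology (subtopology (mtop M) (fst c)) ?W) (subtopology (top_of_set (U c)) V) (snd c)"
    by (rule homeomorphic_map_subtopologies[OF chartD(3)[OF c(1)]])
       (use Wc VU sW topspace_chart[OF c(1)] in \<open>simp add: Int_absorb1\<close>)
  then have h1: "homeomorphic_map (subtopology (mtop M) ?W) (top_of_set V) (snd c)"
    using Wc VU by (simp add: subtopology_subtopology Int_absorb1)
  obtain g where g: "homeomorphism V (Psi1 c ` V) (Psi1 c) g" using emb(2) by blast
  have "homeomorphic_maps (top_of_set V) (top_of_set (Psi1 c ` V)) (Psi1 c) g"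
    using g unfolding homeomorphism_def homeomorphic_maps_def by auto
  then have h2: "homeomorphic_map (top_of_set V) (top_of_set (Psi1 c ` V)) (Psi1 c)"
    using homeomorphic_map_maps by blast
  have "homeomorphic_map (subtopology (mtop M) ?W) (top_of_set (Psi1 c ` V)) (Psi1 c \<circ> snd c)"
    by (rule homeomorphic_map_compose[OF h1 h2])
  then have "homeomorphic_map (subtopology (mtop M) ?W) (top_of_set (Psi1 c ` V)) psi"
  proof (rule homeomorphic_map_eq)
    fix q assume "q \<in> topspace (subtopology (mtop M) ?W)"
    then have "q \<in> fst c" unfolding tW using Wc by blast
    then show "(Psi1 c \<circ> snd c) q = psi q" by (simp only: o_apply Psi1_psi chart_inv(1)[OF c(1)])
  qed
  then have e: "embedding_map (subtopology (mtop M) ?W) euclidean psi"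
    unfolding embedding_map_def tW im .
  show thesis
  proof (rule that[OF W _ e])
    show "p \<in> ?W" using xV chart_inv(1)[OF c] by (intro image_eqI[of _ _ ?x]) simp_all
    show "openin (top_of_set (clifford_torus R.E)) (psi ` ?W)" unfolding im by (rule emb(1))
    show "psi q \<bullet> a0 > 0" if "q \<in> ?W" for q using that Va by (auto simp only: Psi1_psi)
  qed
qed

lemma locally_part_of_clifford_torus:
  assumes R: "reflection R" and orth: "\<And>q. q \<in> topspace (mtop M) \<Longrightarrow> psi q \<bullet> R (psi q) = 0"
  shows "locally_part_of M psi (clifford_torus (reflection.E R))"
  unfolding locally_part_of_def
proof
  fix p assume p: "p \<in> topspace (mtop M)"
  \<comment> \<open>For the torus itself any half-space containing \<open>psi p\<close> will do;
    \<open>a0 = psi p\<close> is the simplest choice.\<close>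
  have "psi p \<bullet> psi p > 0" using psi_unit[OF p] by simp
  from local_embedding[OF R orth p this]
  obtain W where W: "openin (mtop M) W" "p \<in> W" "embedding_map (subtopology (mtop M) W) euclidean psi"
    "openin (top_of_set (clifford_torus (reflection.E R))) (psi ` W)" by blast
  then show "\<exists>W F. openin (mtop M) W \<and> p \<in> W \<and> embedding_map (subtopology (mtop M) W) euclidean psi \<and>
      orthogonal_transformation F \<and> openin (top_of_set (clifford_torus (reflection.E R))) (F ` psi ` W)"
    by (intro exI[of _ W] exI[of _ "\<lambda>v. v"]) (simp add: orthogonal_transformation_id)
qed

lemma locally_part_of_small_hypersphere:
  assumes R: "reflection R" and orth: "\<And>q. q \<in> topspace (mtop M) \<Longrightarrow> psi q \<bullet> R (psi q) = 0"
    and dim: "dim (reflection.E R) = 1"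
  shows "locally_part_of M psi small_hypersphere"
  unfolding locally_part_of_def
proof
  interpret R: reflection R by (rule R)
  fix p assume p: "p \<in> topspace (mtop M)"
  \<comment> \<open>The component of \<open>psi p\<close> in the line \<open>E\<close>: its
    half-space contains exactly the sheet of the torus through \<open>psi p\<close>.\<close>
  let ?a = "R.P (psi p)"
  have n: "norm ?a = 1 / sqrt 2" by (rule R.norm_PQ(1)[OF psi_unit[OF p] orth[OF p]])
  have "psi p \<bullet> ?a = 1 / 2" using psi_unit[OF p] orth[OF p] by (simp add: R.P_def inner_add_right)
  then have a: "psi p \<bullet> ?a > 0" by simp
  obtain W where W: "openin (mtop M) W" "p \<in> W" "embedding_map (subtopology (mtop M) W) euclidean psi"
    and t: "openin (top_of_set (clifford_torus R.E)) (psi ` W)" and pos: "\<And>q. q \<in> W \<Longrightarrow> psi q \<bullet> ?a > 0"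
    by (rule local_embedding[OF R orth p a]) blast+
  have Y: "openin (top_of_set {v \<in> sphere 0 1. v \<bullet> ?a = 1 / 2}) (psi ` W)"
    by (rule R.small_hypersphere_open[OF dim t R.P_in_E n]) (use pos in blast)
  obtain F :: "'n \<times> real \<Rightarrow> 'n \<times> real"
    where F: "orthogonal_transformation F" "openin (top_of_set small_hypersphere) (F ` psi ` W)"
    by (rule rotate_small_hypersphere[OF n Y])
  show "\<exists>W F. openin (mtop M) W \<and> p \<in> W \<and> embedding_map (subtopology (mtop M) W) euclidean psi \<and>
      orthogonal_transformation F \<and> openin (top_of_set (small_hypersphere :: ('n \<times> real) set)) (F ` psi ` W)"
    by (intro exI[of _ W] exI[of _ F] conjI W F)
qed

text \<open>Both eigenspaces are nonzero. If one is a line, the hypersphere arises, after replacing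
  \<open>R\<close> by its negative where necessary; otherwise both sphere factors of the torus have
  positive dimension.\<close>

lemma spherical_classification:
  assumes ne: "topspace (mtop M) \<noteq> {}"
  shows "locally_part_of M psi small_hypersphere \<or>
    (\<exists>p E. 0 < p \<and> p < DIM('n) - 1 \<and> subspace E \<and> dim E = p + 1 \<and> locally_part_of M psi (clifford_torus E))"
proof -
  obtain p0 where p0: "p0 \<in> topspace (mtop M)" using ne by blast
  obtain R where R: "reflection R"
    and refl: "\<And>c p. c \<in> charts M \<Longrightarrow> p \<in> fst c \<Longrightarrow> reflects (Psi1 c) (Nu c) (snd c p) R"
    by (rule global_reflection[OF p0]) blast
  interpret R: reflection R by (rule R)
  have orth: "psi q \<bullet> R (psi q) = 0" if "q \<in> topspace (mtop M)" for q by (rule psi_reflected[OF refl that])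
  then have orth': "psi q \<bullet> - R (psi q) = 0" if "q \<in> topspace (mtop M)" for q using that by simp
  interpret N: reflection "\<lambda>v. - R v" by (rule R.reflection_uminus)
  have d1: "dim R.E > 0" by (rule R.dim_E_pos[OF psi_unit[OF p0] orth[OF p0]])
  have d2: "dim N.E > 0" by (rule N.dim_E_pos[OF psi_unit[OF p0] orth'[OF p0]])
  have d: "dim N.E + dim R.E = DIM('n) + 1" using R.dim_E_comp R.uminus_E by simp
  consider "dim R.E = 1" | "dim N.E = 1" | "dim R.E > 1" "dim N.E > 1" using d1 d2 by linarith
  then show ?thesis
  proof cases
    case 1
    then show ?thesis using locally_part_of_small_hypersphere[OF R orth] by blast
  next
    case 2
    then show ?thesis using locally_part_of_small_hypersphere[OF R.reflection_uminus orth'] by blast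
  next
    case 3
    \<comment> \<open>The witness is \<open>p = dim R.E - 1\<close>. As the two dimensions add up to
      \<open>n + 1\<close>, the bound \<open>p < n - 1\<close> says that the complement has
      dimension greater than 1.\<close>
    have "0 < dim R.E - 1" "dim R.E - 1 < DIM('n) - 1" "dim R.E = (dim R.E - 1) + 1"
      using 3 d by linarith+
    then show ?thesis using locally_part_of_clifford_torus[OF R orth] R.subspace_E by blast
  qed
qed

end

end

end

theorem theorem3p1:
  fixes M :: "('p, 'm::euclidean_space) riemannian"
    and \<phi> :: "'p \<Rightarrow> 'n::euclidean_space \<times> real"
    and \<rho> :: real
  assumes "hypersurface M (space_form \<rho> :: ('n \<times> real, 'n) riemannian) \<phi>"
    and "totally_biharmonic M (space_form \<rho> :: ('n \<times> real, 'n) riemannian) \<phi>"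
  shows "(\<rho> \<le> 0 \<longrightarrow> locally_totally_geodesic M (space_form \<rho> :: ('n \<times> real, 'n) riemannian) \<phi>) \<and>
    (\<rho> > 0 \<longrightarrow>
       locally_totally_geodesic M (space_form \<rho> :: ('n \<times> real, 'n) riemannian) \<phi> \<or>
       locally_part_of M (\<lambda>q. sqrt \<rho> *\<^sub>R \<phi> q) small_hypersphere \<or>
       (\<exists>p E. 0 < p \<and> p < DIM('n) - 1 \<and> subspace E \<and> dim E = p + 1 \<and>
          locally_part_of M (\<lambda>q. sqrt \<rho> *\<^sub>R \<phi> q) (clifford_torus E)))"
proof -
  obtain \<xi> where "unit_normal_field M (space_form \<rho> :: ('n \<times> real, 'n) riemannian) \<phi> \<xi>"
    using assms(1) by (auto simp: hypersurface_def)
  then interpret space_form_hypersurface M \<phi> \<rho> \<xi>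
    using assms(1) by unfold_locales
  note alt = shape_alternative_at[OF assms(2)]
  show ?thesis
  proof (intro conjI impI)
    assume \<rho>: "\<rho> \<le> 0"
    have "DD (Nu c) x u = 0" if c: "c \<in> charts M" and x: "x \<in> U c" for c x u
    proof -
      interpret H: hypersurface_chart "U c" "Psi c" B "Nu c" \<rho> "(0, 1)" by (rule hypersurface_chart[OF c])
      show ?thesis using alt[OF c x] H.nonpositive_curvature[OF x \<rho>] by blast
    qed
    then show "locally_totally_geodesic M (space_form \<rho> :: ('n \<times> real, 'n) riemannian) \<phi>"
      by (rule locally_totally_geodesicI)
  next
    assume \<rho>: "\<rho> > 0"
    show "locally_totally_geodesic M (space_form \<rho> :: ('n \<times> real, 'n) riemannian) \<phi> \<or>
       locally_part_of M (\<lambda>q. sqrt \<rho> *\<^sub>R \<phi> q) small_hypersphere \<or>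
       (\<exists>p E. 0 < p \<and> p < DIM('n) - 1 \<and> subspace E \<and> dim E = p + 1 \<and>
          locally_part_of M (\<lambda>q. sqrt \<rho> *\<^sub>R \<phi> q) (clifford_torus E))"
    \<comment> \<open>The classification starts from a base point, so empty \<open>M\<close> is
      treated apart; there every local statement holds vacuously.\<close>
    proof (cases "topspace (mtop M) = {}")
      case True
      then show ?thesis by (simp add: locally_totally_geodesic_def)
    next
      case False
      from shape_dichotomy[OF \<rho> alt]
      show ?thesis
      proof
        assume "\<forall>c\<in>charts M. \<forall>x\<in>U c. \<forall>u. DD (Nu c) x u = 0"
        then show ?thesis using locally_totally_geodesicI by blast
      next
        assume "\<forall>c\<in>charts M. \<forall>x\<in>U c. \<forall>u v. B (DD (Nu c) x u) (DD (Nu c) x v) = \<rho> * B (DD (Psi c) x u) (DD (Psi c) x v)"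
        then have "B (DD (Nu c) x u) (DD (Nu c) x v) = \<rho> * B (DD (Psi c) x u) (DD (Psi c) x v)"
          if "c \<in> charts M" "x \<in> U c" for c x u v using that by blast
        from spherical_classification[OF \<rho> this False]
        show ?thesis unfolding psi_def[OF \<rho>] by blast
      qed
    qed
  qed
qed

end
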